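(* Let $n\ge 1$, $N:=2^n$, and consider the $n$-qubit bilinear control system $\Sigma_b$ $$\dot\rho(t) = -\big(i\hat H_{u}(t) + \Gamma_{\gamma(t)}\big)\rho(t),\qquad \rho(0)=\rho_0\in\mathfrak{P}_1,$$ where $H_u(t)=H_0+\sum_{j=1}^m u_j(t)H_j$, with the bit-flip Lindblad generator on the $n$-th qubit $V_b:=\mathbb{1}_2^{\otimes(n-1)}\otimes\sigma_x/2$. Assume: (i) $\langle iH_0, iH_1,\dots,iH_m\rangle_{\mathrm{Lie}}=\mathfrak{su}(N)$; (ii) $H_0$ is diagonal in the computational basis; (iii) the noise amplitude is a piecewise constant control $\gamma(t)\in\{0,\gamma_*\}$ for a fixed $\gamma_*>0$, and there are no other sources of decoherence. Then for every $\rho_0\in\mathfrak{P}_1$, $$\overline{\mathfrak{Reach}_{\Sigma_b}(\rho_0)}=\{\rho\in\mathfrak{P}_1\,:\,\rho\prec\rho_0\},$$ i.e. every reachable state is majorised by $\rho_0$, and every $\rho\prec\rho_0$ can be approximated arbitrarily well by reachable states (in general only in the limit $\gamma_*T\to\infty$). *)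

theory Defs
  imports "Jordan_Normal_Form.Schur_Decomposition"
begin

definition qdim :: "nat \<Rightarrow> nat" where "qdim n = 2 ^ n"

definition mtrace :: "complex mat \<Rightarrow> complex" where
  "mtrace A = (\<Sum>i<dim_row A. A $$ (i,i))"

definition hermitian_mat :: "complex mat \<Rightarrow> bool" where
  "hermitian_mat A \<longleftrightarrow> mat_adjoint A = A"

definition unitary_mat :: "nat \<Rightarrow> complex mat \<Rightarrow> bool" where
  "unitary_mat N U \<longleftrightarrow> U \<in> carrier_mat N N \<and> U * mat_adjoint U = 1\<^sub>m N \<and> mat_adjoint U * U = 1\<^sub>m N"

definition psd_mat :: "nat \<Rightarrow> complex mat \<Rightarrow> bool" where
  "psd_mat N A \<longleftrightarrow> (\<forall>v :: nat \<Rightarrow> complex.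
      0 \<le> Re (\<Sum>i<N. \<Sum>j<N. cnj (v i) * A $$ (i,j) * v j))"

definition density_mats :: "nat \<Rightarrow> complex mat set" where
  "density_mats N = {A \<in> carrier_mat N N. hermitian_mat A \<and> psd_mat N A \<and> mtrace A = 1}"

definition eigvals_desc :: "nat \<Rightarrow> complex mat \<Rightarrow> real list \<Rightarrow> bool" where
  "eigvals_desc N A l \<longleftrightarrow> length l = N \<and> sorted_wrt (\<ge>) l \<and>
     (\<exists>U. unitary_mat N U \<and>
        A = U * mat N N (\<lambda>(i,j). if i = j then complex_of_real (l ! i) else 0) * mat_adjoint U)"

definition majorised :: "nat \<Rightarrow> complex mat \<Rightarrow> complex mat \<Rightarrow> bool" where
  "majorised N \<rho> \<rho>0 \<longleftrightarrow> (\<exists>l l0. eigvals_desc N \<rho> l \<and> eigvals_desc N \<rho>0 l0 \<and>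
      (\<forall>k\<le>N. sum_list (take k l) \<le> sum_list (take k l0)) \<and> sum_list l = sum_list l0)"

definition kron :: "complex mat \<Rightarrow> complex mat \<Rightarrow> complex mat" where
  "kron A B = mat (dim_row A * dim_row B) (dim_col A * dim_col B)
     (\<lambda>(i,j). A $$ (i div dim_row B, j div dim_col B) * B $$ (i mod dim_row B, j mod dim_col B))"

definition sigma_x :: "complex mat" where
  "sigma_x = mat 2 2 (\<lambda>(i,j). if i \<noteq> j then 1 else 0)"

definition V_bitflip :: "nat \<Rightarrow> complex mat" where
  "V_bitflip n = kron (1\<^sub>m (2 ^ (n - 1))) ((1/2) \<cdot>\<^sub>m sigma_x)"

definition commutator :: "complex mat \<Rightarrow> complex mat \<Rightarrow> complex mat" where
  "commutator A B = A * B - B * A"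

definition lindblad :: "complex mat \<Rightarrow> real \<Rightarrow> complex mat \<Rightarrow> complex mat" where
  "lindblad V g \<rho> = complex_of_real g \<cdot>\<^sub>m
     ((1/2) \<cdot>\<^sub>m (mat_adjoint V * V * \<rho> + \<rho> * (mat_adjoint V * V)) - V * \<rho> * mat_adjoint V)"

definition ham :: "nat \<Rightarrow> nat \<Rightarrow> (nat \<Rightarrow> complex mat) \<Rightarrow> (nat \<Rightarrow> real) \<Rightarrow> complex mat" where
  "ham N m H u = H 0 + fold (\<lambda>j acc. acc + complex_of_real (u j) \<cdot>\<^sub>m H j) [1..<m+1] (0\<^sub>m N N)"

definition rhs :: "nat \<Rightarrow> nat \<Rightarrow> (nat \<Rightarrow> complex mat) \<Rightarrow> (nat \<Rightarrow> real) \<Rightarrow> real \<Rightarrow> complex mat \<Rightarrow> complex mat" where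
  "rhs n m H u g \<rho> = - (\<i> \<cdot>\<^sub>m commutator (ham (qdim n) m H u) \<rho> + lindblad (V_bitflip n) g \<rho>)"

definition pw_const_on :: "real \<Rightarrow> real set \<Rightarrow> (real \<Rightarrow> 'b) \<Rightarrow> bool" where
  "pw_const_on T S f \<longleftrightarrow> finite S \<and>
     (\<forall>a b. 0 \<le> a \<and> a \<le> b \<and> b \<le> T \<and> {a..b} \<inter> S = {} \<longrightarrow> f a = f b)"

definition reach :: "nat \<Rightarrow> nat \<Rightarrow> (nat \<Rightarrow> complex mat) \<Rightarrow> real \<Rightarrow> complex mat \<Rightarrow> complex mat set" where
  "reach n m H gs \<rho>0 = {\<rho>. \<exists>T S (u :: real \<Rightarrow> nat \<Rightarrow> real) (g :: real \<Rightarrow> real) (x :: real \<Rightarrow> complex mat).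
      0 \<le> T \<and> pw_const_on T S u \<and> pw_const_on T S g \<and> (\<forall>t\<in>{0..T}. g t \<in> {0, gs}) \<and>
      (\<forall>t\<in>{0..T}. x t \<in> carrier_mat (qdim n) (qdim n)) \<and>
      (\<forall>i<qdim n. \<forall>j<qdim n. continuous_on {0..T} (\<lambda>t. x t $$ (i,j))) \<and>
      (\<forall>t\<in>{0..T} - S. \<forall>i<qdim n. \<forall>j<qdim n.
          ((\<lambda>s. x s $$ (i,j)) has_vector_derivative (rhs n m H (u t) (g t) (x t) $$ (i,j)))
            (at t within {0..T})) \<and>
      x 0 = \<rho>0 \<and> x T = \<rho>}"

definition mat_closure :: "nat \<Rightarrow> complex mat set \<Rightarrow> complex mat set" where
  "mat_closure N R = {\<rho> \<in> carrier_mat N N. \<forall>e>0. \<exists>\<sigma>\<in>R.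
      \<forall>i<N. \<forall>j<N. cmod (\<sigma> $$ (i,j) - \<rho> $$ (i,j)) < e}"

inductive_set lie_closure :: "complex mat set \<Rightarrow> complex mat set" for G where
  gen: "A \<in> G \<Longrightarrow> A \<in> lie_closure G"
| add: "A \<in> lie_closure G \<Longrightarrow> B \<in> lie_closure G \<Longrightarrow> A + B \<in> lie_closure G"
| smult: "A \<in> lie_closure G \<Longrightarrow> complex_of_real r \<cdot>\<^sub>m A \<in> lie_closure G"
| bracket: "A \<in> lie_closure G \<Longrightarrow> B \<in> lie_closure G \<Longrightarrow> commutator A B \<in> lie_closure G"

definition su :: "nat \<Rightarrow> complex mat set" where
  "su N = {A \<in> carrier_mat N N. mat_adjoint A = - A \<and> mtrace A = 0}"

end

theory Submission
  imports Defs "HOL-Analysis.Analysis" "Jordan_Normal_Form.Spectral_Radius"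
begin

text \<open>
  With \<open>X\<close> the bit flip on the last qubit, the generator is \<open>\<rho> \<mapsto> - i [H, \<rho>] - (\<gamma> / 4) (\<rho> - X \<rho> X)\<close>. To first
  order its flow is a convex combination of unitary conjugations, hence it cannot increase the Ky Fan sums of
  the largest eigenvalues; this bounds the reachable set from above, and the bound is a closed condition.

  Conversely, the tangent directions of the group generated by the noiseless evolutions form a real Lie algebra,
  so by the Lie algebra condition this group is dense in the unitaries modulo phases; backward
  evolutions are approximated by forward ones through recurrence. Trotter's formula then removes the drift from
  the noisy evolution, so that \<open>\<rho> \<mapsto> (1 - q) \<rho> + q X \<rho> X\<close> is available for \<open>0 \<le> q \<le> 1/2\<close>. Applied to a state
  that is diagonal on one pair of levels and Hadamard-rotated on all the others, it averages exactly two
  eigenvalues, and such averagings generate every majorized spectrum.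
\<close>

text \<open>The drift cannot be switched off and time runs only forward, so target states are in
  general only approximated, and every construction is phrased for closures of orbits. Such closures
  compose because each control step is nonexpansive in the Frobenius norm: the commutator is
  orthogonal to the state and the noise term is dissipative, so errors made early are never
  amplified later. A flip probability of exactly 1/2 is the limit of noise of infinite duration;
  this is one place where the closure is essential. The Hadamard rotation appears because its
  columns are eigenvectors of the flip on a pair of levels, so that pair does not feel the noise. In
  the upper bound, eigenvalues are never differentiated in time: a Ky Fan sum is a supremum of
  linear functionals over projections of fixed rank, a family that unitary conjugation maps to
  itself, and an elementary differential inequality for such suprema suffices. Positivity of the
  state is handled by a second family of the same kind.\<close>

hide_const (open) Finite_Cartesian_Product.mat Finite_Cartesian_Product.vec Finite_Cartesian_Product.row

subsection \<open>Finitely supported matrices\<close>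

text \<open>The dimension \<open>2 ^ n\<close> is a term, so no type of fixed size fits. All square matrices are therefore embedded as
  corners \<open>crn n\<close> of one type of finitely supported infinite matrices, which carries the Frobenius inner product
  and a (non-unital) ring structure; \<open>eN n\<close> is the unit of the corner of size \<open>n\<close>.\<close>

typedef fmat = "{f :: nat \<Rightarrow> nat \<Rightarrow> complex. \<exists>n. \<forall>i j. n \<le> i \<or> n \<le> j \<longrightarrow> f i j = 0}"
  morphisms ent Abs_fmat
  by (rule exI[of _ "\<lambda>_ _. 0"]) simp

setup_lifting type_definition_fmat

definition crn :: "nat \<Rightarrow> fmat set" where
  "crn n = {A. \<forall>i j. n \<le> i \<or> n \<le> j \<longrightarrow> ent A i j = 0}"

lemma crnD: "A \<in> crn n \<Longrightarrow> n \<le> i \<or> n \<le> j \<Longrightarrow> ent A i j = 0"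
  by (auto simp: crn_def)

lemma crn_ex: "\<exists>n. A \<in> crn n"
  using ent[of A] by (auto simp: crn_def)

lemma crn_mono: "A \<in> crn n \<Longrightarrow> n \<le> m \<Longrightarrow> A \<in> crn m"
  by (auto simp: crn_def)

lemma crn_ex2: "\<exists>n. A \<in> crn n \<and> B \<in> crn n"
proof -
  obtain a b where "A \<in> crn a" "B \<in> crn b" using crn_ex by metis
  then have "A \<in> crn (max a b) \<and> B \<in> crn (max a b)" by (auto intro: crn_mono)
  then show ?thesis by blast
qed

lemma crn_ex3: "\<exists>n. A \<in> crn n \<and> B \<in> crn n \<and> C \<in> crn n"
proof -
  obtain a b where "A \<in> crn a" "B \<in> crn a" "C \<in> crn b" using crn_ex crn_ex2 by metis
  then have "A \<in> crn (max a b) \<and> B \<in> crn (max a b) \<and> C \<in> crn (max a b)" by (auto intro: crn_mono)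
  then show ?thesis by blast
qed

text \<open>Products and inner products on the type must not mention an ambient size, so they sum
  over the least corner containing an argument; \<open>ent_times_crn\<close> and
  \<open>inner_crn\<close> then allow any larger corner instead.\<close>

definition fdim :: "fmat \<Rightarrow> nat" where "fdim A = (LEAST n. A \<in> crn n)"

lemma fdim_crn: "A \<in> crn (fdim A)"
  unfolding fdim_def using crn_ex by (rule LeastI_ex)

lemma fdim_le: "A \<in> crn n \<Longrightarrow> fdim A \<le> n"
  unfolding fdim_def by (rule Least_le)

lemma fmat_eqI: "(\<And>i j. ent A i j = ent B i j) \<Longrightarrow> A = B"
  by (metis ent_inject ext)

lemma crn_eqI:
  assumes "A \<in> crn n" "B \<in> crn n" "\<And>i j. i < n \<Longrightarrow> j < n \<Longrightarrow> ent A i j = ent B i j"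
  shows "A = B"
proof (rule fmat_eqI)
  fix i j
  show "ent A i j = ent B i j"
    using assms crnD by (cases "i < n \<and> j < n") (simp, metis leI)
qed

definition mkf :: "nat \<Rightarrow> (nat \<Rightarrow> nat \<Rightarrow> complex) \<Rightarrow> fmat" where
  "mkf n f = Abs_fmat (\<lambda>i j. if i < n \<and> j < n then f i j else 0)"

lemma ent_mkf: "ent (mkf n f) i j = (if i < n \<and> j < n then f i j else 0)"
  unfolding mkf_def by (subst Abs_fmat_inverse) (auto intro!: exI[of _ n])

lemma mkf_crn [simp]: "mkf n f \<in> crn n"
  by (auto simp: crn_def ent_mkf)

instantiation fmat :: "{ab_group_add, semigroup_mult, real_vector}"
begin
lift_definition zero_fmat :: fmat is "\<lambda>_ _. 0" by simp
lift_definition plus_fmat :: "fmat \<Rightarrow> fmat \<Rightarrow> fmat" is "\<lambda>f g i j. f i j + g i j"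
proof -
  fix f g :: "nat \<Rightarrow> nat \<Rightarrow> complex"
  assume "\<exists>n. \<forall>i j. n \<le> i \<or> n \<le> j \<longrightarrow> f i j = 0" "\<exists>n. \<forall>i j. n \<le> i \<or> n \<le> j \<longrightarrow> g i j = 0"
  then obtain n m where "\<forall>i j. n \<le> i \<or> n \<le> j \<longrightarrow> f i j = 0" "\<forall>i j. m \<le> i \<or> m \<le> j \<longrightarrow> g i j = 0"
    by blast
  then show "\<exists>n. \<forall>i j. n \<le> i \<or> n \<le> j \<longrightarrow> f i j + g i j = 0"
    by (intro exI[of _ "max n m"]) auto
qed
lift_definition uminus_fmat :: "fmat \<Rightarrow> fmat" is "\<lambda>f i j. - f i j" by simp
definition minus_fmat :: "fmat \<Rightarrow> fmat \<Rightarrow> fmat" where "minus_fmat A B = A + - B"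
lift_definition scaleR_fmat :: "real \<Rightarrow> fmat \<Rightarrow> fmat" is "\<lambda>r f i j. of_real r * f i j"
  by auto
definition times_fmat :: "fmat \<Rightarrow> fmat \<Rightarrow> fmat" where
  "times_fmat A B = mkf (max (fdim A) (fdim B)) (\<lambda>i j. \<Sum>k<fdim A. ent A i k * ent B k j)"

lemma ent_times_crn:
  assumes "A \<in> crn n" shows "ent (A * B) i j = (\<Sum>k<n. ent A i k * ent B k j)"
proof -
  have "(\<Sum>k<fdim A. ent A i k * ent B k j) = (\<Sum>k<n. ent A i k * ent B k j)"
    using fdim_le[OF assms] fdim_crn[of A] by (intro sum.mono_neutral_left) (auto simp: crnD)
  moreover have "(\<Sum>k<fdim A. ent A i k * ent B k j) = 0" if "\<not> (i < max (fdim A) (fdim B) \<and> j < max (fdim A) (fdim B))"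
    proof (intro sum.neutral ballI)
    fix k
    show "ent A i k * ent B k j = 0"
      using that crnD[OF fdim_crn[of A], of i k] crnD[OF fdim_crn[of B], of k j] by (simp add: not_less) argo
  qed
  ultimately show ?thesis unfolding times_fmat_def ent_mkf by auto
qed

instance
proof
  fix A B C :: fmat
  show "A + B + C = A + (B + C)" by transfer (simp add: add.assoc)
  show "A + B = B + A" by transfer (simp add: add.commute)
  show "0 + A = A" by transfer simp
  show "- A + A = 0" by transfer simp
  show "A - B = A + - B" by (simp add: minus_fmat_def)
  fix r s :: real
  show "r *\<^sub>R (A + B) = r *\<^sub>R A + r *\<^sub>R B" by transfer (simp add: algebra_simps)
  show "(r + s) *\<^sub>R A = r *\<^sub>R A + s *\<^sub>R A" by transfer (simp add: algebra_simps)
  show "r *\<^sub>R s *\<^sub>R A = (r * s) *\<^sub>R A" by transfer (simp add: algebra_simps)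
  show "1 *\<^sub>R A = A" by transfer simp
  obtain n where n: "A \<in> crn n" "B \<in> crn n" "C \<in> crn n" using crn_ex3 by metis
  have AB: "A * B \<in> crn n"
    using n by (auto simp: crn_def ent_times_crn[OF n(1)])
  show "A * B * C = A * (B * C)"
  proof (rule fmat_eqI)
    fix i j
    show "ent (A * B * C) i j = ent (A * (B * C)) i j"
      unfolding ent_times_crn[OF AB] ent_times_crn[OF n(1)] ent_times_crn[OF n(2)]
          sum_distrib_left sum_distrib_right mult.assoc by (rule sum.swap)
  qed
qed
end

lemma ent_zero [simp]: "ent 0 i j = 0" by transfer simp
lemma ent_add [simp]: "ent (A + B) i j = ent A i j + ent B i j" by transfer simp
lemma ent_uminus [simp]: "ent (- A) i j = - ent A i j" by transfer simp
lemma ent_diff [simp]: "ent (A - B) i j = ent A i j - ent B i j"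
  unfolding minus_fmat_def ent_add ent_uminus by simp
lemma ent_scaleR [simp]: "ent (r *\<^sub>R A) i j = of_real r * ent A i j" by transfer simp
lemma ent_sum: "ent (\<Sum>x\<in>S. f x) i j = (\<Sum>x\<in>S. ent (f x) i j)"
  by (induction S rule: infinite_finite_induct) auto

lemma ent_times_crn_right:
  assumes "B \<in> crn n" shows "ent (A * B) i j = (\<Sum>k<n. ent A i k * ent B k j)"
proof -
  obtain m where m: "A \<in> crn m" "B \<in> crn m" using crn_ex2 by blast
  have z: "ent A i k * ent B k j = 0" if "m \<le> k \<or> n \<le> k" for k
    using that crnD[OF m(1), of i k] crnD[OF assms, of k j] by auto
  have "(\<Sum>k<min m n. ent A i k * ent B k j) = (\<Sum>k<m. ent A i k * ent B k j)"
    by (intro sum.mono_neutral_left ballI z) auto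
  moreover have "(\<Sum>k<min m n. ent A i k * ent B k j) = (\<Sum>k<n. ent A i k * ent B k j)"
    by (intro sum.mono_neutral_left ballI z) auto
  ultimately show ?thesis by (simp add: ent_times_crn[OF m(1)])
qed

instantiation fmat :: real_inner
begin
definition inner_fmat :: "fmat \<Rightarrow> fmat \<Rightarrow> real" where
  "inner_fmat A B = (\<Sum>i<fdim A. \<Sum>j<fdim A. Re (cnj (ent A i j) * ent B i j))"
definition norm_fmat :: "fmat \<Rightarrow> real" where "norm_fmat A = sqrt (inner A A)"
definition sgn_fmat :: "fmat \<Rightarrow> fmat" where "sgn_fmat A = inverse (norm A) *\<^sub>R A"
definition dist_fmat :: "fmat \<Rightarrow> fmat \<Rightarrow> real" where "dist_fmat A B = norm (A - B)"
definition uniformity_fmat :: "(fmat \<times> fmat) filter" where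
  "uniformity_fmat = (INF e\<in>{0 <..}. principal {(x, y). dist x y < e})"
definition open_fmat :: "fmat set \<Rightarrow> bool" where
  "open_fmat S = (\<forall>x\<in>S. \<forall>\<^sub>F (x', y) in uniformity. x' = x \<longrightarrow> y \<in> S)"

lemma inner_crn:
  assumes "A \<in> crn n"
  shows "inner A B = (\<Sum>i<n. \<Sum>j<n. Re (cnj (ent A i j) * ent B i j))"
proof -
  have "inner A B = (\<Sum>i<fdim A. \<Sum>j<n. Re (cnj (ent A i j) * ent B i j))"
    unfolding inner_fmat_def using fdim_le[OF assms] fdim_crn[of A]
    by (intro sum.cong refl sum.mono_neutral_left) (auto simp: crnD)
  also have "\<dots> = (\<Sum>i<n. \<Sum>j<n. Re (cnj (ent A i j) * ent B i j))"
    using fdim_le[OF assms] fdim_crn[of A]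
    by (intro sum.mono_neutral_left) (auto simp: crnD)
  finally show ?thesis .
qed

instance
proof
  fix A B C :: fmat and r :: real
  obtain n where n: "A \<in> crn n" "B \<in> crn n" "C \<in> crn n" using crn_ex3 by metis
  have n': "A + B \<in> crn n" "r *\<^sub>R A \<in> crn n" using n by (auto simp: crn_def)
  show "dist A B = norm (A - B)" by (rule dist_fmat_def)
  show "sgn A = A /\<^sub>R norm A" by (rule sgn_fmat_def)
  show "uniformity = (INF e\<in>{0 <..}. principal {(x :: fmat, y). dist x y < e})" by (rule uniformity_fmat_def)
  show "open U = (\<forall>x\<in>U. \<forall>\<^sub>F (x', y) in uniformity. x' = x \<longrightarrow> y \<in> U)" for U :: "fmat set" by (rule open_fmat_def)
  show "inner A B = inner B A"
    by (simp add: inner_crn[OF n(1)] inner_crn[OF n(2)] mult.commute)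
  show "inner (A + B) C = inner A C + inner B C"
    by (simp add: inner_crn[OF n(1)] inner_crn[OF n(2)] inner_crn[OF n'(1)] sum.distrib algebra_simps)
  show "inner (r *\<^sub>R A) C = r * inner A C"
    by (simp add: inner_crn[OF n(1)] inner_crn[OF n'(2)] sum_distrib_left algebra_simps)
  have sq: "inner A A = (\<Sum>i<n. \<Sum>j<n. (cmod (ent A i j))\<^sup>2)"
    unfolding inner_crn[OF n(1)] cmod_power2 by (intro sum.cong refl) (simp add: power2_eq_square)
  show "0 \<le> inner A A" unfolding sq by (intro sum_nonneg) auto
  show "inner A A = 0 \<longleftrightarrow> A = 0"
  proof
    assume "inner A A = 0"
    then have "\<And>i j. i < n \<Longrightarrow> j < n \<Longrightarrow> ent A i j = 0" unfolding sq
      by (simp add: sum_nonneg_eq_0_iff sum_nonneg)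
    then show "A = 0" using crn_eqI[OF n(1), of 0] by (simp add: crn_def)
  qed (subst sq, simp)
  show "norm A = sqrt (inner A A)" by (rule norm_fmat_def)
qed
end

lemma norm_crn: "A \<in> crn n \<Longrightarrow> (norm A)\<^sup>2 = (\<Sum>i<n. \<Sum>j<n. (cmod (ent A i j))\<^sup>2)"
  unfolding power2_norm_eq_inner[of A] inner_crn cmod_power2 by (intro sum.cong refl) (simp add: power2_eq_square)

lemma crn_times [simp]: "A \<in> crn n \<Longrightarrow> B \<in> crn n \<Longrightarrow> A * B \<in> crn n"
  unfolding crn_def using ent_times_crn[of A n B] by (auto simp: crn_def)

instance fmat :: real_normed_algebra
proof
  fix A B C :: fmat and r :: real
  obtain n where n: "A \<in> crn n" "B \<in> crn n" "C \<in> crn n" using crn_ex3 by metis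
  have n': "A + B \<in> crn n" "r *\<^sub>R A \<in> crn n" using n by (auto simp: crn_def)
  note e = ent_times_crn[OF n(1)] ent_times_crn[OF n(2)] ent_times_crn[OF n'(1)] ent_times_crn[OF n'(2)]
  show "(A + B) * C = A * C + B * C" by (rule fmat_eqI) (simp add: e algebra_simps sum.distrib)
  show "A * (B + C) = A * B + A * C" by (rule fmat_eqI) (simp add: e algebra_simps sum.distrib)
  show "r *\<^sub>R A * B = r *\<^sub>R (A * B)" by (rule fmat_eqI) (simp add: e algebra_simps sum_distrib_left)
  show "A * r *\<^sub>R B = r *\<^sub>R (A * B)" by (rule fmat_eqI) (simp add: e algebra_simps sum_distrib_left)
  \<comment> \<open>Cauchy-Schwarz for each entry of the product; summed over all entries this is
    submultiplicativity of the Frobenius norm.\<close>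
  have "(cmod (ent (A * B) i j))\<^sup>2 \<le> (\<Sum>k<n. (cmod (ent A i k))\<^sup>2) * (\<Sum>k<n. (cmod (ent B k j))\<^sup>2)" for i j
  proof -
    have "cmod (ent (A * B) i j) \<le> (\<Sum>k<n. \<bar>cmod (ent A i k)\<bar> * \<bar>cmod (ent B k j)\<bar>)"
      unfolding e by (rule order_trans[OF norm_sum]) (simp add: norm_mult)
    also have "\<dots> \<le> L2_set (\<lambda>k. cmod (ent A i k)) {..<n} * L2_set (\<lambda>k. cmod (ent B k j)) {..<n}"
      by (rule L2_set_mult_ineq)
    finally have "(cmod (ent (A * B) i j))\<^sup>2 \<le> (L2_set (\<lambda>k. cmod (ent A i k)) {..<n} * L2_set (\<lambda>k. cmod (ent B k j)) {..<n})\<^sup>2"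
      by (rule power_mono) simp
    then show ?thesis by (simp add: power_mult_distrib L2_set_def sum_nonneg)
  qed
  then have "(norm (A * B))\<^sup>2 \<le> (\<Sum>i<n. \<Sum>j<n. (\<Sum>k<n. (cmod (ent A i k))\<^sup>2) * (\<Sum>k<n. (cmod (ent B k j))\<^sup>2))"
    unfolding norm_crn[OF crn_times[OF n(1,2)]] by (intro sum_mono)
  also have "\<dots> = (norm A)\<^sup>2 * (norm B)\<^sup>2"
    unfolding norm_crn[OF n(1)] norm_crn[OF n(2)] sum.swap[of "\<lambda>i j. (cmod (ent B i j))\<^sup>2"]
    by (rule sum_product[symmetric])
  finally show "norm (A * B) \<le> norm A * norm B"
    by (metis power_mult_distrib power2_le_imp_le mult_nonneg_nonneg norm_ge_zero)
qed

section \<open>Adjoints, complex scalars and diagonal matrices\<close>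

lift_definition adj :: "fmat \<Rightarrow> fmat" is "\<lambda>f i j. cnj (f j i)" by auto
text \<open>The class instances make \<open>fmat\<close> an algebra over the reals only, so complex
  scalars need an operation of their own.\<close>

lift_definition cs :: "complex \<Rightarrow> fmat \<Rightarrow> fmat" is "\<lambda>c f i j. c * f i j" by auto

lemma ent_adj [simp]: "ent (adj A) i j = cnj (ent A j i)" by transfer simp
lemma ent_cs [simp]: "ent (cs c A) i j = c * ent A i j" by transfer simp

definition eN :: "nat \<Rightarrow> fmat" where "eN n = mkf n (\<lambda>i j. if i = j then 1 else 0)"
definition dg :: "nat \<Rightarrow> (nat \<Rightarrow> complex) \<Rightarrow> fmat" where "dg n d = mkf n (\<lambda>i j. if i = j then d i else 0)"

lemma ent_eN: "ent (eN n) i j = (if i = j \<and> i < n then 1 else 0)"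
  by (auto simp: eN_def ent_mkf)
lemma ent_dg: "ent (dg n d) i j = (if i = j \<and> i < n then d i else 0)"
  by (auto simp: dg_def ent_mkf)

lemma eN_crn [simp]: "eN n \<in> crn n" and dg_crn [simp]: "dg n d \<in> crn n"
  by (auto simp: eN_def dg_def)

lemma crn_closed [simp]:
  shows "0 \<in> crn n"
    and "A \<in> crn n \<Longrightarrow> B \<in> crn n \<Longrightarrow> A + B \<in> crn n"
    and "A \<in> crn n \<Longrightarrow> B \<in> crn n \<Longrightarrow> A - B \<in> crn n"
    and "A \<in> crn n \<Longrightarrow> - A \<in> crn n"
    and "A \<in> crn n \<Longrightarrow> r *\<^sub>R A \<in> crn n"
    and "A \<in> crn n \<Longrightarrow> cs c A \<in> crn n"
    and "A \<in> crn n \<Longrightarrow> adj A \<in> crn n"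
  by (auto simp: crn_def)

lemma crn_sum: "(\<And>x. x \<in> S \<Longrightarrow> f x \<in> crn n) \<Longrightarrow> (\<Sum>x\<in>S. f x) \<in> crn n"
  by (induction S rule: infinite_finite_induct) auto

lemma dg_one: "dg n (\<lambda>_. 1) = eN n"
  by (simp add: dg_def eN_def)

lemma ent_dg_left: "ent (dg n d * A) i j = (if i < n then d i * ent A i j else 0)"
proof -
  have "ent (dg n d * A) i j = (\<Sum>k<n. if k = i then d i * ent A i j else 0)"
    unfolding ent_times_crn[OF dg_crn] by (intro sum.cong) (auto simp: ent_dg)
  then show ?thesis by simp
qed

lemma ent_dg_right: "ent (A * dg n d) i j = (if j < n then ent A i j * d j else 0)"
proof -
  have "ent (A * dg n d) i j = (\<Sum>k<n. if k = j then ent A i j * d j else 0)"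
    unfolding ent_times_crn_right[OF dg_crn] by (intro sum.cong) (auto simp: ent_dg)
  then show ?thesis by simp
qed

lemma eN_left [simp]: "A \<in> crn n \<Longrightarrow> eN n * A = A"
  by (rule fmat_eqI) (simp add: ent_dg_left crnD flip: dg_one)

lemma eN_right [simp]: "A \<in> crn n \<Longrightarrow> A * eN n = A"
  by (rule fmat_eqI) (simp add: ent_dg_right crnD flip: dg_one)

lemma adj_simps [simp]:
  "adj 0 = 0" "adj (adj A) = A" "adj (A + B) = adj A + adj B" "adj (A - B) = adj A - adj B" "adj (- A) = - adj A"
  "adj (r *\<^sub>R A) = r *\<^sub>R adj A" "adj (cs c A) = cs (cnj c) (adj A)" "adj (eN n) = eN n"
  "adj (dg n d) = dg n (\<lambda>i. cnj (d i))"
  by (auto intro!: fmat_eqI simp: ent_eN ent_dg)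

lemma adj_times [simp]: "adj (A * B) = adj B * adj A"
proof -
  obtain n where n: "A \<in> crn n" "B \<in> crn n" using crn_ex2 by metis
  have "adj B \<in> crn n" using n by simp
  then show ?thesis
    by (intro fmat_eqI) (simp add: ent_times_crn[OF n(1)] ent_times_crn[of "adj B" n] mult.commute)
qed

lemma cs_simps [simp]:
  "cs c A * B = cs c (A * B)" "A * cs c B = cs c (A * B)" "cs c (cs d A) = cs (c * d) A" "cs 1 A = A" "cs 0 A = 0"
  "cs c 0 = 0" "cs (of_real r) A = r *\<^sub>R A" "cs c (r *\<^sub>R A) = r *\<^sub>R cs c A"
proof -
  obtain n where n: "A \<in> crn n" using crn_ex by blast
  have n': "cs c A \<in> crn n" using n by simp
  show "cs c A * B = cs c (A * B)"
    by (rule fmat_eqI) (simp add: ent_times_crn[OF n] ent_times_crn[OF n'] sum_distrib_left mult.assoc)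
  show "A * cs c B = cs c (A * B)"
    by (rule fmat_eqI) (simp add: ent_times_crn[OF n] sum_distrib_left algebra_simps)
qed (auto intro!: fmat_eqI)

lemma cs_add: "cs c (A + B) = cs c A + cs c B" "cs c (A - B) = cs c A - cs c B" "cs c (- A) = - cs c A"
  by (auto intro!: fmat_eqI simp: algebra_simps)

lemma inner_adj: "inner (adj A) (adj B) = inner A B"
proof -
  obtain n where n: "A \<in> crn n" "B \<in> crn n" using crn_ex2 by metis
  have "adj A \<in> crn n" using n by simp
  then show ?thesis
    unfolding inner_crn[OF n(1)] inner_crn[OF \<open>adj A \<in> crn n\<close>] ent_adj by (subst sum.swap) simp
qed

lemma norm_adj [simp]: "norm (adj A) = norm A"
  unfolding norm_eq_sqrt_inner inner_adj ..

lemma inner_mult_left: "inner (U * A) B = inner A (adj U * B)"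
proof -
  obtain n where n: "A \<in> crn n" "B \<in> crn n" "U \<in> crn n" using crn_ex3 by metis
  have n': "adj U \<in> crn n" "U * A \<in> crn n" using n by simp_all
  have "inner (U * A) B = (\<Sum>i<n. \<Sum>j<n. \<Sum>k<n. Re (cnj (ent U i k) * cnj (ent A k j) * ent B i j))"
    unfolding inner_crn[OF n'(2)] ent_times_crn[OF n(3)] cnj_sum sum_distrib_right Re_sum by simp
  also have "\<dots> = (\<Sum>k<n. \<Sum>j<n. \<Sum>i<n. Re (cnj (ent U i k) * cnj (ent A k j) * ent B i j))"
    (is "(\<Sum>i<n. \<Sum>j<n. \<Sum>k<n. ?f i j k) = _")
  proof -
    have "(\<Sum>i<n. \<Sum>j<n. \<Sum>k<n. ?f i j k) = (\<Sum>i<n. \<Sum>k<n. \<Sum>j<n. ?f i j k)"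
      by (rule sum.cong[OF refl], rule sum.swap)
    also have "\<dots> = (\<Sum>k<n. \<Sum>i<n. \<Sum>j<n. ?f i j k)" by (rule sum.swap)
    also have "\<dots> = (\<Sum>k<n. \<Sum>j<n. \<Sum>i<n. ?f i j k)"
      by (rule sum.cong[OF refl], rule sum.swap)
    finally show ?thesis .
  qed
  also have "\<dots> = inner A (adj U * B)"
    unfolding inner_crn[OF n(1)] ent_times_crn[OF n'(1)] sum_distrib_left Re_sum ent_adj
    by (intro sum.cong refl) (simp only: mult.assoc mult.left_commute)
  finally show ?thesis .
qed

lemma inner_mult_right: "inner (A * U) B = inner A (B * adj U)"
  by (metis adj_simps(2) adj_times inner_adj inner_mult_left)

lemma norm_cs [simp]: "norm (cs c A) = cmod c * norm A"
proof -
  obtain n where n: "A \<in> crn n" using crn_ex by metis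
  then have "cs c A \<in> crn n" by simp
  from norm_crn[OF this] norm_crn[OF n] have "(norm (cs c A))\<^sup>2 = (cmod c * norm A)\<^sup>2"
    by (simp add: power_mult_distrib norm_mult sum_distrib_left)
  then show ?thesis by (simp add: power2_eq_iff_nonneg)
qed

section \<open>Unitary elements of a corner\<close>

definition uni :: "nat \<Rightarrow> fmat set" where
  "uni n = {U \<in> crn n. U * adj U = eN n \<and> adj U * U = eN n}"

lemma uni_D [simp]: "U \<in> uni n \<Longrightarrow> U \<in> crn n" "U \<in> uni n \<Longrightarrow> U * adj U = eN n" "U \<in> uni n \<Longrightarrow> adj U * U = eN n"
  by (auto simp: uni_def)

lemma uni_cancel:
  assumes "U \<in> uni n" "A \<in> crn n"
  shows "U * (adj U * A) = A" "adj U * (U * A) = A" "A * U * adj U = A" "A * adj U * U = A"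
proof -
  have "U * (adj U * A) = (U * adj U) * A" "adj U * (U * A) = (adj U * U) * A"
    "A * U * adj U = A * (U * adj U)" "A * adj U * U = A * (adj U * U)" by (simp_all only: mult.assoc)
  then show "U * (adj U * A) = A" "adj U * (U * A) = A" "A * U * adj U = A" "A * adj U * U = A"
    using assms by simp_all
qed

lemma uni_closed:
  shows "eN n \<in> uni n" and "U \<in> uni n \<Longrightarrow> adj U \<in> uni n" and "U \<in> uni n \<Longrightarrow> V \<in> uni n \<Longrightarrow> U * V \<in> uni n"
proof -
  assume U: "U \<in> uni n" and V: "V \<in> uni n"
  have "U * V * adj (U * V) = U * (V * adj V) * adj U" by (simp only: adj_times mult.assoc)
  then have 1: "U * V * adj (U * V) = eN n" by (simp only: uni_D[OF U] uni_D[OF V] eN_right)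
  have "adj (U * V) * (U * V) = adj V * (adj U * U) * V" by (simp only: adj_times mult.assoc)
  then have 2: "adj (U * V) * (U * V) = eN n"
    using V by (simp only: uni_D[OF U] uni_D[OF V] eN_right crn_closed)
  show "U * V \<in> uni n" unfolding uni_def mem_Collect_eq using U V by (intro conjI 1 2) simp
qed (unfold uni_def, simp_all)

lemma norm_uni_left: assumes "U \<in> uni n" "A \<in> crn n" shows "norm (U * A) = norm A"
  unfolding norm_eq_sqrt_inner inner_mult_left uni_cancel[OF assms] ..

lemma norm_uni_right: assumes "U \<in> uni n" "A \<in> crn n" shows "norm (A * U) = norm A"
  unfolding norm_eq_sqrt_inner inner_mult_right uni_cancel[OF assms] ..

lemma norm_conj: assumes "U \<in> uni n" "A \<in> crn n" shows "norm (U * A * adj U) = norm A"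
  using assms by (simp add: norm_uni_right[of "adj U" n] uni_closed norm_uni_left)

lemma dg_times: "dg n d * dg n d' = dg n (\<lambda>i. d i * d' i)"
  by (rule fmat_eqI) (simp add: ent_dg_left ent_dg)

lemma dg_cong: "(\<And>i. i < n \<Longrightarrow> d i = d' i) \<Longrightarrow> dg n d = dg n d'"
  by (rule fmat_eqI) (simp add: ent_dg)

subsection \<open>Spectral theorem\<close>

text \<open>Vectors are matrices supported in column 0. Matrix action and outer products are then
  products in \<open>fmat\<close>, and a scalar product is a multiple of
  \<open>eN 1\<close>.\<close>

definition colv :: "nat \<Rightarrow> fmat \<Rightarrow> bool" where
  "colv n v \<longleftrightarrow> v \<in> crn n \<and> (\<forall>i j. 0 < j \<longrightarrow> ent v i j = 0)"

definition cip :: "nat \<Rightarrow> fmat \<Rightarrow> fmat \<Rightarrow> complex" where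
  "cip n v w = (\<Sum>i<n. cnj (ent v i 0) * ent w i 0)"

lemma adj_colv_times:
  assumes "colv n v" "colv n w" shows "adj v * w = cs (cip n v w) (eN 1)"
proof (rule fmat_eqI)
  fix i j
  have v: "adj v \<in> crn n" using assms by (simp add: colv_def)
  show "ent (adj v * w) i j = ent (cs (cip n v w) (eN 1)) i j"
    using assms by (cases "i = 0"; cases "j = 0") (auto simp: ent_times_crn[OF v] cip_def colv_def ent_eN)
qed

lemma colv_times_eN1: "colv n v \<Longrightarrow> v * eN 1 = v"
  by (rule fmat_eqI) (auto simp: colv_def ent_dg_right simp flip: dg_one)

lemma colv_closed: "colv n v \<Longrightarrow> colv n (cs c v)" "colv n v \<Longrightarrow> colv n w \<Longrightarrow> colv n (v - w)"
  by (auto simp: colv_def)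

lemma cip_diff: "cip n (v - w) x = cip n v x - cip n w x" "cip n x (v - w) = cip n x v - cip n x w"
  by (simp_all add: cip_def algebra_simps sum_subtractf)

lemma norm_colv:
  assumes "0 < n" "colv n v" shows "cip n v v = of_real ((norm v)\<^sup>2)"
proof -
  have v: "v \<in> crn n" using assms by (simp add: colv_def)
  have "(\<Sum>j<n. (cmod (ent v i j))\<^sup>2) = (cmod (ent v i 0))\<^sup>2" for i
  proof -
    have "(\<Sum>j<n. (cmod (ent v i j))\<^sup>2) = (\<Sum>j\<in>{0}. (cmod (ent v i j))\<^sup>2)"
      using assms by (intro sum.mono_neutral_right) (auto simp: colv_def)
    then show ?thesis by simp
  qed
  then show ?thesis
    unfolding norm_crn[OF v] cip_def of_real_sum[symmetric]
    by (simp only: mult.commute of_real_sum complex_norm_square)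
qed

lemma eigenvector_exists:
  assumes "0 < n" "A \<in> crn n"
  shows "\<exists>v k. colv n v \<and> norm v = 1 \<and> A * v = cs k v"
proof -
  define M where "M = mat n n (\<lambda>(i,j). ent A i j)"
  have M: "M \<in> carrier_mat n n" by (simp add: M_def)
  obtain k where "eigenvalue M k" using spectrum_non_empty[OF M] assms(1) by (auto simp: spectrum_def)
  then obtain x where x: "x \<in> carrier_vec n" "x \<noteq> 0\<^sub>v n" "M *\<^sub>v x = k \<cdot>\<^sub>v x"
    using M by (auto simp: eigenvalue_def eigenvector_def)
  define w where "w = mkf n (\<lambda>i j. if j = 0 then vec_index x i else 0)"
  have cw: "colv n w" by (auto simp: colv_def w_def ent_mkf)
  have "w \<noteq> 0"
  proof
    assume "w = 0"
    then have ez: "ent w i 0 = 0" for i by simp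
    have "vec_index x i = 0" if "i < n" for i using that ez[of i] assms(1) by (simp add: w_def ent_mkf)
    then have "x = 0\<^sub>v n" using x(1) by (intro eq_vecI) auto
    then show False using x(2) by simp
  qed
  have "A * w = cs k w"
  proof (rule crn_eqI[of _ n])
    fix i j assume "i < n" "j < n"
    have "vec_index (M *\<^sub>v x) i = (\<Sum>l<n. ent A i l * vec_index x l)"
      using x(1) \<open>i < n\<close> M by (simp add: M_def scalar_prod_def atLeast0LessThan)
    then have "(\<Sum>l<n. ent A i l * vec_index x l) = k * vec_index x i"
      using x \<open>i < n\<close> by simp
    then show "ent (A * w) i j = ent (cs k w) i j"
      using \<open>i < n\<close> \<open>j < n\<close> by (simp add: ent_times_crn[OF assms(2)] w_def ent_mkf)
  qed (use assms in \<open>auto simp: w_def\<close>)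
  then have "A * cs (of_real (inverse (norm w))) w = cs k (cs (of_real (inverse (norm w))) w)"
    by (simp add: mult.commute del: cs_simps(7) of_real_inverse)
  moreover have "colv n (cs (of_real (inverse (norm w))) w)" using cw colv_closed by blast
  moreover have "norm (cs (of_real (inverse (norm w))) w) = 1" using \<open>w \<noteq> 0\<close> by (simp add: norm_inverse)
  ultimately show ?thesis by blast
qed

text \<open>A Householder reflection, after a phase change making the last entry of \<open>v\<close> real.\<close>

lemma householder:
  assumes v: "colv (Suc n) v" "norm v = 1"
  defines "u \<equiv> mkf (Suc n) (\<lambda>i j. if i = n \<and> j = 0 then 1 else 0)"
  shows "\<exists>U\<in>uni (Suc n). \<exists>z. U * u = cs z v"
proof -
  let ?N = "Suc n"
  define a where "a = ent v n 0"
  \<comment> \<open>The phase that turns the last entry into its modulus; if that entry is 0, any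
    phase will do.\<close>
  define z where "z = (if a = 0 then 1 else cnj a / of_real (cmod a))"
  define r where "r = cmod a"
  define v' where "v' = cs z v"
  have z: "cmod z = 1" by (auto simp: z_def norm_divide)
  have za: "z * a = of_real r"
    by (auto simp: z_def r_def complex_norm_square[symmetric] mult.commute power2_eq_square)
  have u: "colv ?N u" by (auto simp: colv_def u_def ent_mkf)
  have v': "colv ?N v'" unfolding v'_def using v colv_closed by blast
  have entu: "ent u i 0 = (if i = n then 1 else 0)" for i by (simp add: u_def ent_mkf)
  have entv': "ent v' n 0 = of_real r" using za by (simp add: v'_def a_def)
  have uu: "cip ?N u u = 1" by (simp add: cip_def entu)
  have uv: "cip ?N u v' = of_real r" by (simp add: cip_def entu entv')
  have vu: "cip ?N v' u = of_real r" by (simp add: cip_def entu entv')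
  have vv: "cip ?N v' v' = 1" using norm_colv[OF _ v'] v(2) z by (simp add: v'_def)
  \<comment> \<open>\<open>u\<close> and \<open>v'\<close> are unit vectors with a real scalar
    product, so the reflection along their difference exchanges them.\<close>
  define w where "w = v' - u"
  have w: "colv ?N w" unfolding w_def using u v' colv_closed by blast
  have ww: "cip ?N w w = of_real (2 - 2 * r)"
    unfolding w_def cip_diff uu uv vu vv by simp
  have wu: "cip ?N w u = of_real (r - 1)" unfolding w_def cip_diff uu vu by simp
  show ?thesis
  proof (cases "r = 1")
    case True
    then have "norm w = 0" using norm_colv[OF _ w] ww by simp
    then have "u = v'" by (simp add: w_def)
    then have "eN ?N * u = cs z v" using u v(1) by (simp add: colv_def v'_def)
    then show ?thesis using uni_closed(1) by blast
  next
    case False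
    \<comment> \<open>The usual Householder factor, 2 divided by the squared norm
      \<open>2 - 2 * r\<close> of \<open>w\<close>.\<close>
    define c where "c = 1 / (1 - r)"
    define U where "U = eN ?N - c *\<^sub>R (w * adj w)"
    have wc: "w \<in> crn ?N" using w by (simp add: colv_def)
    have U: "adj U = U" by (simp add: U_def)
    have e1: "w * adj w * (w * adj w) = (2 - 2 * r) *\<^sub>R (w * adj w)"
    proof -
      have "w * adj w * (w * adj w) = w * (adj w * w) * adj w" by (simp only: mult.assoc)
      also have "adj w * w = (2 - 2 * r) *\<^sub>R eN 1" by (simp only: adj_colv_times[OF w w] ww cs_simps)
      also have "w * \<dots> * adj w = (2 - 2 * r) *\<^sub>R (w * eN 1 * adj w)" by simp
      finally show ?thesis by (simp only: colv_times_eN1[OF w])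
    qed
    have "U * U = eN ?N - (2 * c) *\<^sub>R (w * adj w) + (c * c) *\<^sub>R (w * adj w * (w * adj w))"
      using wc by (simp add: U_def algebra_simps scaleR_2 flip: scaleR_scaleR)
    also have "\<dots> = eN ?N + (c * c * (2 - 2 * r) - 2 * c) *\<^sub>R (w * adj w)"
      unfolding e1 by (simp add: algebra_simps)
    also have "c * c * (2 - 2 * r) - 2 * c = 0"
    proof -
      have "c * (1 - r) = 1" using False by (simp add: c_def)
      moreover have "c * c * (2 - 2 * r) = 2 * c * (c * (1 - r))" by (simp add: algebra_simps)
      ultimately show ?thesis by simp
    qed
    finally have UU: "U * U = eN ?N" by simp
    have "w * adj w * u = w * (adj w * u)" by (simp only: mult.assoc)
    also have "adj w * u = (r - 1) *\<^sub>R eN 1" by (simp only: adj_colv_times[OF w u] wu cs_simps)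
    also have "w * \<dots> = (r - 1) *\<^sub>R (w * eN 1)" by simp
    finally have wwu: "w * adj w * u = (r - 1) *\<^sub>R w" by (simp only: colv_times_eN1[OF w])
    have "U * u = u - (c * (r - 1)) *\<^sub>R w"
      using u by (simp add: U_def left_diff_distrib wwu colv_def)
    also have "c * (r - 1) = - 1" using False by (simp add: c_def field_simps)
    finally have "U * u = cs z v" by (simp add: w_def v'_def)
    moreover have "U \<in> uni ?N" unfolding uni_def using U UU wc by (simp add: U_def)
    ultimately show ?thesis by blast
  qed
qed

text \<open>\<open>eN (Suc n) - eN n\<close> projects onto the last coordinate and annihilates the
  corner of size \<open>n\<close>. Sums of an element of that corner and a multiple of this
  projection therefore multiply blockwise.\<close>

lemma eN_diff_times:
  assumes "A \<in> crn n"
  shows "A * (eN (Suc n) - eN n) = 0" "(eN (Suc n) - eN n) * A = 0"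
  using assms crn_mono[OF assms, of "Suc n"] by (simp_all add: algebra_simps)

lemma eN_diff_idem: "(eN (Suc n) - eN n) * (eN (Suc n) - eN n) = eN (Suc n) - eN n"
  using crn_mono[OF eN_crn, of n "Suc n"] by (simp add: algebra_simps)

text \<open>Induction on the size: a unitary moves an eigenvector to the last coordinate, and
  normality then clears both the last column and the last row. What remains is a normal matrix in
  the smaller corner plus a scalar block.\<close>

theorem normal_spectral:
  assumes "A \<in> crn n" "A * adj A = adj A * A"
  shows "\<exists>U\<in>uni n. \<exists>d. A = U * dg n d * adj U"
  using assms
proof (induction n arbitrary: A)
  case 0
  then have "A = 0" by (intro crn_eqI[of A 0 0]) auto
  moreover have "dg 0 (\<lambda>_. 0) = 0" by (rule crn_eqI[of _ 0]) auto
  ultimately have "A = eN 0 * dg 0 (\<lambda>_. 0) * adj (eN 0)" by simp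
  then show ?case using uni_closed(1) by blast
next
  case (Suc n)
  let ?N = "Suc n"
  define E where "E = eN (Suc n) - eN n"
  obtain v k where v: "colv ?N v" "norm v = 1" "A * v = cs k v"
    using eigenvector_exists[OF _ Suc.prems(1)] by blast
  define u where "u = mkf (Suc n) (\<lambda>i j. if i = n \<and> j = 0 then 1 else 0)"
  obtain U z where U: "U \<in> uni ?N" "U * u = cs z v"
    using householder[OF v(1,2)] unfolding u_def by blast
  have uc: "u \<in> crn ?N" by (simp add: u_def)
  define B where "B = adj U * A * U"
  have B: "B \<in> crn ?N" unfolding B_def using U Suc.prems by simp
  have AB: "A = U * B * adj U"
    unfolding B_def using U(1) Suc.prems(1) by (simp add: mult.assoc uni_cancel uni_closed(2))
  have BB: "B * adj B = adj B * B"
  proof -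
    have "B * adj B = adj U * (A * (U * adj U) * adj A) * U" by (simp add: B_def mult.assoc)
    also have "\<dots> = adj U * (adj A * (U * adj U) * A) * U" using U(1) Suc.prems by simp
    also have "\<dots> = adj B * B" by (simp add: B_def mult.assoc)
    finally show ?thesis .
  qed
  have Bu: "B * u = cs k u"
  proof -
    have "B * u = adj U * (A * (U * u))" by (simp add: B_def mult.assoc)
    also have "\<dots> = cs k (adj U * (U * u))" unfolding U(2) by (simp add: v mult.commute)
    finally show ?thesis by (simp only: uni_cancel[OF U(1) uc])
  qed
  define F where "F = B - cs k (eN ?N)"
  have F: "F \<in> crn ?N" by (simp add: F_def B)
  have FF: "F * adj F = adj F * F" using B by (simp add: F_def algebra_simps BB cs_add)
  have "F * u = 0" using Bu uc by (simp add: F_def left_diff_distrib)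
  \<comment> \<open>Normality makes \<open>adj F * u\<close> as long as \<open>F * u\<close>, which
    is 0; so the last row vanishes together with the last column.\<close>
  have "inner (adj F * u) (adj F * u) = inner u (F * adj F * u)" by (simp add: inner_mult_left mult.assoc)
  also have "F * adj F * u = adj F * (F * u)" by (simp only: FF mult.assoc)
  finally have "adj F * u = 0" using \<open>F * u = 0\<close> by simp
  have colF: "ent F i n = ent (F * u) i 0" "ent (adj F) i n = ent (adj F * u) i 0" for i
    unfolding ent_times_crn_right[OF uc] by (simp_all add: u_def ent_mkf if_distrib[of "\<lambda>x. _ * x"] cong: if_cong)
  have colz: "ent F i n = 0" "ent F n i = 0" for i
    using colF[of i] \<open>F * u = 0\<close> \<open>adj F * u = 0\<close> by simp_all
  define C where "C = B - cs k E"
  have "ent C i j = 0" if "n \<le> i \<or> n \<le> j" for i j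
  proof (cases "i < ?N \<and> j < ?N")
    case True
    then have "ent C i j = ent F i j" using that by (auto simp: C_def F_def E_def ent_eN)
    moreover have "i = n \<or> j = n" using True that by auto
    ultimately show ?thesis using colz by auto
  next
    case False
    then have "ent B i j = 0" using crnD[OF B] by auto
    then show ?thesis using False by (auto simp: C_def E_def ent_eN)
  qed
  then have C: "C \<in> crn n" by (simp add: crn_def)
  have BC: "B = C + cs k E" by (simp add: C_def)
  have Ead: "adj E = E" by (simp add: E_def)
  note zs = eN_diff_times[of _ n, folded E_def] eN_diff_idem[of n, folded E_def] Ead
  have CC: "C * adj C = adj C * C"
    using BB C unfolding BC by (simp add: algebra_simps zs)
  from Suc.IH[OF C CC] obtain W d where W: "W \<in> uni n" and Cd: "C = W * dg n d * adj W" by blast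
  define W' where "W' = W + E"
  have Ecrn: "E \<in> crn ?N" using crn_mono[OF eN_crn, of n ?N] by (simp add: E_def)
  have W': "W' \<in> uni ?N"
    unfolding uni_def using W Ecrn crn_mono[of W n ?N]
    by (simp add: W'_def algebra_simps zs) (simp add: E_def)
  have dd: "dg ?N (d(n := k)) = dg n d + cs k E"
    by (rule fmat_eqI) (auto simp: ent_dg E_def ent_eN)
  have "W' * dg ?N (d(n := k)) * adj W' = B"
    unfolding BC Cd dd W'_def using W by (simp add: algebra_simps zs)
  moreover have "(U * W') * dg ?N (d(n := k)) * adj (U * W') = U * (W' * dg ?N (d(n := k)) * adj W') * adj U"
    by (simp only: adj_times mult.assoc)
  ultimately have "A = (U * W') * dg ?N (d(n := k)) * adj (U * W')"
    using AB by simp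
  moreover have "U * W' \<in> uni ?N" using U W' uni_closed by blast
  ultimately show ?case by blast
qed

subsection \<open>Exponentials of skew-Hermitian matrices\<close>

abbreviation rdg :: "nat \<Rightarrow> (nat \<Rightarrow> real) \<Rightarrow> fmat" where
  "rdg n l \<equiv> dg n (\<lambda>i. of_real (l i))"
abbreviation idg :: "nat \<Rightarrow> (nat \<Rightarrow> real) \<Rightarrow> fmat" where
  "idg n l \<equiv> dg n (\<lambda>i. \<i> * of_real (l i))"
abbreviation edg :: "nat \<Rightarrow> (nat \<Rightarrow> real) \<Rightarrow> real \<Rightarrow> fmat" where
  "edg n l t \<equiv> dg n (\<lambda>i. exp (\<i> * of_real (l i) * of_real t))"

lemma spectral_middle:
  assumes "V \<in> uni n" "A = V * dg n d * adj V" shows "dg n d = adj V * A * V"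
proof -
  have "adj V * A * V = (adj V * V) * dg n d * (adj V * V)" unfolding assms(2) by (simp only: mult.assoc)
  then show ?thesis using assms(1) by simp
qed

lemma dg_inject: "dg n d = dg n d' \<Longrightarrow> i < n \<Longrightarrow> d i = d' i"
  by (metis ent_dg)

lemma hermitian_spectral:
  assumes "A \<in> crn n" "adj A = A"
  shows "\<exists>V\<in>uni n. \<exists>l. A = V * rdg n l * adj V"
proof -
  obtain V d where V: "V \<in> uni n" "A = V * dg n d * adj V" using normal_spectral[OF assms(1)] assms(2) by auto
  have "adj (dg n d) = dg n d" unfolding spectral_middle[OF V] using assms(2) by (simp add: mult.assoc)
  then have "cnj (d i) = d i" if "i < n" for i using dg_inject[of n "\<lambda>i. cnj (d i)" d i] that by simp
  then have "dg n d = dg n (\<lambda>i. of_real (Re (d i)))"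
    by (intro dg_cong) (simp add: complex_eq_iff)
  then show ?thesis using V by metis
qed

lemma unitary_spectral:
  assumes "U \<in> uni n"
  shows "\<exists>V\<in>uni n. \<exists>l. U = V * dg n (\<lambda>i. exp (\<i> * of_real (l i))) * adj V"
proof -
  have "U * adj U = adj U * U" using assms by simp
  then obtain V d where V: "V \<in> uni n" "U = V * dg n d * adj V"
    using normal_spectral[OF uni_D(1)[OF assms]] by blast
  have "dg n d \<in> uni n" unfolding spectral_middle[OF V] by (intro uni_closed V(1) assms)
  then have "dg n d * adj (dg n d) = eN n" by (rule uni_D)
  then have "dg n (\<lambda>i. d i * cnj (d i)) = dg n (\<lambda>_. 1)" by (simp add: dg_times dg_one)
  from dg_inject[OF this] have "d i * cnj (d i) = 1" if "i < n" for i using that by simp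
  then have "complex_of_real ((cmod (d i))\<^sup>2) = of_real 1" if "i < n" for i
    using that unfolding complex_norm_square by simp
  then have "(cmod (d i))\<^sup>2 = 1" if "i < n" for i
    using that by (simp only: of_real_eq_iff)
  then have dn: "cmod (d i) = 1" if "i < n" for i using that abs_square_eq_1[of "cmod (d i)"] by simp
  have "d i = exp (\<i> * of_real (Arg (d i)))" if "i < n" for i
  proof -
    have "d i \<noteq> 0" using dn[OF that] by auto
    from Arg_eq[OF this] have "d i = of_real (cmod (d i)) * exp (\<i> * of_real (Arg (d i)))" .
    also have "\<dots> = exp (\<i> * of_real (Arg (d i)))" by (simp only: dn[OF that] of_real_1 mult_1_left)
    finally show ?thesis .
  qed
  then have "dg n d = dg n (\<lambda>i. exp (\<i> * of_real (Arg (d i))))" by (rule dg_cong)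
  then show ?thesis using V by metis
qed

lemma skew_spectral:
  assumes "K \<in> crn n" "adj K = - K"
  shows "\<exists>V\<in>uni n. \<exists>l. K = V * idg n l * adj V"
proof -
  have "adj (cs (- \<i>) K) = cs (- \<i>) K"
    unfolding adj_simps(7) assms(2) by (rule fmat_eqI) simp
  then obtain V l where V: "V \<in> uni n" "cs (- \<i>) K = V * rdg n l * adj V"
    using hermitian_spectral[of "cs (- \<i>) K" n] assms(1) by auto
  have "K = cs \<i> (cs (- \<i>) K)" by simp
  also have "\<dots> = V * cs \<i> (rdg n l) * adj V" unfolding V(2) by simp
  also have "cs \<i> (rdg n l) = idg n l"
    by (rule fmat_eqI) (simp add: ent_dg)
  finally show ?thesis using V(1) by blast
qed

lemma norm_dg_le: "norm (dg n d) \<le> (\<Sum>i<n. cmod (d i))"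
proof -
  have "(norm (dg n d))\<^sup>2 = (\<Sum>i<n. (cmod (d i))\<^sup>2)"
  proof -
    have "(\<Sum>j<n. (cmod (ent (dg n d) i j))\<^sup>2) = (\<Sum>j<n. if j = i then (cmod (d i))\<^sup>2 else 0)" if "i < n" for i
      using that by (intro sum.cong) (auto simp: ent_dg)
    then show ?thesis unfolding norm_crn[OF dg_crn] by simp
  qed
  then have "norm (dg n d) = L2_set (\<lambda>i. cmod (d i)) {..<n}"
    unfolding L2_set_def by (metis norm_ge_zero real_sqrt_abs abs_of_nonneg)
  then show ?thesis by (simp add: L2_set_le_sum)
qed

lemma cmod_ent_le: "cmod (ent A i j) \<le> norm A"
proof -
  obtain n where n: "A \<in> crn n" using crn_ex by blast
  show ?thesis
  proof (cases "i < n \<and> j < n")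
    case True
    have "(cmod (ent A i j))\<^sup>2 \<le> (\<Sum>j<n. (cmod (ent A i j))\<^sup>2)"
      using True by (intro member_le_sum) auto
    also have "\<dots> \<le> (norm A)\<^sup>2" unfolding norm_crn[OF n]
      using True by (intro member_le_sum[of i "{..<n}" "\<lambda>i. \<Sum>j<n. (cmod (ent A i j))\<^sup>2"]) (auto intro: sum_nonneg)
    finally show ?thesis by (rule power2_le_imp_le) simp
  next
    case False
    then show ?thesis using crnD[OF n, of i j] by auto
  qed
qed

section \<open>Entrywise calculus and a Taylor estimate\<close>

lemma bounded_linear_ent: "bounded_linear (\<lambda>A. ent A i j)"
  by (rule bounded_linear_intro[of _ 1]) (auto simp: cmod_ent_le scaleR_conv_of_real)

lemma bounded_linear_cs: "bounded_linear (\<lambda>c. cs c A)"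
  by (rule bounded_linear_intro[of _ "norm A"]) (auto intro!: fmat_eqI simp: algebra_simps scaleR_conv_of_real)

abbreviation munit :: "nat \<Rightarrow> nat \<Rightarrow> nat \<Rightarrow> fmat" where
  "munit n i j \<equiv> mkf n (\<lambda>k l. if k = i \<and> l = j then 1 else 0)"

text \<open>Inside a corner the expansion into matrix units is a finite sum, which lets derivatives,
  continuity and limits be checked entry by entry.\<close>

lemma fmat_expand:
  assumes "A \<in> crn n"
  shows "A = (\<Sum>i<n. \<Sum>j<n. cs (ent A i j) (munit n i j))"
proof (rule crn_eqI[of _ n])
  fix k l assume kl: "k < n" "l < n"
  have "(\<Sum>j<n. ent A i j * (if k = i \<and> l = j then 1 else 0)) = (\<Sum>j<n. if j = l then (if k = i then ent A i l else 0) else 0)" for i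
    by (intro sum.cong) auto
  then have "(\<Sum>j<n. ent A i j * (if k = i \<and> l = j then 1 else 0)) = (if i = k then ent A i l else 0)" for i
    using kl by simp
  then show "ent A k l = ent (\<Sum>i<n. \<Sum>j<n. cs (ent A i j) (munit n i j)) k l"
    using kl by (simp add: ent_sum ent_mkf)
qed (auto intro!: crn_sum assms)

lemma has_vector_derivative_crnI:
  assumes "\<And>t. f t \<in> crn n" "D \<in> crn n"
    and "\<And>i j. i < n \<Longrightarrow> j < n \<Longrightarrow> ((\<lambda>t. ent (f t) i j) has_vector_derivative ent D i j) F"
  shows "(f has_vector_derivative D) F"
proof -
  have "((\<lambda>t. \<Sum>i<n. \<Sum>j<n. cs (ent (f t) i j) (munit n i j))
     has_vector_derivative (\<Sum>i<n. \<Sum>j<n. cs (ent D i j) (munit n i j))) F"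
    using assms(3) by (intro has_vector_derivative_sum bounded_linear.has_vector_derivative[OF bounded_linear_cs]) auto
  then show ?thesis
    using fmat_expand[OF assms(1)] fmat_expand[OF assms(2)] by simp
qed

lemma continuous_on_crnI:
  assumes "\<And>t. f t \<in> crn n"
    and "\<And>i j. i < n \<Longrightarrow> j < n \<Longrightarrow> continuous_on S (\<lambda>t. ent (f t) i j)"
  shows "continuous_on S f"
proof -
  have "continuous_on S (\<lambda>t. \<Sum>i<n. \<Sum>j<n. cs (ent (f t) i j) (munit n i j))"
    using assms(2) by (intro continuous_on_sum bounded_linear.continuous_on[OF bounded_linear_cs]) auto
  then show ?thesis using fmat_expand[OF assms(1)] by simp
qed

lemma bounded_linear_adj: "bounded_linear adj"
  by (rule bounded_linear_intro[of _ 1]) auto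

text \<open>Speed at most \<open>B\<close> keeps \<open>y\<close> within \<open>B * h\<close> of its
  start, so the velocity varies by at most \<open>M * B * h\<close>; one more integration gives the
  quadratic remainder. The bounds on \<open>G\<close> are required only along \<open>y\<close>,
  because the estimates for the generator hold only inside a corner.\<close>

lemma linear_ode_taylor:
  fixes y :: "real \<Rightarrow> 'a::real_normed_vector"
  assumes "0 \<le> h" and y: "\<And>s. s \<in> {0..h} \<Longrightarrow> (y has_vector_derivative G (y s)) (at s within {0..h})"
    and G: "\<And>s. s \<in> {0..h} \<Longrightarrow> norm (G (y s) - G (y 0)) \<le> M * norm (y s - y 0)"
    and B: "\<And>s. s \<in> {0..h} \<Longrightarrow> norm (G (y s)) \<le> B" and "0 \<le> M"
  shows "norm (y h - y 0 - h *\<^sub>R G (y 0)) \<le> M * B * h\<^sup>2"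
proof -
  have B0: "0 \<le> B" using order_trans[OF norm_ge_zero B[of 0]] assms(1) by simp
  have 1: "norm (y s - y 0) \<le> B * h" if s: "s \<in> {0..h}" for s
  proof -
    have "norm (y s - y 0) \<le> B * norm (s - 0)"
      using y B s by (intro differentiable_bound[of "{0..h}" y "\<lambda>x u. u *\<^sub>R G (y x)"])
        (auto simp: has_vector_derivative_def onorm_scaleR_left[OF bounded_linear_ident] onorm_id)
    also have "\<dots> \<le> B * h" using s B0 by (intro mult_left_mono) auto
    finally show ?thesis .
  qed
  define g where "g = (\<lambda>s. y s - s *\<^sub>R G (y 0))"
  have g: "(g has_vector_derivative (G (y s) - G (y 0))) (at s within {0..h})" if "s \<in> {0..h}" for s
    unfolding g_def by (rule derivative_eq_intros y that | simp)+
  have bd: "norm (G (y s) - G (y 0)) \<le> M * (B * h)" if s: "s \<in> {0..h}" for s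
    by (rule order_trans[OF G[OF s] mult_left_mono[OF 1[OF s] assms(5)]])
  have "norm (g h - g 0) \<le> M * (B * h) * norm (h - 0)"
    using g bd assms(1) by (intro differentiable_bound[of "{0..h}" g "\<lambda>x u. u *\<^sub>R (G (y x) - G (y 0))"])
      (auto simp: has_vector_derivative_def onorm_scaleR_left[OF bounded_linear_ident] onorm_id)
  then show ?thesis using assms(1) by (simp add: g_def power2_eq_square algebra_simps)
qed

section \<open>Exponential curves\<close>

definition skew :: "nat \<Rightarrow> fmat set" where "skew n = {K \<in> crn n. adj K = - K}"

text \<open>The curve is read off a diagonalisation rather than a power series, which reduces the
  group law, unitarity and recurrence to scalar exponentials. It is a relation so that a
  diagonalisation already at hand, as in \<open>grp_dense\<close>, can be used directly.\<close>

definition is_fexp :: "nat \<Rightarrow> fmat \<Rightarrow> (real \<Rightarrow> fmat) \<Rightarrow> bool" where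
  "is_fexp n K E \<longleftrightarrow> (\<exists>V\<in>uni n. \<exists>l. K = V * idg n l * adj V \<and>
     E = (\<lambda>t. V * edg n l t * adj V))"

definition fexp :: "nat \<Rightarrow> fmat \<Rightarrow> real \<Rightarrow> fmat" where
  "fexp n K = (SOME E. is_fexp n K E)"

lemma is_fexp_fexp: "K \<in> skew n \<Longrightarrow> is_fexp n K (fexp n K)"
proof -
  assume "K \<in> skew n"
  then obtain V l where V: "V \<in> uni n" and Kd: "K = V * idg n l * adj V"
    using skew_spectral[of K n] by (auto simp only: skew_def mem_Collect_eq)
  have "is_fexp n K (\<lambda>t. V * edg n l t * adj V)"
    unfolding is_fexp_def by (intro bexI[OF _ V] exI[of _ l] conjI Kd refl)
  then show "is_fexp n K (fexp n K)" unfolding fexp_def by (rule someI[where P = "is_fexp n K"])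
qed

lemma conj_dg_times:
  assumes "V \<in> uni n"
  shows "(V * dg n c * adj V) * (V * dg n d * adj V) = V * dg n (\<lambda>i. c i * d i) * adj V"
proof -
  have "(V * dg n c * adj V) * (V * dg n d * adj V) = V * (dg n c * (adj V * V) * dg n d) * adj V"
    by (simp only: mult.assoc)
  then show ?thesis using assms by (simp add: dg_times)
qed

context
  fixes n K E assumes K: "is_fexp n K E"
begin

lemma fexp_spectral:
  obtains V l where "V \<in> uni n" "K = V * idg n l * adj V"
    "\<And>t. E t = V * edg n l t * adj V"
  using K unfolding is_fexp_def by blast

lemma fexp_skew: "K \<in> crn n" "adj K = - K"
proof -
  obtain V l where V: "V \<in> uni n" "K = V * idg n l * adj V" by (rule fexp_spectral)
  show "K \<in> crn n" unfolding V(2) using V(1) by simp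
  have "dg n (\<lambda>i. - (\<i> * of_real (l i))) = - idg n l" by (rule fmat_eqI) (simp add: ent_dg)
  then show "adj K = - K" unfolding V(2) by (simp add: mult.assoc)
qed

lemma fexp_0: "E 0 = eN n"
  by (rule fexp_spectral) (simp add: dg_one)

lemma fexp_add: "E (s + t) = E s * E t"
  by (rule fexp_spectral) (simp add: conj_dg_times exp_add[symmetric] distrib_left)

lemma fexp_adj: "adj (E t) = E (- t)"
  by (rule fexp_spectral) (simp add: mult.assoc exp_cnj)

lemma fexp_crn [simp]: "E t \<in> crn n"
  by (rule fexp_spectral) simp

lemma fexp_uni: "E t \<in> uni n"
  unfolding uni_def by (simp add: fexp_adj fexp_add[symmetric] fexp_0)

lemma fexp_deriv: "(E has_vector_derivative K * E t) (at t within S)"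
proof (rule fexp_spectral)
  fix V l assume V: "V \<in> uni n" and Kd: "K = V * idg n l * adj V" and
    Et: "\<And>t. E t = V * edg n l t * adj V"
  have "((\<lambda>t. edg n l t) has_vector_derivative
     dg n (\<lambda>i. \<i> * of_real (l i) * exp (\<i> * of_real (l i) * of_real t))) (at t within S)"
  proof (rule has_vector_derivative_crnI[of _ n])
    fix i j
    have "((\<lambda>z. exp (\<i> * of_real (l i) * z)) has_field_derivative \<i> * of_real (l i) * exp (\<i> * of_real (l i) * of_real t)) (at (of_real t))"
      by (auto intro!: derivative_eq_intros)
    from has_vector_derivative_real_field[OF this]
    have 1: "((\<lambda>t. exp (\<i> * of_real (l i) * of_real t)) has_vector_derivative \<i> * of_real (l i) * exp (\<i> * of_real (l i) * of_real t)) (at t within S)"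
      by blast
    show "((\<lambda>t. ent (edg n l t) i j) has_vector_derivative
       ent (dg n (\<lambda>i. \<i> * of_real (l i) * exp (\<i> * of_real (l i) * of_real t))) i j) (at t within S)"
      using 1 by (cases "i = j"; cases "i < n") (simp_all add: ent_dg)
  qed auto
  then have "((\<lambda>t. V * edg n l t * adj V) has_vector_derivative
     V * dg n (\<lambda>i. \<i> * of_real (l i) * exp (\<i> * of_real (l i) * of_real t)) * adj V) (at t within S)"
    by (intro bounded_linear.has_vector_derivative[OF bounded_linear_mult_left]
        bounded_linear.has_vector_derivative[OF bounded_linear_mult_right])
  also have "(\<lambda>t. V * edg n l t * adj V) = E" using Et by auto
  also have "V * dg n (\<lambda>i. \<i> * of_real (l i) * exp (\<i> * of_real (l i) * of_real t)) * adj V = K * E t"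
    unfolding Et by (subst Kd) (simp only: conj_dg_times[OF V])
  finally show ?thesis .
qed

lemma fexp_taylor: "norm (E t - eN n - t *\<^sub>R K) \<le> norm K * norm K * norm (eN n) * t\<^sup>2"
proof -
  have pos: "norm (E t - eN n - t *\<^sub>R K) \<le> norm K * (norm K * norm (eN n)) * t\<^sup>2" if "0 \<le> t" for t
  proof -
    have nE: "norm (E s) = norm (eN n)" for s
      using norm_uni_left[OF fexp_uni, of "eN n" s] by simp
    have "norm (E t - E 0 - t *\<^sub>R (K * E 0)) \<le> norm K * (norm K * norm (eN n)) * t\<^sup>2"
      using that by (intro linear_ode_taylor[where G = "\<lambda>A. K * A"] fexp_deriv)
        (auto simp: right_diff_distrib[symmetric] norm_mult_ineq intro: order_trans[OF norm_mult_ineq] simp: nE)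
    then show ?thesis by (simp add: fexp_0 fexp_skew)
  qed
  show ?thesis
  proof (cases "0 \<le> t")
    case False
    \<comment> \<open>The adjoint preserves the norm and reverses time, which reduces negative
      \<open>t\<close> to the case already treated.\<close>
    have "norm (E t - eN n - t *\<^sub>R K) = norm (adj (E t - eN n - t *\<^sub>R K))" by (simp only: norm_adj)
    also have "adj (E t - eN n - t *\<^sub>R K) = E (- t) - eN n - (- t) *\<^sub>R K"
      by (simp add: fexp_adj fexp_skew)
    also have "norm \<dots> \<le> norm K * (norm K * norm (eN n)) * (- t)\<^sup>2" using False by (intro pos) simp
    finally show ?thesis by (simp add: mult.assoc)
  qed (use pos in \<open>simp add: mult.assoc\<close>)
qed

text \<open>Simultaneous Dirichlet approximation: some multiple of a fixed time brings all phases
  \<open>l i * t\<close> close to multiples of 2 pi at once.\<close>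

lemma fexp_recurrent:
  assumes "0 < e"
  shows "\<exists>t\<ge>T. norm (E t - eN n) < e"
proof (rule fexp_spectral)
  fix V l assume V: "V \<in> uni n" and
    Et: "\<And>t. E t = V * edg n l t * adj V"
  \<comment> \<open>The return time is a positive integer multiple of this unit, hence at least
    \<open>T\<close>.\<close>
  define \<tau> where "\<tau> = max T 1"
  \<comment> \<open>Each of the \<open>n\<close> phases contributes at most
    \<open>2 * pi / N\<close> to the error; the added 1 keeps \<open>N\<close> positive also for
    \<open>n = 0\<close>.\<close>
  obtain N where N: "2 * pi * (real n + 1) / e < real N" using reals_Archimedean2 by blast
  have "0 < 2 * pi * (real n + 1) / e" using assms by simp
  then have N0: "0 < N" using N by (metis less_trans of_nat_0_less_iff)
  obtain q p where q: "0 < q" and p: "\<And>i. i < n \<Longrightarrow> \<bar>of_int q * (l i * \<tau> / (2 * pi)) - of_int (p i)\<bar> < 1 / real N"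
    using Dirichlet_approx_simult[OF N0, of n "\<lambda>i. l i * \<tau> / (2 * pi)"] by metis
  define t where "t = of_int q * \<tau>"
  have \<tau>: "\<tau> > 0" "T \<le> \<tau>" by (auto simp: \<tau>_def)
  have "1 * \<tau> \<le> t" unfolding t_def using q \<tau> by (intro mult_right_mono) auto
  then have "T \<le> t" using \<tau> by simp
  have small: "cmod (exp (\<i> * of_real (l i) * of_real t) - 1) \<le> 2 * pi / real N" if i: "i < n" for i
  proof -
    define x where "x = l i * t - 2 * pi * of_int (p i)"
    have "exp (\<i> * of_real (l i) * of_real t) = exp (\<i> * of_real x) * exp (2 * of_int (p i) * of_real pi * \<i>)"
      unfolding exp_add[symmetric] by (rule arg_cong[of _ _ exp]) (simp add: x_def algebra_simps)
    also have "exp (2 * of_int (p i) * of_real pi * \<i>) = (1::complex)"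
      using exp_integer_2pi[of "of_int (p i)"] by simp
    finally have "cmod (exp (\<i> * of_real (l i) * of_real t) - 1) = 2 * \<bar>sin (x / 2)\<bar>"
      using dist_exp_i_1[of x] by simp
    also have "\<dots> \<le> \<bar>x\<bar>" using abs_sin_x_le_abs_x[of "x / 2"] by simp
    also have "x = 2 * pi * (of_int q * (l i * \<tau> / (2 * pi)) - of_int (p i))"
      by (simp add: x_def t_def field_simps)
    also have "\<bar>\<dots>\<bar> = 2 * pi * \<bar>of_int q * (l i * \<tau> / (2 * pi)) - of_int (p i)\<bar>"
      by (simp add: abs_mult)
    also have "\<dots> \<le> 2 * pi * (1 / real N)" using p[OF i] by (intro mult_left_mono) auto
    finally show ?thesis by simp
  qed
  have "E t - eN n = V * dg n (\<lambda>i. exp (\<i> * of_real (l i) * of_real t) - 1) * adj V"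
  proof -
    have "dg n (\<lambda>i. exp (\<i> * of_real (l i) * of_real t) - 1) = edg n l t - eN n"
      by (rule fmat_eqI) (simp add: ent_dg ent_eN)
    then show ?thesis using V by (simp add: Et left_diff_distrib right_diff_distrib)
  qed
  then have "norm (E t - eN n) = norm (dg n (\<lambda>i. exp (\<i> * of_real (l i) * of_real t) - 1))"
    by (simp only: norm_conj[OF V dg_crn])
  also have "\<dots> \<le> (\<Sum>i<n. cmod (exp (\<i> * of_real (l i) * of_real t) - 1))" by (rule norm_dg_le)
  also have "\<dots> \<le> (\<Sum>i<n. 2 * pi / real N)" using small by (intro sum_mono) simp
  also have "\<dots> \<le> 2 * pi * (real n + 1) / real N" using N0 by (simp add: field_simps)
  also have "\<dots> < e" using N N0 assms by (simp add: field_simps)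
  finally show ?thesis using \<open>T \<le> t\<close> by blast
qed

end

subsection \<open>Density of the generated unitary group\<close>

inductive_set grp :: "nat \<Rightarrow> fmat set \<Rightarrow> fmat set" for n S where
  grp_one: "eN n \<in> grp n S"
| grp_step: "K \<in> S \<Longrightarrow> U \<in> grp n S \<Longrightarrow> fexp n K t * U \<in> grp n S"

abbreviation near :: "nat \<Rightarrow> fmat set \<Rightarrow> fmat \<Rightarrow> real \<Rightarrow> bool" where
  "near n S A e \<equiv> \<exists>d>0. \<forall>h. \<bar>h\<bar> < d \<longrightarrow> (\<exists>X\<in>grp n S. norm (X - eN n - h *\<^sub>R A) \<le> e * \<bar>h\<bar>)"

text \<open>First-order contact with the group is demanded without a rate, only up to
  \<open>e * \<bar>h\<bar>\<close> for every \<open>e\<close>. This makes the set closed under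
  limits, which is how brackets are obtained.\<close>

definition tang :: "nat \<Rightarrow> fmat set \<Rightarrow> fmat set" where
  "tang n S = {A \<in> skew n. \<forall>e>0. near n S A e}"

lemma skewD: "K \<in> skew n \<Longrightarrow> K \<in> crn n" "K \<in> skew n \<Longrightarrow> adj K = - K"
  by (auto simp: skew_def)

lemma tangD:
  assumes "A \<in> tang n S" "0 < e"
  shows "near n S A e"
  using assms unfolding tang_def by blast

lemma tang_skew: "A \<in> tang n S \<Longrightarrow> A \<in> skew n"
  by (simp add: tang_def)

definition ftr :: "nat \<Rightarrow> fmat \<Rightarrow> complex" where "ftr n A = (\<Sum>i<n. ent A i i)"

lemma ftr_commute: assumes "A \<in> crn n" "B \<in> crn n" shows "ftr n (A * B) = ftr n (B * A)"
  unfolding ftr_def ent_times_crn[OF assms(1)] ent_times_crn[OF assms(2)]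
  by (subst sum.swap) (simp add: mult.commute)

lemma ftr_conj: assumes "V \<in> uni n" "A \<in> crn n" shows "ftr n (V * A * adj V) = ftr n A"
  using assms ftr_commute[of "V * A" n "adj V"] by (simp add: uni_cancel)

context
  fixes n :: nat and S :: "fmat set"
  assumes S: "S \<subseteq> skew n"
begin

lemma grp_uni: "U \<in> grp n S \<Longrightarrow> U \<in> uni n"
proof (induction rule: grp.induct)
  case (grp_step K U t)
  then show ?case using S fexp_uni[OF is_fexp_fexp] uni_closed(3) by blast
qed (rule uni_closed)

lemma grp_mult: "U \<in> grp n S \<Longrightarrow> V \<in> grp n S \<Longrightarrow> U * V \<in> grp n S"
proof (induction rule: grp.induct)
  case grp_one
  then show ?case using grp_uni uni_D(1) by simp
next
  case (grp_step K U t)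
  then show ?case by (simp add: mult.assoc grp.grp_step)
qed

lemma grp_gen: assumes "K \<in> S" shows "fexp n K t \<in> grp n S"
proof -
  have "K \<in> skew n" using assms S by auto
  from fexp_crn[OF is_fexp_fexp[OF this]] grp_step[OF assms grp_one[of n S], of t] show ?thesis by simp
qed

lemma grp_adj: "U \<in> grp n S \<Longrightarrow> adj U \<in> grp n S"
proof (induction rule: grp.induct)
  case grp_one
  then show ?case by (simp add: grp.grp_one)
next
  case (grp_step K U t)
  then have "adj (fexp n K t) = fexp n K (- t)" using S fexp_adj[OF is_fexp_fexp] by blast
  then show ?case using grp_step grp_gen grp_mult by simp
qed

lemma tang_gen: assumes "K \<in> S" shows "K \<in> tang n S"
proof -
  have K: "K \<in> skew n" using assms S by auto
  define C where "C = norm K * norm K * norm (eN n) + 1"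
  have C: "C > 0" by (simp add: C_def add_nonneg_pos)
  have "near n S K e" if e: "e > 0" for e
  proof (intro exI[of _ "e / C"] conjI allI impI)
    fix h assume h: "\<bar>h\<bar> < e / C"
    have "norm (fexp n K h - eN n - h *\<^sub>R K) \<le> norm K * norm K * norm (eN n) * h\<^sup>2"
      by (rule fexp_taylor[OF is_fexp_fexp[OF K]])
    also have "\<dots> \<le> C * h\<^sup>2" unfolding C_def by (intro mult_right_mono) auto
    also have "C * h\<^sup>2 = (C * \<bar>h\<bar>) * \<bar>h\<bar>" by (simp add: power2_eq_square)
    also have "\<dots> \<le> e * \<bar>h\<bar>" using h C by (intro mult_right_mono) (auto simp: field_simps)
    finally show "\<exists>X\<in>grp n S. norm (X - eN n - h *\<^sub>R K) \<le> e * \<bar>h\<bar>" using grp_gen[OF assms] by blast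
  qed (use e C in simp)
  then show ?thesis using K by (simp add: tang_def)
qed

lemma tang_scaleR: assumes A: "A \<in> tang n S" shows "r *\<^sub>R A \<in> tang n S"
proof -
  have "near n S (r *\<^sub>R A) e" if e: "e > 0" for e
  proof -
    let ?R = "\<bar>r\<bar> + 1"
    obtain d where d: "0 < d" "\<And>h. \<bar>h\<bar> < d \<Longrightarrow> \<exists>X\<in>grp n S. norm (X - eN n - h *\<^sub>R A) \<le> e / ?R * \<bar>h\<bar>"
      using tangD[OF A, of "e / ?R"] e by (auto simp: add_nonneg_pos)
    show ?thesis
    proof (intro exI[of _ "d / ?R"] conjI allI impI)
      fix h assume h: "\<bar>h\<bar> < d / ?R"
      have "\<bar>h * r\<bar> \<le> \<bar>h\<bar> * ?R" unfolding abs_mult by (intro mult_left_mono) auto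
      also have "\<dots> < d" using h by (simp add: field_simps)
      finally obtain X where X: "X \<in> grp n S" "norm (X - eN n - (h * r) *\<^sub>R A) \<le> e / ?R * \<bar>h * r\<bar>" using d by blast
      have "e / ?R * \<bar>h * r\<bar> \<le> e / ?R * (\<bar>h\<bar> * ?R)" unfolding abs_mult using e by (intro mult_left_mono) auto
      also have "\<dots> = e * \<bar>h\<bar>" by simp
      finally show "\<exists>X\<in>grp n S. norm (X - eN n - h *\<^sub>R r *\<^sub>R A) \<le> e * \<bar>h\<bar>" using X by force
    qed (use d in simp)
  qed
  moreover have "r *\<^sub>R A \<in> skew n" using tang_skew[OF A] by (simp add: skew_def)
  ultimately show ?thesis by (simp add: tang_def)
qed

text \<open>The product of the group elements that approximate along \<open>A\<close> and along
  \<open>B\<close> approximates along the sum, since the cross term is of second order in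
  \<open>h\<close>.\<close>

lemma tang_add: assumes A: "A \<in> tang n S" and B: "B \<in> tang n S" shows "A + B \<in> tang n S"
proof -
  note As = tang_skew[OF A] and Bs = tang_skew[OF B]
  have "near n S (A + B) e" if e: "e > 0" for e
  proof -
    have e3: "e / 3 > 0" using e by simp
    obtain d1 where d1: "0 < d1" "\<And>h. \<bar>h\<bar> < d1 \<Longrightarrow> \<exists>X\<in>grp n S. norm (X - eN n - h *\<^sub>R A) \<le> e / 3 * \<bar>h\<bar>"
      using tangD[OF A e3] by blast
    obtain d2 where d2: "0 < d2" "\<And>h. \<bar>h\<bar> < d2 \<Longrightarrow> \<exists>X\<in>grp n S. norm (X - eN n - h *\<^sub>R B) \<le> e / 3 * \<bar>h\<bar>"
      using tangD[OF B e3] by blast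
    define M where "M = norm A * (norm B + e / 3) + 1"
    have M: "M > 0" using e by (simp add: M_def add_nonneg_pos)
    show ?thesis
    proof (intro exI[of _ "min (min d1 d2) (e / 3 / M)"] conjI allI impI)
      fix h assume h: "\<bar>h\<bar> < min (min d1 d2) (e / 3 / M)"
      then obtain X where X: "X \<in> grp n S" "norm (X - eN n - h *\<^sub>R A) \<le> e / 3 * \<bar>h\<bar>" using d1 by auto
      obtain Y where Y: "Y \<in> grp n S" "norm (Y - eN n - h *\<^sub>R B) \<le> e / 3 * \<bar>h\<bar>" using d2 h by auto
      have cr: "X \<in> crn n" "Y \<in> crn n" "A \<in> crn n" "B \<in> crn n"
        using X Y grp_uni uni_D(1) skewD(1) As Bs by blast+
      have "norm (Y - eN n) \<le> norm (Y - eN n - h *\<^sub>R B) + norm (h *\<^sub>R B)"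
        using norm_triangle_ineq[of "Y - eN n - h *\<^sub>R B" "h *\<^sub>R B"] by simp
      also have "\<dots> \<le> \<bar>h\<bar> * (norm B + e / 3)" using Y(2) by (simp add: algebra_simps)
      finally have Y1: "norm (Y - eN n) \<le> \<bar>h\<bar> * (norm B + e / 3)" .
      have "norm (A * (Y - eN n)) \<le> norm A * norm (Y - eN n)" by (rule norm_mult_ineq)
      also have "\<dots> \<le> norm A * (\<bar>h\<bar> * (norm B + e / 3))" using Y1 by (intro mult_left_mono) auto
      also have "\<dots> \<le> M * \<bar>h\<bar>" unfolding M_def by (simp add: algebra_simps)
      also have "\<dots> \<le> e / 3" using h M by (simp add: field_simps)
      finally have AY: "norm (A * (Y - eN n)) \<le> e / 3" .
      \<comment> \<open>Two given errors, the first multiplied by a unitary and so unchanged in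
        norm, plus a cross term; \<open>M\<close> was chosen to make \<open>A * (Y - eN n)\<close>
        small.\<close>
      have eq: "X * Y - eN n - h *\<^sub>R (A + B) = (X - eN n - h *\<^sub>R A) * Y + (Y - eN n - h *\<^sub>R B) + h *\<^sub>R (A * (Y - eN n))"
        using cr by (simp add: algebra_simps)
      have "norm (X * Y - eN n - h *\<^sub>R (A + B)) \<le> norm ((X - eN n - h *\<^sub>R A) * Y) + norm (Y - eN n - h *\<^sub>R B) + norm (h *\<^sub>R (A * (Y - eN n)))"
        unfolding eq by (intro norm_triangle_le add_right_mono norm_triangle_ineq)
      also have "norm ((X - eN n - h *\<^sub>R A) * Y) = norm (X - eN n - h *\<^sub>R A)"
        using cr by (intro norm_uni_right[OF grp_uni[OF Y(1)]]) simp
      also have "norm (h *\<^sub>R (A * (Y - eN n))) \<le> \<bar>h\<bar> * (e / 3)"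
        unfolding norm_scaleR by (rule mult_left_mono[OF AY]) simp
      finally have "norm (X * Y - eN n - h *\<^sub>R (A + B)) \<le> e * \<bar>h\<bar>" using X(2) Y(2) by (simp add: algebra_simps)
      then show "\<exists>X\<in>grp n S. norm (X - eN n - h *\<^sub>R (A + B)) \<le> e * \<bar>h\<bar>" using grp_mult[OF X(1) Y(1)] by blast
    qed (use d1 d2 e M in simp)
  qed
  moreover have "A + B \<in> skew n" using As Bs by (simp add: skew_def)
  ultimately show ?thesis by (simp add: tang_def)
qed

lemma tang_closed:
  assumes "A \<in> skew n" "\<And>e. 0 < e \<Longrightarrow> \<exists>B\<in>tang n S. norm (A - B) \<le> e"
  shows "A \<in> tang n S"
proof -
  have "near n S A e" if e: "e > 0" for e
  proof -
    have e2: "e / 2 > 0" using e by simp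
    obtain B where B: "B \<in> tang n S" "norm (A - B) \<le> e / 2" using assms(2)[OF e2] by blast
    obtain d where d: "0 < d" "\<And>h. \<bar>h\<bar> < d \<Longrightarrow> \<exists>X\<in>grp n S. norm (X - eN n - h *\<^sub>R B) \<le> e / 2 * \<bar>h\<bar>"
      using tangD[OF B(1) e2] by blast
    have "\<exists>X\<in>grp n S. norm (X - eN n - h *\<^sub>R A) \<le> e * \<bar>h\<bar>" if "\<bar>h\<bar> < d" for h
    proof -
      obtain X where X: "X \<in> grp n S" "norm (X - eN n - h *\<^sub>R B) \<le> e / 2 * \<bar>h\<bar>" using d \<open>\<bar>h\<bar> < d\<close> by blast
      have "X - eN n - h *\<^sub>R A = (X - eN n - h *\<^sub>R B) - h *\<^sub>R (A - B)" by (simp add: algebra_simps)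
      then have "norm (X - eN n - h *\<^sub>R A) \<le> norm (X - eN n - h *\<^sub>R B) + norm (h *\<^sub>R (A - B))"
        by (simp only: norm_triangle_ineq4)
      also have "norm (h *\<^sub>R (A - B)) \<le> \<bar>h\<bar> * (e / 2)" unfolding norm_scaleR by (rule mult_left_mono[OF B(2)]) simp
      finally show ?thesis using X by (intro bexI[of _ X]) (simp_all add: algebra_simps)
    qed
    then show ?thesis using d(1) by blast
  qed
  then show ?thesis using assms(1) by (simp add: tang_def)
qed

lemma tang_conj: assumes V: "V \<in> grp n S" and A: "A \<in> tang n S" shows "V * A * adj V \<in> tang n S"
proof -
  have Vu: "V \<in> uni n" by (rule grp_uni[OF V])
  have "near n S (V * A * adj V) e" if e: "e > 0" for e
  proof -
    obtain d where d: "0 < d" "\<And>h. \<bar>h\<bar> < d \<Longrightarrow> \<exists>X\<in>grp n S. norm (X - eN n - h *\<^sub>R A) \<le> e * \<bar>h\<bar>"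
      using tangD[OF A e] by blast
    have "\<exists>X\<in>grp n S. norm (X - eN n - h *\<^sub>R (V * A * adj V)) \<le> e * \<bar>h\<bar>" if "\<bar>h\<bar> < d" for h
    proof -
      obtain X where X: "X \<in> grp n S" "norm (X - eN n - h *\<^sub>R A) \<le> e * \<bar>h\<bar>" using d \<open>\<bar>h\<bar> < d\<close> by blast
      have c: "X - eN n - h *\<^sub>R A \<in> crn n" using uni_D(1)[OF grp_uni[OF X(1)]] skewD(1)[OF tang_skew[OF A]] by simp
      have "V * X * adj V - eN n - h *\<^sub>R (V * A * adj V) = V * (X - eN n - h *\<^sub>R A) * adj V"
        using Vu by (simp add: left_diff_distrib right_diff_distrib)
      then have "norm (V * X * adj V - eN n - h *\<^sub>R (V * A * adj V)) \<le> e * \<bar>h\<bar>"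
        using X(2) norm_conj[OF Vu c] by simp
      then show ?thesis using grp_mult[OF grp_mult[OF V X(1)] grp_adj[OF V]] by blast
    qed
    then show ?thesis using d(1) by blast
  qed
  moreover have "V * A * adj V \<in> skew n" using tang_skew[OF A] Vu by (simp add: skew_def mult.assoc)
  ultimately show ?thesis by (simp add: tang_def)
qed

text \<open>Conjugating \<open>B\<close> by a group element \<open>V\<close> close to
  \<open>eN n + h *\<^sub>R A\<close> stays tangent, and the difference quotient of
  \<open>V * B * adj V\<close> against \<open>B\<close> tends to the bracket as \<open>h\<close>
  shrinks; closedness under limits finishes.\<close>

lemma tang_bracket: assumes A: "A \<in> tang n S" and B: "B \<in> tang n S" shows "A * B - B * A \<in> tang n S"
proof (rule tang_closed)
  note As = tang_skew[OF A] and Bs = tang_skew[OF B]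
  note sk = skewD[OF As] skewD[OF Bs]
  show "A * B - B * A \<in> skew n" unfolding skew_def using sk by simp
  fix e :: real assume e: "e > 0"
  \<comment> \<open>Makes each of the terms \<open>F * B\<close> and \<open>B * adj F\<close> cost
    at most a third of \<open>e * h\<close>; the added 1 covers \<open>B = 0\<close>.\<close>
  define e1 where "e1 = e / (3 * (norm B + 1))"
  have nB: "norm B + 1 > 0" by (simp add: add_nonneg_pos)
  have e1: "e1 > 0" using e nB by (simp add: e1_def)
  have e1B: "e1 * norm B \<le> e / 3"
  proof -
    have "e1 * norm B \<le> e1 * (norm B + 1)" using e1 by (intro mult_left_mono) auto
    also have "e / (3 * c) * c = e / 3" if "c > 0" for c :: real using that by simp
    from this[OF nB] have "e1 * (norm B + 1) = e / 3" unfolding e1_def .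
    finally show ?thesis .
  qed
  obtain d where d: "0 < d" "\<And>h. \<bar>h\<bar> < d \<Longrightarrow> \<exists>X\<in>grp n S. norm (X - eN n - h *\<^sub>R A) \<le> e1 * \<bar>h\<bar>"
    using tangD[OF A e1] by blast
  \<comment> \<open>Bounds the quadratic term \<open>D * B * adj D\<close> by
    \<open>M * h\<^sup>2\<close>; the choice of \<open>h\<close> reduces this to the remaining
    third.\<close>
  define M where "M = (norm A + e1) * norm B * (norm A + e1) + 1"
  have M: "M > 0" using e1 by (simp add: M_def add_nonneg_pos)
  define h where "h = min (d / 2) (e / 3 / M)"
  have h: "0 < h" "h < d" using d(1) e M by (auto simp: h_def)
  have hM: "h * M \<le> e / 3" using M by (simp add: h_def min_def field_simps)
  obtain V where V: "V \<in> grp n S" "norm (V - eN n - h *\<^sub>R A) \<le> e1 * h" using d(2)[of h] h by auto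
  have Vu: "V \<in> uni n" by (rule grp_uni[OF V(1)])
  define D where "D = V - eN n"
  define F where "F = V - eN n - h *\<^sub>R A"
  have Dc: "D \<in> crn n" "F \<in> crn n" using Vu sk by (simp_all add: D_def F_def)
  have VD: "V = eN n + D" and DF: "D = h *\<^sub>R A + F" by (simp_all add: D_def F_def)
  have nF: "norm F \<le> e1 * h" using V by (simp add: F_def)
  have nD: "norm D \<le> h * (norm A + e1)"
    unfolding DF using nF h norm_triangle_ineq[of "h *\<^sub>R A" F] by (simp add: algebra_simps)
  have "V * B * adj V - B = D * B + B * adj D + D * B * adj D"
    unfolding VD using Dc sk by (simp add: algebra_simps)
  also have "D * B + B * adj D = h *\<^sub>R (A * B - B * A) + (F * B + B * adj F)"
    unfolding DF using sk by (simp add: algebra_simps)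
  finally have eq: "V * B * adj V - B - h *\<^sub>R (A * B - B * A) = F * B + B * adj F + D * B * adj D" by simp
  have b1: "norm (F * B) \<le> h * (e / 3)" "norm (B * adj F) \<le> h * (e / 3)"
  proof -
    have "norm F * norm B \<le> e1 * h * norm B" using nF by (intro mult_right_mono) auto
    also have "\<dots> = h * (e1 * norm B)" by simp
    also have "\<dots> \<le> h * (e / 3)" using e1B h by (intro mult_left_mono) auto
    finally have *: "norm F * norm B \<le> h * (e / 3)" .
    show "norm (F * B) \<le> h * (e / 3)" by (rule order_trans[OF norm_mult_ineq *])
    show "norm (B * adj F) \<le> h * (e / 3)" using norm_mult_ineq[of B "adj F"] * by (simp add: mult.commute)
  qed
  have b2: "norm (D * B * adj D) \<le> h * (e / 3)"
  proof -
    have "norm (D * B * adj D) \<le> norm D * norm B * norm D"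
      using norm_mult_ineq[of "D * B" "adj D"] mult_right_mono[OF norm_mult_ineq[of D B], of "norm D"] by simp
    also have "\<dots> \<le> h * (norm A + e1) * norm B * (h * (norm A + e1))"
      using nD h e1 by (intro mult_mono) auto
    also have "\<dots> = h * (h * (M - 1))" by (simp add: M_def algebra_simps)
    also have "\<dots> \<le> h * (h * M)" using h by (intro mult_left_mono) auto
    also have "\<dots> \<le> h * (e / 3)" using hM h by (intro mult_left_mono) auto
    finally show ?thesis .
  qed
  have "norm (V * B * adj V - B - h *\<^sub>R (A * B - B * A)) \<le> norm (F * B) + norm (B * adj F) + norm (D * B * adj D)"
    unfolding eq by (intro norm_triangle_le add_right_mono norm_triangle_ineq)
  also have "\<dots> \<le> h * e" using b1 b2 by (simp add: algebra_simps)
  finally have nn: "norm (V * B * adj V - B - h *\<^sub>R (A * B - B * A)) \<le> h * e" .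
  define C where "C = (1 / h) *\<^sub>R (V * B * adj V + (- 1) *\<^sub>R B)"
  have "C \<in> tang n S" unfolding C_def by (intro tang_scaleR tang_add tang_conj V B)
  moreover have "A * B - B * A - C = (- 1 / h) *\<^sub>R (V * B * adj V - B - h *\<^sub>R (A * B - B * A))"
    using h by (simp add: C_def algebra_simps)
  then have "norm (A * B - B * A - C) = norm (V * B * adj V - B - h *\<^sub>R (A * B - B * A)) / h" using h by simp
  then have "norm (A * B - B * A - C) \<le> e" using nn h by (simp add: pos_divide_le_eq mult.commute)
  ultimately show "\<exists>C\<in>tang n S. norm (A * B - B * A - C) \<le> e" by blast
qed

text \<open>A group element close to \<open>E (1 / k)\<close> is multiplied with itself
  \<open>k\<close> times. All factors are isometries, so the errors merely add up, and each of them
  is a small multiple of \<open>1 / k\<close>.\<close>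

lemma grp_dense_exp:
  assumes K: "K \<in> tang n S" and E: "is_fexp n K E" and e: "0 < e"
  shows "\<exists>V\<in>grp n S. norm (V - E 1) < e"
proof -
  define C where "C = norm K * norm K * norm (eN n)"
  have e3: "e / 3 > 0" using e by simp
  obtain d where d: "0 < d" "\<And>h. \<bar>h\<bar> < d \<Longrightarrow> \<exists>X\<in>grp n S. norm (X - eN n - h *\<^sub>R K) \<le> e / 3 * \<bar>h\<bar>"
    using tangD[OF K e3] by blast
  \<comment> \<open>The first bound puts \<open>h = 1 / k\<close> into the range of the tangency
    estimate, the second makes the Taylor remainder \<open>C * h\<^sup>2\<close> at most
    \<open>e / 3 * h\<close>.\<close>
  obtain k :: nat where k: "max (1 / d) (3 * C / e) < real k" using reals_Archimedean2 by blast
  have k0: "real k > 0" using k d(1) by (smt (verit) divide_pos_pos)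
  define h where "h = 1 / real k"
  have h: "0 < h" "h < d" using k k0 d(1) by (auto simp: h_def field_simps)
  have hC: "C * h \<le> e / 3" using k k0 e by (simp add: h_def field_simps)
  obtain X where X: "X \<in> grp n S" "norm (X - eN n - h *\<^sub>R K) \<le> e / 3 * h" using d(2)[of h] h by auto
  have Xu: "X \<in> uni n" by (rule grp_uni[OF X(1)])
  have "norm (X - E h) = norm ((X - eN n - h *\<^sub>R K) - (E h - eN n - h *\<^sub>R K))" by simp
  also have "\<dots> \<le> norm (X - eN n - h *\<^sub>R K) + norm (E h - eN n - h *\<^sub>R K)" by (rule norm_triangle_ineq4)
  also have "\<dots> \<le> e / 3 * h + C * h\<^sup>2" using X(2) fexp_taylor[OF E, of h] unfolding C_def by linarith
  also have "C * h\<^sup>2 = (C * h) * h" by (simp add: power2_eq_square)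
  also have "e / 3 * h + \<dots> \<le> e / 3 * h + e / 3 * h" using hC h by (intro add_left_mono mult_right_mono) auto
  finally have XE: "norm (X - E h) \<le> 2 * e / 3 * h" by simp
  have "\<exists>V\<in>grp n S. norm (V - E (real j * h)) \<le> real j * norm (X - E h)" for j
  proof (induction j)
    case 0
    then show ?case using grp_one[of n S] by (intro bexI[of _ "eN n"]) (simp_all add: fexp_0[OF E])
  next
    case (Suc j)
    then obtain V where V: "V \<in> grp n S" "norm (V - E (real j * h)) \<le> real j * norm (X - E h)" by blast
    have c: "V \<in> crn n" "X \<in> crn n" using grp_uni V X uni_D(1) by blast+
    have "E (real (Suc j) * h) = E h * E (real j * h)"
      by (simp add: fexp_add[OF E, symmetric] algebra_simps)
    then have "X * V - E (real (Suc j) * h) = X * (V - E (real j * h)) + (X - E h) * E (real j * h)"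
      by (simp add: algebra_simps)
    then have "norm (X * V - E (real (Suc j) * h)) \<le> norm (X * (V - E (real j * h))) + norm ((X - E h) * E (real j * h))"
      by (simp only: norm_triangle_ineq)
    also have "norm (X * (V - E (real j * h))) = norm (V - E (real j * h))"
      using c fexp_crn[OF E] by (intro norm_uni_left[OF Xu]) simp
    also have "norm ((X - E h) * E (real j * h)) = norm (X - E h)"
      using c fexp_crn[OF E] by (intro norm_uni_right[OF fexp_uni[OF E]]) simp
    finally have "norm (X * V - E (real (Suc j) * h)) \<le> real (Suc j) * norm (X - E h)"
      using V(2) by (simp add: algebra_simps)
    then show ?case using grp_mult[OF X(1) V(1)] by blast
  qed
  from this[of k] obtain V where V: "V \<in> grp n S" "norm (V - E (real k * h)) \<le> real k * norm (X - E h)" by blast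
  have "real k * h = 1" using k0 by (simp add: h_def)
  have "real k * norm (X - E h) \<le> real k * (2 * e / 3 * h)" using XE by (intro mult_left_mono) auto
  also have "\<dots> = 2 * e / 3 * (real k * h)" by simp
  also have "\<dots> < e" using e \<open>real k * h = 1\<close> by simp
  finally show ?thesis using V \<open>real k * h = 1\<close> by (intro bexI[of _ V]) simp_all
qed

text \<open>A unitary is the exponential of a skew matrix, but only traceless generators are known
  to be tangent. Subtracting the mean of the phases removes the trace at the price of the global
  phase \<open>z\<close>.\<close>

lemma grp_dense:
  assumes "\<And>A. A \<in> skew n \<Longrightarrow> ftr n A = 0 \<Longrightarrow> A \<in> tang n S" and U: "U \<in> uni n" and e: "0 < e" and n: "0 < n"
  shows "\<exists>V\<in>grp n S. \<exists>z. cmod z = 1 \<and> norm (V - cs z U) < e"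
proof -
  obtain W \<theta> where W: "W \<in> uni n" and Ud: "U = W * dg n (\<lambda>i. exp (\<i> * of_real (\<theta> i))) * adj W"
    using unitary_spectral[OF U] by blast
  define m where "m = (\<Sum>i<n. \<theta> i) / real n"
  define l where "l = (\<lambda>i. \<theta> i - m)"
  define K where "K = W * idg n l * adj W"
  define E where "E = (\<lambda>t. W * edg n l t * adj W)"
  have KE: "is_fexp n K E" unfolding is_fexp_def K_def E_def using W by blast
  have "ftr n K = (\<Sum>i<n. \<i> * of_real (l i))" unfolding K_def ftr_conj[OF W dg_crn] by (simp add: ftr_def ent_dg)
  also have "\<dots> = \<i> * of_real (\<Sum>i<n. l i)" by (simp add: sum_distrib_left)
  also have "(\<Sum>i<n. l i) = 0" using n by (simp add: l_def m_def sum_subtractf)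
  finally have "ftr n K = 0" by simp
  then have "K \<in> tang n S" using fexp_skew[OF KE] by (intro assms(1)) (auto simp: skew_def)
  from grp_dense_exp[OF this KE e] obtain V where V: "V \<in> grp n S" "norm (V - E 1) < e" by blast
  have "E 1 = cs (exp (- \<i> * of_real m)) U"
  proof -
    have "dg n (\<lambda>i. exp (\<i> * of_real (l i) * of_real 1)) = cs (exp (- \<i> * of_real m)) (dg n (\<lambda>i. exp (\<i> * of_real (\<theta> i))))"
      by (rule fmat_eqI) (simp add: ent_dg l_def exp_add[symmetric] algebra_simps)
    then show ?thesis unfolding E_def Ud by simp
  qed
  moreover have "cmod (exp (- \<i> * of_real m)) = 1" using norm_exp_i_times[of "- m"] by simp
  ultimately show ?thesis using V by metis
qed

end

subsection \<open>Noisy evolution and its closure\<close>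

lemma nonincreasing_except_finite:
  fixes f :: "real \<Rightarrow> real"
  assumes "finite S" "a \<le> b" "continuous_on {a..b} f"
    and "\<And>t. t \<in> {a..b} - S \<Longrightarrow> (f has_vector_derivative f' t) (at t within {a..b})"
    and "\<And>t. t \<in> {a..b} - S \<Longrightarrow> f' t \<le> 0"
  shows "f b \<le> f a"
proof -
  have "(f' has_integral (f b - f a)) {a..b}"
  proof (rule fundamental_theorem_of_calculus_interior_strong[OF assms(1,2)])
    show "(f has_vector_derivative f' x) (at x)" if "x \<in> {a<..<b} - S" for x
      using assms(4)[of x] that at_within_Icc_at[of a x b] by auto
  qed (rule assms)
  \<comment> \<open>The sign of \<open>f'\<close> is unknown on \<open>S\<close>; setting it to 0 on
    a finite set leaves the integral unchanged.\<close>
  then have "((\<lambda>t. if t \<in> S then 0 else f' t) has_integral (f b - f a)) {a..b}"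
    by (rule has_integral_spike_finite[OF assms(1), rotated]) auto
  moreover have "((\<lambda>t::real. 0::real) has_integral 0) {a..b}" by (rule has_integral_0)
  ultimately have "f b - f a \<le> 0"
    by (rule has_integral_le) (use assms(5) in auto)
  then show ?thesis by simp
qed

lemma norm_nonincreasing:
  fixes y :: "real \<Rightarrow> 'a::real_inner"
  assumes "finite S" "a \<le> b" "continuous_on {a..b} y"
    and "\<And>t. t \<in> {a..b} - S \<Longrightarrow> (y has_vector_derivative D t) (at t within {a..b})"
    and "\<And>t. t \<in> {a..b} - S \<Longrightarrow> inner (y t) (D t) \<le> 0"
  shows "norm (y b) \<le> norm (y a)"
proof -
  have "inner (y b) (y b) \<le> inner (y a) (y a)"
  proof (rule nonincreasing_except_finite[OF assms(1,2), where f' = "\<lambda>t. 2 * inner (y t) (D t)"])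
    show "continuous_on {a..b} (\<lambda>t. inner (y t) (y t))" by (intro continuous_intros assms)
    fix t assume t: "t \<in> {a..b} - S"
    show "((\<lambda>t. inner (y t) (y t)) has_vector_derivative 2 * inner (y t) (D t)) (at t within {a..b})"
      using assms(4)[OF t] unfolding has_vector_derivative_def
      by (auto intro!: derivative_eq_intros simp: inner_commute algebra_simps)
  qed (use assms(5) in auto)
  then show ?thesis by (simp add: norm_le)
qed

lemma tendsto_crnI:
  assumes "\<And>t. f t \<in> crn n" "l \<in> crn n"
    and "\<And>i j. i < n \<Longrightarrow> j < n \<Longrightarrow> ((\<lambda>t. ent (f t) i j) \<longlongrightarrow> ent l i j) F"
  shows "(f \<longlongrightarrow> l) F"
proof -
  have "((\<lambda>t. \<Sum>i<n. \<Sum>j<n. cs (ent (f t) i j) (munit n i j))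
     \<longlongrightarrow> (\<Sum>i<n. \<Sum>j<n. cs (ent l i j) (munit n i j))) F"
    using assms(3) by (intro tendsto_sum bounded_linear.tendsto[OF bounded_linear_cs]) auto
  then show ?thesis using fmat_expand[OF assms(1)] fmat_expand[OF assms(2)] by simp
qed

text \<open>The solution is the exponential series of \<open>L\<close>, summed entrywise because \<open>fmat\<close> is not complete.\<close>

lemma linear_flow_exists:
  assumes L: "bounded_linear L" "\<And>A. A \<in> crn n \<Longrightarrow> L A \<in> crn n" and A: "A \<in> crn n"
  shows "\<exists>y. y 0 = A \<and> (\<forall>t. y t \<in> crn n) \<and> (\<forall>t. (y has_vector_derivative L (y t)) (at t))"
proof -
  interpret L: bounded_linear L by (rule L)
  obtain M where M: "\<And>A. norm (L A) \<le> norm A * M" "0 \<le> M" using L.nonneg_bounded by blast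
  define a where "a = (\<lambda>k. (L ^^ k) A)"
  have a0: "a 0 = A" and aS: "a (Suc k) = L (a k)" for k by (simp_all add: a_def)
  have ac: "a k \<in> crn n" for k by (induction k) (simp_all add: a0 aS A L)
  have an: "norm (a k) \<le> M ^ k * norm A" for k
  proof (induction k)
    case (Suc k)
    have "norm (a (Suc k)) \<le> norm (a k) * M" unfolding aS by (rule M)
    also have "\<dots> \<le> M ^ k * norm A * M" using Suc M(2) by (intro mult_right_mono)
    finally show ?case by (simp add: mult_ac)
  qed (simp add: a0)
  have sm: "summable (\<lambda>k. ent (a (k + m)) i j / fact k * z ^ k)" for i j m and z :: complex
  proof (rule summable_comparison_test')
    have "summable (\<lambda>k. (M ^ m * norm A) * (inverse (fact k) * (M * cmod z) ^ k))"
      by (intro summable_mult summable_exp)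
    then show "summable (\<lambda>k. M ^ m * norm A * ((M * cmod z) ^ k / fact k))" by (simp add: field_simps)
    fix k :: nat assume "0 \<le> k"
    have "cmod (ent (a (k + m)) i j) \<le> M ^ (k + m) * norm A" using cmod_ent_le an order_trans by blast
    then have "cmod (ent (a (k + m)) i j) / fact k * cmod z ^ k \<le> M ^ (k + m) * norm A / fact k * cmod z ^ k"
      by (intro mult_right_mono divide_right_mono) auto
    then show "norm (ent (a (k + m)) i j / fact k * z ^ k) \<le> M ^ m * norm A * ((M * cmod z) ^ k / fact k)"
      by (simp add: norm_mult norm_divide norm_power power_add power_mult_distrib mult_ac)
  qed
  \<comment> \<open>Shifting the coefficients by one turns the series both into its image under
    \<open>L\<close> and into its termwise derivative; comparing \<open>Y 0\<close> with
    \<open>Y 1\<close> therefore yields the differential equation.\<close>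
  define Y where "Y = (\<lambda>m t. mkf n (\<lambda>i j. \<Sum>k. ent (a (k + m)) i j / fact k * complex_of_real t ^ k))"
  have Yc: "Y m t \<in> crn n" for m t by (simp add: Y_def)
  have lim: "(\<lambda>N. \<Sum>k<N. (t ^ k / fact k) *\<^sub>R a (k + m)) \<longlonglongrightarrow> Y m t" for m t
  proof (rule tendsto_crnI[of _ n])
    fix i j assume ij: "i < n" "j < n"
    have "(\<lambda>N. \<Sum>k<N. ent (a (k + m)) i j / fact k * complex_of_real t ^ k) \<longlonglongrightarrow> ent (Y m t) i j"
      using summable_LIMSEQ[OF sm] ij by (simp add: Y_def ent_mkf)
    also have "(\<lambda>N. \<Sum>k<N. ent (a (k + m)) i j / fact k * complex_of_real t ^ k) = (\<lambda>N. ent (\<Sum>k<N. (t ^ k / fact k) *\<^sub>R a (k + m)) i j)"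
      by (simp add: ent_sum mult_ac)
    finally show "(\<lambda>N. ent (\<Sum>k<N. (t ^ k / fact k) *\<^sub>R a (k + m)) i j) \<longlonglongrightarrow> ent (Y m t) i j" .
  qed (auto intro!: crn_sum simp: ac Yc)
  have LY: "L (Y 0 t) = Y 1 t" for t
  proof -
    have "(\<lambda>N. L (\<Sum>k<N. (t ^ k / fact k) *\<^sub>R a (k + 0))) \<longlonglongrightarrow> L (Y 0 t)" by (rule L.tendsto[OF lim])
    moreover have "(\<lambda>N. L (\<Sum>k<N. (t ^ k / fact k) *\<^sub>R a (k + 0))) = (\<lambda>N. \<Sum>k<N. (t ^ k / fact k) *\<^sub>R a (k + 1))"
      by (simp add: L.sum L.scaleR aS)
    ultimately show ?thesis using lim[of t 1] LIMSEQ_unique by metis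
  qed
  have deriv: "(Y 0 has_vector_derivative L (Y 0 t)) (at t)" for t
    unfolding LY
  proof (rule has_vector_derivative_crnI[of _ n, OF Yc Yc])
    fix i j assume ij: "i < n" "j < n"
    have "((\<lambda>z. \<Sum>k. ent (a k) i j / fact k * z ^ k) has_field_derivative
       (\<Sum>k. diffs (\<lambda>k. ent (a k) i j / fact k) k * complex_of_real t ^ k)) (at (complex_of_real t))"
      by (rule termdiffs_strong_converges_everywhere) (use sm[of 0] in simp)
    from has_vector_derivative_real_field[OF this]
    have "((\<lambda>s. \<Sum>k. ent (a k) i j / fact k * complex_of_real s ^ k) has_vector_derivative
       (\<Sum>k. diffs (\<lambda>k. ent (a k) i j / fact k) k * complex_of_real t ^ k)) (at t)" by blast
    also have "diffs (\<lambda>k. ent (a k) i j / fact k) = (\<lambda>k. ent (a (k + 1)) i j / fact k)"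
      by (rule ext) (simp add: diffs_def field_simps del: of_nat_Suc)
    finally show "((\<lambda>t. ent (Y 0 t) i j) has_vector_derivative ent (Y 1 t) i j) (at t)"
      using ij by (simp add: Y_def ent_mkf)
  qed
  have "Y 0 0 = A"
  proof (rule crn_eqI[OF Yc A])
    fix i j assume ij: "i < n" "j < n"
    have "(\<Sum>k. ent (a k) i j / fact k * (0::complex) ^ k) = ent (a 0) i j"
      using powser_zero[of "\<lambda>k. ent (a k) i j / fact k"] by simp
    then show "ent (Y 0 0) i j = ent A i j" using ij by (simp add: Y_def ent_mkf a0)
  qed
  then show ?thesis using Yc deriv by (intro exI[of _ "Y 0"]) simp
qed

text \<open>Of the bit flip only the properties of a self-adjoint unitary are kept here. The
  elements of \<open>Ks\<close> play the role of the Hamiltonians multiplied by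
  \<open>- \<i>\<close>.\<close>

locale noisy =
  fixes n :: nat and X :: fmat and Ks :: "fmat set" and c :: real
  assumes Xc [simp]: "X \<in> crn n" and Xadj [simp]: "adj X = X" and XX: "X * X = eN n"
    and Ks: "Ks \<subseteq> skew n" and c: "0 < c"
begin

definition gen :: "fmat \<Rightarrow> real \<Rightarrow> fmat \<Rightarrow> fmat" where
  "gen K g A = K * A - A * K - g *\<^sub>R (A - X * A * X)"

lemma Xuni: "X \<in> uni n"
  unfolding uni_def using XX by simp

lemma norm_XX: "A \<in> crn n \<Longrightarrow> norm (X * A * X) = norm A"
  using norm_conj[OF Xuni] by simp

lemma norm_delta: "A \<in> crn n \<Longrightarrow> norm (A - X * A * X) \<le> 2 * norm A"
  using norm_triangle_ineq4[of A "X * A * X"] norm_XX by simp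

lemma norm_comm: "norm (K * A - A * K) \<le> 2 * norm K * norm A" for K A :: fmat
  using norm_triangle_ineq4[of "K * A" "A * K"] norm_mult_ineq[of K A] norm_mult_ineq[of A K]
  by (simp add: mult.commute)

lemma gen_crn: "K \<in> skew n \<Longrightarrow> A \<in> crn n \<Longrightarrow> gen K g A \<in> crn n"
  by (simp add: gen_def skewD)

lemma gen_diff: "gen K g (A - B) = gen K g A - gen K g B"
  by (simp add: gen_def algebra_simps)

lemma bounded_linear_gen: "bounded_linear (gen K g)"
  unfolding gen_def
  by (intro bounded_linear_sub bounded_linear_const_scaleR bounded_linear_mult_left bounded_linear_mult_right bounded_linear_ident
      bounded_linear_compose[OF bounded_linear_mult_left bounded_linear_mult_right] bounded_linear_scaleR_right
      bounded_linear_compose[OF bounded_linear_scaleR_right])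

lemma norm_gen: "A \<in> crn n \<Longrightarrow> 0 \<le> g \<Longrightarrow> norm (gen K g A) \<le> (2 * norm K + 2 * g) * norm A"
proof -
  assume A: "A \<in> crn n" and g: "0 \<le> g"
  have "norm (gen K g A) \<le> norm (K * A - A * K) + g * norm (A - X * A * X)"
    unfolding gen_def using norm_triangle_ineq4[of "K * A - A * K" "g *\<^sub>R (A - X * A * X)"] g by simp
  also have "\<dots> \<le> 2 * norm K * norm A + g * (2 * norm A)"
    by (intro add_mono norm_comm mult_left_mono norm_delta A g)
  finally show ?thesis by (simp add: algebra_simps)
qed

text \<open>The commutator with a skew matrix is orthogonal to \<open>A\<close>, and Cauchy-Schwarz
  bounds \<open>inner A (X * A * X)\<close> by \<open>inner A A\<close> because conjugation by
  \<open>X\<close> is isometric. Applied to differences of solutions, this makes the flow a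
  contraction.\<close>

lemma gen_dissipative:
  assumes "K \<in> skew n" "A \<in> crn n" "0 \<le> g"
  shows "inner A (gen K g A) \<le> 0"
proof -
  have "inner A (K * A) = inner (adj K * A) A" by (simp add: inner_mult_left)
  then have 1: "inner A (K * A) = 0" using skewD[OF assms(1)] by (simp add: inner_commute)
  have "inner A (A * K) = inner (A * adj K) A" by (simp add: inner_mult_right)
  then have 2: "inner A (A * K) = 0" using skewD[OF assms(1)] by (simp add: inner_commute)
  have "inner A (X * A * X) \<le> norm A * norm (X * A * X)" by (rule norm_cauchy_schwarz)
  then have "inner A (X * A * X) \<le> inner A A" using norm_XX[OF assms(2)]
    by (simp add: power2_norm_eq_inner flip: power2_eq_square)
  then have "0 \<le> g * (inner A A - inner A (X * A * X))" using assms(3) by simp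
  then show ?thesis by (simp add: gen_def inner_diff_right 1 2)
qed

definition sol :: "fmat \<Rightarrow> real \<Rightarrow> real \<Rightarrow> (real \<Rightarrow> fmat) \<Rightarrow> bool" where
  "sol K g T y \<longleftrightarrow> (\<forall>t\<in>{0..T}. y t \<in> crn n \<and> (y has_vector_derivative gen K g (y t)) (at t within {0..T}))"

lemma sol_nonexpansive:
  assumes "sol K g T y" "sol K g T z" "K \<in> skew n" "0 \<le> g" "0 \<le> T"
  shows "norm (y T - z T) \<le> norm (y 0 - z 0)"
proof (rule norm_nonincreasing[of "{}", where D = "\<lambda>t. gen K g (y t - z t)"])
  have d: "((\<lambda>t. y t - z t) has_vector_derivative gen K g (y t - z t)) (at t within {0..T})" if "t \<in> {0..T}" for t
    using assms(1,2) that unfolding sol_def gen_diff by (intro has_vector_derivative_diff) auto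
  then show "continuous_on {0..T} (\<lambda>t. y t - z t)"
    unfolding continuous_on_eq_continuous_within using has_vector_derivative_continuous by blast
  show "((\<lambda>t. y t - z t) has_vector_derivative gen K g (y t - z t)) (at t within {0..T})" if "t \<in> {0..T} - {}" for t
    using d that by simp
  show "inner (y t - z t) (gen K g (y t - z t)) \<le> 0" if "t \<in> {0..T} - {}" for t
    using assms that by (intro gen_dissipative) (auto simp: sol_def)
qed (use assms in auto)

lemma sol_exists:
  assumes "K \<in> skew n" "A \<in> crn n"
  shows "\<exists>y. y 0 = A \<and> (\<forall>T. sol K g T y)"
proof -
  obtain y where y: "y 0 = A" "\<And>t. y t \<in> crn n" "\<And>t. (y has_vector_derivative gen K g (y t)) (at t)"
    using linear_flow_exists[OF bounded_linear_gen gen_crn[OF assms(1)] assms(2), of g] by blast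
  then show ?thesis unfolding sol_def by (intro exI[of _ y]) (auto intro: has_vector_derivative_at_within)
qed

lemma sol_zero: "sol K g T (\<lambda>_. 0)"
  by (simp add: sol_def gen_def)

lemma sol_restrict: "sol K g T y \<Longrightarrow> S \<le> T \<Longrightarrow> sol K g S y"
  unfolding sol_def by (auto intro: has_vector_derivative_within_subset[of _ _ _ "{0..T}"])

lemma sol_norm_le:
  assumes "sol K g T y" "K \<in> skew n" "0 \<le> g" "s \<in> {0..T}"
  shows "norm (y s) \<le> norm (y 0)"
  using sol_nonexpansive[OF sol_restrict[OF assms(1)] sol_zero assms(2,3), of s] assms(4) by simp

lemma sol_taylor:
  assumes "sol K g h y" "K \<in> skew n" "0 \<le> g" "0 \<le> h"
  shows "norm (y h - y 0 - h *\<^sub>R gen K g (y 0)) \<le> (2 * norm K + 2 * g)\<^sup>2 * norm (y 0) * h\<^sup>2"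
proof -
  let ?M = "2 * norm K + 2 * g"
  have "norm (y h - y 0 - h *\<^sub>R gen K g (y 0)) \<le> ?M * (?M * norm (y 0)) * h\<^sup>2"
  proof (rule linear_ode_taylor[OF assms(4)])
    fix s assume s: "s \<in> {0..h}"
    show "(y has_vector_derivative gen K g (y s)) (at s within {0..h})" using assms s by (simp add: sol_def)
    have c: "y s \<in> crn n" "y 0 \<in> crn n" using assms s by (auto simp: sol_def)
    show "norm (gen K g (y s) - gen K g (y 0)) \<le> ?M * norm (y s - y 0)"
      unfolding gen_diff[symmetric] using c assms by (intro norm_gen) auto
    have "norm (gen K g (y s)) \<le> ?M * norm (y s)" using c assms by (intro norm_gen)
    also have "\<dots> \<le> ?M * norm (y 0)" using assms s by (intro mult_left_mono sol_norm_le) auto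
    finally show "norm (gen K g (y s)) \<le> ?M * norm (y 0)" .
  qed (use assms in auto)
  then show ?thesis by (simp add: power2_eq_square mult_ac)
qed

lemma sol_unitary:
  assumes K: "K \<in> skew n" and A: "A \<in> crn n"
  shows "sol K 0 T (\<lambda>t. fexp n K t * A * adj (fexp n K t))"
proof -
  note E = is_fexp_fexp[OF K]
  let ?E = "fexp n K"
  have "((\<lambda>t. ?E t * A * adj (?E t)) has_vector_derivative gen K 0 (?E t * A * adj (?E t))) (at t within S)" for t S
  proof -
    have 1: "((\<lambda>t. ?E t * A) has_vector_derivative K * ?E t * A) (at t within S)"
      by (rule bounded_linear.has_vector_derivative[OF bounded_linear_mult_left fexp_deriv[OF E]])
    have 2: "((\<lambda>t. adj (?E t)) has_vector_derivative adj (K * ?E t)) (at t within S)"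
      by (rule bounded_linear.has_vector_derivative[OF bounded_linear_adj fexp_deriv[OF E]])
    have "((\<lambda>t. ?E t * A * adj (?E t)) has_vector_derivative (?E t * A * adj (K * ?E t) + K * ?E t * A * adj (?E t))) (at t within S)"
      by (rule has_vector_derivative_mult[OF 1 2])
    moreover have "?E t * A * adj (K * ?E t) + K * ?E t * A * adj (?E t) = gen K 0 (?E t * A * adj (?E t))"
      using skewD(2)[OF K] by (simp add: gen_def mult.assoc)
    ultimately show ?thesis by simp
  qed
  then show ?thesis unfolding sol_def using A fexp_crn[OF E] by simp
qed

lemma conj_taylor:
  assumes K: "K \<in> skew n" and A: "A \<in> crn n" and "0 \<le> h"
  shows "norm (fexp n K h * A * adj (fexp n K h) - A - h *\<^sub>R (K * A - A * K)) \<le> (2 * norm K)\<^sup>2 * norm A * h\<^sup>2"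
  using sol_taylor[OF sol_unitary[OF K A] K order_refl assms(3)] A by (simp add: fexp_0[OF is_fexp_fexp[OF K]] gen_def)

text \<open>Controls are maps on the whole corner and not pairs of states, so that a control chosen
  for one state can be applied to a nearby one.\<close>

definition stepm :: "(fmat \<Rightarrow> fmat) set" where
  "stepm = {f. \<exists>K\<in>Ks. \<exists>g\<in>{0, c}. \<exists>T\<ge>0. \<forall>A\<in>crn n. \<exists>y. sol K g T y \<and> y 0 = A \<and> y T = f A}"

inductive_set ctl :: "(fmat \<Rightarrow> fmat) set" where
  ctl_id: "id \<in> ctl"
| ctl_step: "f \<in> stepm \<Longrightarrow> g \<in> ctl \<Longrightarrow> f \<circ> g \<in> ctl"

definition cls :: "fmat \<Rightarrow> fmat set" where
  "cls A = {B \<in> crn n. \<forall>e>0. \<exists>f\<in>ctl. norm (f A - B) < e}"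

lemma stepm_props:
  assumes "f \<in> stepm"
  shows "A \<in> crn n \<Longrightarrow> f A \<in> crn n"
    and "A \<in> crn n \<Longrightarrow> B \<in> crn n \<Longrightarrow> norm (f A - f B) \<le> norm (A - B)"
proof -
  obtain K g T where K: "K \<in> skew n" "0 \<le> g" "0 \<le> T" and f: "\<And>A. A \<in> crn n \<Longrightarrow> \<exists>y. sol K g T y \<and> y 0 = A \<and> y T = f A"
  proof -
    obtain K g T where K: "K \<in> Ks" "g \<in> {0, c}" "0 \<le> T" "\<forall>A\<in>crn n. \<exists>y. sol K g T y \<and> y 0 = A \<and> y T = f A"
      using assms unfolding stepm_def by blast
    show ?thesis by (rule that[of K g T]) (use K Ks c in auto)
  qed
  show "f A \<in> crn n" if "A \<in> crn n"
  proof -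
    obtain y where "sol K g T y" "y T = f A" using f[OF \<open>A \<in> crn n\<close>] by blast
    then show ?thesis using K(3) unfolding sol_def by (metis atLeastAtMost_iff order_refl)
  qed
  show "norm (f A - f B) \<le> norm (A - B)" if "A \<in> crn n" "B \<in> crn n"
    using f[OF that(1)] f[OF that(2)] sol_nonexpansive[OF _ _ K] by metis
qed

lemma ctl_props:
  assumes "f \<in> ctl"
  shows "(\<forall>A\<in>crn n. f A \<in> crn n) \<and> (\<forall>A\<in>crn n. \<forall>B\<in>crn n. norm (f A - f B) \<le> norm (A - B))"
  using assms
proof (induction rule: ctl.induct)
  case (ctl_step f g)
  have "norm (f (g A) - f (g B)) \<le> norm (A - B)" if "A \<in> crn n" "B \<in> crn n" for A B
    using order_trans[OF stepm_props(2)[OF ctl_step(1)]] ctl_step.IH that by blast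
  then show ?case using stepm_props(1)[OF ctl_step(1)] ctl_step.IH by simp
qed auto

lemma ctl_comp: "f \<in> ctl \<Longrightarrow> g \<in> ctl \<Longrightarrow> f \<circ> g \<in> ctl"
  by (induction rule: ctl.induct) (auto simp: comp_assoc intro: ctl_step)

lemma cls_refl: "A \<in> crn n \<Longrightarrow> A \<in> cls A"
  unfolding cls_def using ctl_id by force

lemma cls_step: "f \<in> stepm \<Longrightarrow> A \<in> crn n \<Longrightarrow> f A \<in> cls A"
  unfolding cls_def using ctl_step[OF _ ctl_id, of f] stepm_props by force

lemma cls_crn: "B \<in> cls A \<Longrightarrow> B \<in> crn n"
  by (simp add: cls_def)

lemma clsD: "B \<in> cls A \<Longrightarrow> 0 < e \<Longrightarrow> \<exists>f\<in>ctl. norm (f A - B) < e"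
  by (simp add: cls_def)

text \<open>The control leading from \<open>B\<close> towards \<open>C\<close> is applied to a state
  merely near \<open>B\<close>; being nonexpansive, it does not enlarge that error.\<close>

lemma cls_trans:
  assumes "B \<in> cls A" "C \<in> cls B" "A \<in> crn n" shows "C \<in> cls A"
proof -
  have "\<exists>f\<in>ctl. norm (f A - C) < e" if "e > 0" for e
  proof -
    have e2: "e / 2 > 0" using that by simp
    obtain f where f: "f \<in> ctl" "norm (f A - B) < e / 2" using assms(1) clsD e2 by blast
    obtain g where g: "g \<in> ctl" "norm (g B - C) < e / 2" using assms(2) clsD e2 by blast
    have "norm (g (f A) - g B) \<le> norm (f A - B)" using ctl_props[OF g(1)] ctl_props[OF f(1)] assms cls_crn by blast
    then have "norm ((g \<circ> f) A - C) < e" using f(2) g(2) norm_triangle_ineq[of "g (f A) - g B" "g B - C"] by simp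
    then show ?thesis using ctl_comp[OF g(1) f(1)] by blast
  qed
  then show ?thesis using assms(2) by (simp add: cls_def)
qed

lemma cls_closed:
  assumes "C \<in> crn n" "\<And>e. 0 < e \<Longrightarrow> \<exists>B\<in>cls A. norm (B - C) < e" shows "C \<in> cls A"
proof -
  have "\<exists>f\<in>ctl. norm (f A - C) < e" if "e > 0" for e
  proof -
    have e2: "e / 2 > 0" using that by simp
    obtain B where B: "B \<in> cls A" "norm (B - C) < e / 2" using assms(2)[OF e2] by blast
    obtain f where f: "f \<in> ctl" "norm (f A - B) < e / 2" using B(1) clsD e2 by blast
    have "norm (f A - C) < e" using f(2) B(2) norm_triangle_ineq[of "f A - B" "B - C"] by simp
    then show ?thesis using f by blast
  qed
  then show ?thesis using assms(1) by (simp add: cls_def)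
qed

lemma conj_diff_le:
  assumes "V \<in> uni n" "W \<in> uni n" "A \<in> crn n"
  shows "norm (V * A * adj V - W * A * adj W) \<le> 2 * norm (V - W) * norm A"
proof -
  have "V * A * adj V - W * A * adj W = (V - W) * A * adj V + W * (A * adj (V - W))"
    by (simp add: algebra_simps)
  then have "norm (V * A * adj V - W * A * adj W) \<le> norm ((V - W) * A * adj V) + norm (W * (A * adj (V - W)))"
    by (simp only: norm_triangle_ineq)
  also have "norm ((V - W) * A * adj V) = norm ((V - W) * A)"
    using assms by (intro norm_uni_right[OF uni_closed(2)]) auto
  also have "norm (W * (A * adj (V - W))) = norm (A * adj (V - W))"
    using assms by (intro norm_uni_left) auto
  also have "norm ((V - W) * A) \<le> norm (V - W) * norm A" by (rule norm_mult_ineq)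
  also have "norm (A * adj (V - W)) \<le> norm (V - W) * norm A"
    using norm_mult_ineq[of A "adj (V - W)"] unfolding norm_adj by (simp only: mult.commute)
  finally show ?thesis by (simp add: mult_ac)
qed

text \<open>Only nonnegative times are control steps. A negative \<open>t\<close> is replaced by
  \<open>t + \<tau>\<close>, where \<open>\<tau>\<close> is a return time at least
  \<open>- t\<close>.\<close>

lemma conj_fexp_cls:
  assumes K: "K \<in> Ks" and A: "A \<in> crn n"
  shows "fexp n K t * A * adj (fexp n K t) \<in> cls A"
proof -
  have Ks': "K \<in> skew n" using K Ks by auto
  note E = is_fexp_fexp[OF Ks']
  let ?E = "fexp n K"
  have pos: "?E s * A * adj (?E s) \<in> cls A" if s: "0 \<le> s" for s
  proof -
    have "(\<lambda>A. ?E s * A * adj (?E s)) \<in> stepm"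
      unfolding stepm_def mem_Collect_eq
      by (intro bexI[OF _ K] bexI[of _ 0] exI[of _ s] conjI s ballI exI[of _ "\<lambda>t. ?E t * _ * adj (?E t)"] sol_unitary[OF Ks'])
        (simp_all add: fexp_0[OF E])
    from cls_step[OF this A] show ?thesis .
  qed
  show ?thesis
  proof (rule cls_closed)
    show "?E t * A * adj (?E t) \<in> crn n" using A fexp_crn[OF E] by simp
    fix e :: real assume e: "e > 0"
    \<comment> \<open>A deviation of the unitary enters the conjugated state multiplied by at most
      \<open>2 * norm A\<close>; the added 1 excludes division by 0.\<close>
    let ?e = "e / (2 * norm A + 1)"
    have pos1: "2 * norm A + 1 > 0" by (simp add: add_nonneg_pos)
    obtain \<tau> where \<tau>: "- t \<le> \<tau>" "norm (?E \<tau> - eN n) < ?e"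
      using fexp_recurrent[OF E, of ?e "- t"] e pos1 by auto
    have "?E (t + \<tau>) - ?E t = ?E t * (?E \<tau> - eN n)"
      using fexp_crn[OF E] by (simp add: fexp_add[OF E] right_diff_distrib)
    then have "norm (?E (t + \<tau>) - ?E t) = norm (?E \<tau> - eN n)"
      using norm_uni_left[OF fexp_uni[OF E]] fexp_crn[OF E] by simp
    then have "norm (?E (t + \<tau>) * A * adj (?E (t + \<tau>)) - ?E t * A * adj (?E t)) \<le> 2 * norm (?E \<tau> - eN n) * norm A"
      using conj_diff_le[OF fexp_uni[OF E] fexp_uni[OF E] A] by metis
    also have "\<dots> \<le> 2 * ?e * norm A" using \<tau>(2) by (intro mult_right_mono mult_left_mono) auto
    also have "\<dots> < e" using e pos1 by (simp add: field_simps)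
    finally show "\<exists>B\<in>cls A. norm (B - ?E t * A * adj (?E t)) < e" using pos[of "t + \<tau>"] \<tau>(1) by force
  qed
qed

lemma conj_grp_cls:
  assumes "V \<in> grp n Ks" "A \<in> crn n"
  shows "V * A * adj V \<in> cls A"
  using assms
proof (induction rule: grp.induct)
  case grp_one
  then show ?case by (simp add: cls_refl)
next
  case (grp_step K U t)
  have c: "U * A * adj U \<in> crn n" using grp_step cls_crn by blast
  have "fexp n K t * (U * A * adj U) * adj (fexp n K t) \<in> cls A"
    using cls_trans[OF grp_step.IH[OF grp_step.prems] conj_fexp_cls[OF grp_step(1) c] grp_step.prems] .
  then show ?case by (simp add: mult.assoc)
qed

end

section \<open>Arbitrary unitaries and drift-free noise\<close>

locale controllable_noisy = noisy +
  assumes dense: "\<And>U e. U \<in> uni n \<Longrightarrow> 0 < e \<Longrightarrow> \<exists>V\<in>grp n Ks. \<exists>z. cmod z = 1 \<and> norm (V - cs z U) < e"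
    and Ks_ne: "Ks \<noteq> {}"
begin

text \<open>Density holds only up to a global phase, and a global phase cancels in the
  conjugation.\<close>

lemma conj_uni_cls:
  assumes U: "U \<in> uni n" and A: "A \<in> crn n"
  shows "U * A * adj U \<in> cls A"
proof (rule cls_closed)
  show "U * A * adj U \<in> crn n" using U A by simp
  fix e :: real assume e: "e > 0"
  let ?e = "e / (2 * norm A + 1)"
  have pos1: "2 * norm A + 1 > 0" by (simp add: add_nonneg_pos)
  obtain V z where V: "V \<in> grp n Ks" "cmod z = 1" "norm (V - cs z U) < ?e" using dense[OF U, of ?e] e pos1 by auto
  have zz: "z * cnj z = 1" "cnj z * z = 1" using V(2) by (simp_all add: complex_norm_square[symmetric] mult.commute)
  have zU: "cs z U \<in> uni n" unfolding uni_def using U zz by simp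
  have "cs z U * A * adj (cs z U) = U * A * adj U" using zz by simp
  then have "norm (V * A * adj V - U * A * adj U) \<le> 2 * norm (V - cs z U) * norm A"
    using conj_diff_le[OF grp_uni[OF Ks V(1)] zU A] by simp
  also have "\<dots> \<le> 2 * ?e * norm A" using V(3) by (intro mult_right_mono mult_left_mono) auto
  also have "\<dots> < e" using e pos1 by (simp add: field_simps)
  finally show "\<exists>B\<in>cls A. norm (B - U * A * adj U) < e" using conj_grp_cls[OF V(1) A] by blast
qed

definition mix :: "real \<Rightarrow> fmat \<Rightarrow> fmat" where "mix q A = A - q *\<^sub>R (A - X * A * X)"

lemma mix_crn: "A \<in> crn n \<Longrightarrow> mix q A \<in> crn n"
  by (simp add: mix_def)

lemma delta_delta: "A \<in> crn n \<Longrightarrow> (A - X * A * X) - X * (A - X * A * X) * X = 2 *\<^sub>R (A - X * A * X)"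
proof -
  assume A: "A \<in> crn n"
  have "X * (X * A * X) * X = (X * X) * A * (X * X)" by (simp only: mult.assoc)
  then have "X * (X * A * X) * X = A" using A XX by simp
  then show ?thesis by (simp add: right_diff_distrib left_diff_distrib scaleR_2)
qed

text \<open>The defect \<open>A - X * A * X\<close> is doubled when its own defect is formed,
  because conjugation by \<open>X\<close> is an involution. Hence flip probabilities compose as for
  independent flips.\<close>

lemma mix_mix: "A \<in> crn n \<Longrightarrow> mix p (mix q A) = mix (p + q - 2 * p * q) A"
proof -
  assume A: "A \<in> crn n"
  define D where "D = A - X * A * X"
  have "mix p (mix q A) = A - q *\<^sub>R D - p *\<^sub>R (D - q *\<^sub>R (D - X * D * X))"
    by (simp add: mix_def D_def algebra_simps)
  also have "D - X * D * X = 2 *\<^sub>R D" unfolding D_def by (rule delta_delta[OF A])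
  also have "A - q *\<^sub>R D - p *\<^sub>R (D - q *\<^sub>R 2 *\<^sub>R D) = A - (p + q - 2 * p * q) *\<^sub>R D"
    by (simp add: algebra_simps)
  finally show ?thesis by (simp add: mix_def D_def)
qed

lemma norm_mix: assumes "A \<in> crn n" "0 \<le> q" "q \<le> 1" shows "norm (mix q A) \<le> norm A"
proof -
  have "mix q A = (1 - q) *\<^sub>R A + q *\<^sub>R (X * A * X)" by (simp add: mix_def algebra_simps)
  then have "norm (mix q A) \<le> (1 - q) * norm A + q * norm (X * A * X)"
    using norm_triangle_ineq[of "(1 - q) *\<^sub>R A" "q *\<^sub>R (X * A * X)"] assms by simp
  then show ?thesis unfolding norm_XX[OF assms(1)] by (simp add: algebra_simps)
qed

text \<open>The solution of \<open>q' = c * (1 - 2 * q)\<close> with \<open>q 0 = 0\<close>: the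
  flip probability produced by noise of rate \<open>c\<close> and duration \<open>t\<close> without
  drift. It stays strictly below 1/2.\<close>

definition qt :: "real \<Rightarrow> real" where "qt t = (1 - exp (- 2 * c * t)) / 2"

lemma qt_add: "qt (s + t) = qt s + qt t - 2 * qt s * qt t"
proof -
  have "exp (- 2 * c * (s + t)) = exp (- 2 * c * s) * exp (- 2 * c * t)"
    by (simp add: distrib_left flip: exp_add)
  then show ?thesis by (simp add: qt_def field_simps)
qed

lemma qt_bounds: assumes "0 \<le> h" shows "0 \<le> qt h" "qt h \<le> 1" "qt h \<le> c * h" "c * h - qt h \<le> 2 * c\<^sup>2 * h\<^sup>2"
proof -
  define x where "x = 2 * c * h"
  have x: "0 \<le> x" using assms c by (simp add: x_def)
  have q: "qt h = (1 - exp (- x)) / 2" by (simp add: qt_def x_def)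
  show "0 \<le> qt h" using x by (simp add: q)
  have "0 \<le> exp (- x)" by (rule exp_ge_zero)
  then show "qt h \<le> 1" unfolding q by (simp add: pos_divide_le_eq del: exp_ge_zero)
  show "qt h \<le> c * h" using exp_ge_add_one_self[of "- x"] by (simp add: q x_def)
  have "exp (- x) \<le> 1 / (1 + x)"
    using exp_ge_add_one_self[of x] x by (simp add: exp_minus divide_simps)
  also have "\<dots> \<le> 1 - x + x\<^sup>2"
  proof -
    have "(1 - x + x\<^sup>2) * (1 + x) = 1 + x ^ 3" by (simp add: algebra_simps power2_eq_square power3_eq_cube)
    then have "1 \<le> (1 - x + x\<^sup>2) * (1 + x)" using x by simp
    then show ?thesis using x by (simp add: pos_divide_le_eq)
  qed
  finally have "exp (- x) \<le> 1 - x + x\<^sup>2" .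
  moreover have "c * h = x / 2" "2 * c\<^sup>2 * h\<^sup>2 = x\<^sup>2 / 2" by (simp_all add: x_def power_mult_distrib)
  ultimately show "c * h - qt h \<le> 2 * c\<^sup>2 * h\<^sup>2" unfolding q by (simp add: field_simps)
qed

text \<open>One Trotter step: noise with drift \<open>K\<close> switched on for time \<open>h\<close>, followed by undoing the drift.\<close>

lemma trotter_step:
  assumes K: "K \<in> Ks"
  shows "\<exists>C\<ge>0. \<forall>h\<ge>0. \<exists>F. (\<forall>A\<in>crn n. F A \<in> cls A) \<and>
    (\<forall>A\<in>crn n. \<forall>B\<in>crn n. norm (F A - F B) \<le> norm (A - B)) \<and>
    (\<forall>A\<in>crn n. norm (F A - mix (qt h) A) \<le> C * h\<^sup>2 * norm A)"
proof -
  have Ks': "K \<in> skew n" using K Ks by auto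
  have Kc: "K \<in> crn n" using Ks' skewD by blast
  note E = is_fexp_fexp[OF Ks']
  let ?E = "fexp n K"
  define M where "M = 2 * norm K + 2 * c"
  \<comment> \<open>One summand per second-order error: the noisy flow, the replacement of
    \<open>c * h\<close> by \<open>qt h\<close>, the commutator of the drift with the defect, and
    the unitary that is to be undone.\<close>
  define C where "C = M\<^sup>2 + 4 * c\<^sup>2 + 4 * norm K * c + (2 * norm K)\<^sup>2"
  have C: "C \<ge> 0" using c by (simp add: C_def)
  show ?thesis
  proof (intro exI[of _ C] conjI C allI impI)
    fix h :: real assume h: "0 \<le> h"
    have "\<forall>A\<in>crn n. \<exists>y. sol K c h y \<and> y 0 = A" using sol_exists[OF Ks'] by blast
    then obtain Y where Y: "\<And>A. A \<in> crn n \<Longrightarrow> sol K c h (Y A) \<and> Y A 0 = A" by metis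
    define P where "P = (\<lambda>A. Y A h)"
    have "P \<in> stepm" unfolding stepm_def mem_Collect_eq P_def
      by (intro bexI[OF _ K] bexI[of _ c] exI[of _ h] conjI h ballI) (use Y in auto)
    note P = stepm_props[OF this] cls_step[OF this]
    define F where "F = (\<lambda>A. ?E (- h) * P A * adj (?E (- h)))"
    have Eu: "?E (- h) \<in> uni n" by (rule fexp_uni[OF E])
    show "\<exists>F. (\<forall>A\<in>crn n. F A \<in> cls A) \<and> (\<forall>A\<in>crn n. \<forall>B\<in>crn n. norm (F A - F B) \<le> norm (A - B)) \<and>
      (\<forall>A\<in>crn n. norm (F A - mix (qt h) A) \<le> C * h\<^sup>2 * norm A)"
    proof (intro exI[of _ F] conjI ballI)
      fix A assume A: "A \<in> crn n"
      show "F A \<in> cls A" unfolding F_def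
        by (rule cls_trans[OF P(3)[OF A] conj_fexp_cls[OF K P(1)[OF A]] A])
      show "norm (F A - F B) \<le> norm (A - B)" if B: "B \<in> crn n" for B
      proof -
        have "F A - F B = ?E (- h) * (P A - P B) * adj (?E (- h))" by (simp add: F_def algebra_simps)
        then have "norm (F A - F B) = norm (P A - P B)" using norm_conj[OF Eu] P A B by simp
        then show ?thesis using P A B by simp
      qed
      define D where "D = A - X * A * X"
      define B where "B = mix (qt h) A"
      have Bd: "B = A - qt h *\<^sub>R D" by (simp add: B_def mix_def D_def)
      have Bc: "B \<in> crn n" and Dc: "D \<in> crn n" unfolding B_def D_def using A mix_crn by simp_all
      have nD: "norm D \<le> 2 * norm A" unfolding D_def by (rule norm_delta[OF A])
      define R1 where "R1 = P A - A - h *\<^sub>R gen K c A"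
      define R3 where "R3 = ?E h * B * adj (?E h) - B - h *\<^sub>R (K * B - B * K)"
      have R1: "norm R1 \<le> M\<^sup>2 * norm A * h\<^sup>2"
        unfolding R1_def P_def M_def using sol_taylor[of K c h "Y A"] Y[OF A] Ks' c h by simp
      have nB: "norm B \<le> norm A" unfolding B_def using norm_mix[OF A] qt_bounds[OF h] by simp
      have "norm R3 \<le> (2 * norm K)\<^sup>2 * norm B * h\<^sup>2" unfolding R3_def by (rule conj_taylor[OF Ks' Bc h])
      also have "\<dots> \<le> (2 * norm K)\<^sup>2 * norm A * h\<^sup>2" using nB by (intro mult_right_mono mult_left_mono) auto
      finally have R3: "norm R3 \<le> (2 * norm K)\<^sup>2 * norm A * h\<^sup>2" .
      have R2: "norm ((c * h - qt h) *\<^sub>R D) \<le> 4 * c\<^sup>2 * norm A * h\<^sup>2"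
      proof -
        have "norm ((c * h - qt h) *\<^sub>R D) = (c * h - qt h) * norm D" using qt_bounds[OF h] by simp
        also have "\<dots> \<le> (2 * c\<^sup>2 * h\<^sup>2) * (2 * norm A)" using qt_bounds[OF h] nD by (intro mult_mono) auto
        finally show ?thesis by (simp add: mult_ac)
      qed
      have R4: "norm ((h * qt h) *\<^sub>R (K * D - D * K)) \<le> 4 * norm K * c * norm A * h\<^sup>2"
      proof -
        have "norm ((h * qt h) *\<^sub>R (K * D - D * K)) = (h * qt h) * norm (K * D - D * K)" using qt_bounds[OF h] h by simp
        also have "\<dots> \<le> (h * (c * h)) * (2 * norm K * (2 * norm A))"
          using qt_bounds[OF h] h nD c order_trans[OF norm_comm mult_left_mono[OF nD, of "2 * norm K"]]
          by (intro mult_mono mult_left_mono) auto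
        finally show ?thesis by (simp add: power2_eq_square mult_ac)
      qed
      \<comment> \<open>The comparison is made before the drift is undone, where the first-order
        terms of both sides cancel; the final conjugation by \<open>?E (- h)\<close> does not change
        the norm.\<close>
      have eq: "P A - ?E h * B * adj (?E h) = R1 - (c * h - qt h) *\<^sub>R D + (h * qt h) *\<^sub>R (K * D - D * K) - R3"
        unfolding R1_def R3_def Bd gen_def D_def[symmetric] by (simp add: algebra_simps)
      have "norm (P A - ?E h * B * adj (?E h)) \<le> norm R1 + norm ((c * h - qt h) *\<^sub>R D) + norm ((h * qt h) *\<^sub>R (K * D - D * K)) + norm R3"
        unfolding eq by (intro order_trans[OF norm_triangle_ineq4] add_right_mono order_trans[OF norm_triangle_ineq] order_refl)
      also have "\<dots> \<le> C * h\<^sup>2 * norm A" using R1 R2 R3 R4 by (simp add: C_def algebra_simps)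
      finally have main: "norm (P A - ?E h * B * adj (?E h)) \<le> C * h\<^sup>2 * norm A" .
      have EE: "?E (- h) * ?E h = eN n" by (simp add: fexp_add[OF E, symmetric] fexp_0[OF E])
      have "?E (- h) * (?E h * B * adj (?E h)) * adj (?E (- h)) = (?E (- h) * ?E h) * B * adj (?E (- h) * ?E h)"
        by (simp add: mult.assoc)
      then have "F A - B = ?E (- h) * (P A - ?E h * B * adj (?E h)) * adj (?E (- h))"
        unfolding F_def using Bc EE by (simp add: left_diff_distrib right_diff_distrib)
      then have "norm (F A - B) = norm (P A - ?E h * B * adj (?E h))"
        using norm_conj[OF Eu] P(1)[OF A] Bc fexp_crn[OF E] by simp
      then show "norm (F A - mix (qt h) A) \<le> C * h\<^sup>2 * norm A" using main by (simp add: B_def)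
    qed
  qed
qed

text \<open>With \<open>k\<close> steps of length \<open>t / k\<close>, the ideal maps
  \<open>mix (qt h)\<close> compose exactly to \<open>mix (qt t)\<close>, and the contraction
  property lets the \<open>k\<close> errors add up to
  \<open>C * t\<^sup>2 * norm A / k\<close>.\<close>

lemma mix_qt_cls:
  assumes A: "A \<in> crn n" and t: "0 \<le> t"
  shows "mix (qt t) A \<in> cls A"
proof (rule cls_closed[OF mix_crn[OF A]])
  fix e :: real assume e: "e > 0"
  obtain K where "K \<in> Ks" using Ks_ne by auto
  from trotter_step[OF this] obtain C where C: "C \<ge> 0" and Cstep: "\<And>h. h \<ge> 0 \<Longrightarrow> \<exists>F. (\<forall>A\<in>crn n. F A \<in> cls A) \<and>
    (\<forall>A\<in>crn n. \<forall>B\<in>crn n. norm (F A - F B) \<le> norm (A - B)) \<and>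
    (\<forall>A\<in>crn n. norm (F A - mix (qt h) A) \<le> C * h\<^sup>2 * norm A)" by blast
  obtain k :: nat where k: "C * t\<^sup>2 * norm A / e < real k" using reals_Archimedean2 by blast
  have "0 \<le> C * t\<^sup>2 * norm A / e" using C e by simp
  then have k0: "real k > 0" using k by linarith
  define h where "h = t / real k"
  have h: "h \<ge> 0" using t k0 by (simp add: h_def)
  from Cstep[OF h] obtain F where F: "\<And>A. A \<in> crn n \<Longrightarrow> F A \<in> cls A"
    "\<And>A B. A \<in> crn n \<Longrightarrow> B \<in> crn n \<Longrightarrow> norm (F A - F B) \<le> norm (A - B)"
    "\<And>A. A \<in> crn n \<Longrightarrow> norm (F A - mix (qt h) A) \<le> C * h\<^sup>2 * norm A" by blast
  have "(F ^^ j) A \<in> cls A \<and> norm ((F ^^ j) A - mix (qt (real j * h)) A) \<le> real j * (C * h\<^sup>2 * norm A)" for j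
  proof (induction j)
    case 0
    then show ?case using A by (simp add: cls_refl qt_def mix_def)
  next
    case (Suc j)
    let ?G = "(F ^^ j) A" and ?B = "mix (qt (real j * h)) A"
    have jh: "real j * h \<ge> 0" using h by simp
    have Gc: "?G \<in> crn n" and Bc: "?B \<in> crn n" using Suc cls_crn mix_crn[OF A] by blast+
    have "F ?G \<in> cls A" using cls_trans[OF conjunct1[OF Suc] F(1)[OF Gc] A] .
    moreover have "mix (qt h) ?B = mix (qt (real (Suc j) * h)) A"
    proof -
      have "real (Suc j) * h = h + real j * h" by (simp add: algebra_simps)
      then show ?thesis by (simp add: mix_mix[OF A] qt_add)
    qed
    moreover have "norm (F ?G - mix (qt h) ?B) \<le> norm (F ?G - F ?B) + norm (F ?B - mix (qt h) ?B)"
      using norm_triangle_ineq[of "F ?G - F ?B" "F ?B - mix (qt h) ?B"] by simp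
    moreover have "norm (F ?G - F ?B) \<le> real j * (C * h\<^sup>2 * norm A)" using F(2)[OF Gc Bc] Suc by simp
    moreover have "norm (F ?B - mix (qt h) ?B) \<le> C * h\<^sup>2 * norm A"
    proof -
      have "norm ?B \<le> norm A" using norm_mix[OF A] qt_bounds[OF jh] by simp
      then have "C * h\<^sup>2 * norm ?B \<le> C * h\<^sup>2 * norm A" using C by (intro mult_left_mono) auto
      then show ?thesis using F(3)[OF Bc] by simp
    qed
    ultimately show ?case by (simp add: algebra_simps)
  qed
  from this[of k] have "(F ^^ k) A \<in> cls A" and nk: "norm ((F ^^ k) A - mix (qt (real k * h)) A) \<le> real k * (C * h\<^sup>2 * norm A)" by auto
  moreover have "real k * h = t" using k0 by (simp add: h_def)
  moreover have "real k * (C * h\<^sup>2 * norm A) < e"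
  proof -
    have "real k * (C * h\<^sup>2 * norm A) = C * t\<^sup>2 * norm A / real k" using k0 by (simp add: h_def power2_eq_square)
    also have "\<dots> < e" using k k0 e by (simp add: pos_divide_less_eq mult.commute)
    finally show ?thesis .
  qed
  ultimately show "\<exists>B\<in>cls A. norm (B - mix (qt t) A) < e" by (intro bexI[of _ "(F ^^ k) A"]) simp_all
qed

text \<open>Finite durations give only probabilities below 1/2. So \<open>q\<close> is shrunk to
  \<open>p = q * (1 - d)\<close>, the equation \<open>qt t = p\<close> is solved for
  \<open>t\<close>, and \<open>d\<close> is small enough for the closure to absorb the
  difference.\<close>

lemma mix_cls:
  assumes A: "A \<in> crn n" and q: "0 \<le> q" "q \<le> 1 / 2"
  shows "mix q A \<in> cls A"
proof (rule cls_closed[OF mix_crn[OF A]])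
  fix e :: real assume e: "e > 0"
  define w where "w = 2 * norm A + 1"
  have w: "w > 0" "2 * norm A \<le> w" using norm_ge_zero[of A] unfolding w_def by linarith+
  define r where "r = e / (2 * w)"
  have r: "r > 0" "r * w = e / 2" using e w by (simp_all add: r_def)
  define d where "d = min (1 / 4) r"
  have d: "0 < d" "d \<le> 1 / 4" "d \<le> r" using r(1) by (simp_all add: d_def)
  define p where "p = q * (1 - d)"
  have p: "0 \<le> p" "p < 1 / 2"
  proof -
    show "0 \<le> p" using q d by (simp add: p_def)
    have "p \<le> 1 / 2 * (1 - d)" unfolding p_def using q d by (intro mult_right_mono) linarith+
    also have "\<dots> < 1 / 2 * 1" using d by (intro mult_strict_left_mono) simp_all
    finally show "p < 1 / 2" by simp
  qed
  define t where "t = - ln (1 - 2 * p) / (2 * c)"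
  have "ln (1 - 2 * p) \<le> 0" using p by simp
  then have t: "0 \<le> t" using c by (simp add: t_def divide_nonpos_pos)
  have "- 2 * c * t = ln (1 - 2 * p)" using c by (simp add: t_def)
  then have "qt t = p" using p by (simp add: qt_def)
  then have in_cls: "mix p A \<in> cls A" using mix_qt_cls[OF A t] by simp
  have "mix p A - mix q A = (q * d) *\<^sub>R (A - X * A * X)" by (simp add: mix_def p_def algebra_simps)
  then have "norm (mix p A - mix q A) = q * d * norm (A - X * A * X)" using q d by simp
  also have "\<dots> \<le> 1 / 2 * d * (2 * norm A)" using q d norm_delta[OF A] by (intro mult_mono) auto
  also have "\<dots> \<le> d * w"
  proof -
    have "d * norm A \<le> d * w" using w(2) norm_ge_zero[of A] d by (intro mult_left_mono) linarith+
    then show ?thesis by simp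
  qed
  also have "\<dots> \<le> r * w" using w d(3) by (intro mult_right_mono) simp_all
  also have "\<dots> = e / 2" by (rule r)
  also have "\<dots> < e" using e by simp
  finally show "\<exists>B\<in>cls A. norm (B - mix q A) < e" using in_cls by blast
qed

end

subsection \<open>Majorization and the bit flip\<close>

text \<open>Muirhead's argument: every transform moves weight from a surplus to a later deficit and
  settles at least one more coordinate. The order of \<open>x\<close> may be lost on the way, so the
  induction compares sums of the first entries of \<open>x\<close> rather than of its largest
  ones.\<close>

lemma majorization_by_transforms:
  fixes x y :: "nat \<Rightarrow> real"
  assumes step: "\<And>d j k q. P d \<Longrightarrow> j < n \<Longrightarrow> k < n \<Longrightarrow> j \<noteq> k \<Longrightarrow> 0 \<le> q \<Longrightarrow> q \<le> 1 \<Longrightarrow>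
      P (d(j := (1 - q) * d j + q * d k, k := (1 - q) * d k + q * d j))"
    and cong: "\<And>d d'. P d \<Longrightarrow> (\<And>i. i < n \<Longrightarrow> d i = d' i) \<Longrightarrow> P d'"
    and y: "\<And>i j. i \<le> j \<Longrightarrow> j < n \<Longrightarrow> y j \<le> y i"
    and "\<And>m. m \<le> n \<Longrightarrow> (\<Sum>i<m. y i) \<le> (\<Sum>i<m. x i)" "(\<Sum>i<n. y i) = (\<Sum>i<n. x i)" "P x"
  shows "P y"
  using assms(4-6)
proof (induction "card {i. i < n \<and> x i \<noteq> y i}" arbitrary: x rule: less_induct)
  case less
  show ?case
  proof (cases "\<forall>i<n. x i = y i")
    case True
    then show ?thesis using cong[OF less.prems(3)] by auto
  next
    case False
    have "\<exists>k<n. x k < y k"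
    proof (rule ccontr)
      assume "\<not> ?thesis"
      then have ge: "\<forall>i<n. y i \<le> x i" by auto
      have "(\<Sum>i<n. x i - y i) = 0" using less.prems(2) by (simp add: sum_subtractf)
      then have "\<forall>i\<in>{..<n}. x i - y i = 0" using ge by (subst (asm) sum_nonneg_eq_0_iff) auto
      then show False using False by auto
    qed
    \<comment> \<open>At the first deficit \<open>k\<close> all earlier entries of \<open>x\<close>
      dominate those of \<open>y\<close>, and the partial sum up to and including \<open>k\<close>
      forces a surplus before it.\<close>
    define k where "k = (LEAST k. k < n \<and> x k < y k)"
    have k: "k < n" "x k < y k" using LeastI_ex[OF \<open>\<exists>k<n. x k < y k\<close>] unfolding k_def by auto
    have below: "y i \<le> x i" if "i < k" for i
      using not_less_Least[of i "\<lambda>k. k < n \<and> x k < y k"] that k unfolding k_def by auto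
    have "\<exists>j<k. y j < x j"
    proof (rule ccontr)
      assume "\<not> ?thesis"
      then have "(\<Sum>i<k. x i) \<le> (\<Sum>i<k. y i)" by (meson lessThan_iff not_less sum_mono)
      moreover have "(\<Sum>i<Suc k. y i) \<le> (\<Sum>i<Suc k. x i)" using k by (intro less.prems) simp
      ultimately show False using k by simp
    qed
    then obtain j where j: "j < k" "y j < x j" by blast
    have jn: "j < n" using j k by simp
    \<comment> \<open>The largest shift that overshoots neither target, hence one that attains at
      least one of them. The order of \<open>y\<close> makes it at most \<open>x j - x k\<close>, so
      that the weight \<open>q\<close> is admissible.\<close>
    define \<delta> where "\<delta> = min (x j - y j) (y k - x k)"
    have \<delta>: "0 < \<delta>" "\<delta> \<le> x j - y j" "\<delta> \<le> y k - x k" using j k by (auto simp: \<delta>_def)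
    have gap: "\<delta> \<le> x j - x k" "0 < x j - x k" using \<delta> y[of j k] j k by auto
    define q where "q = \<delta> / (x j - x k)"
    have q: "0 \<le> q" "q \<le> 1" using \<delta> gap by (auto simp: q_def)
    have qx: "q * (x j - x k) = \<delta>" using gap by (simp add: q_def)
    define x' where "x' = x(j := x j - \<delta>, k := x k + \<delta>)"
    have x'_eq: "x' = x(j := (1 - q) * x j + q * x k, k := (1 - q) * x k + q * x j)"
    proof -
      have "(1 - q) * x j + q * x k = x j - q * (x j - x k)" "(1 - q) * x k + q * x j = x k + q * (x j - x k)"
        by (simp_all add: algebra_simps)
      then show ?thesis by (simp only: x'_def qx)
    qed
    have sums: "(\<Sum>i<m. x' i) = (\<Sum>i<m. x i) - (if j < m then \<delta> else 0) + (if k < m then \<delta> else 0)" for m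
    proof -
      have "x' i = x i - (if i = j then \<delta> else 0) + (if i = k then \<delta> else 0)" for i using j by (auto simp: x'_def)
      then show ?thesis by (simp add: sum.distrib sum_subtractf)
    qed
    show ?thesis
    proof (rule less.hyps[of x'])
      have "{i. i < n \<and> x' i \<noteq> y i} \<subset> {i. i < n \<and> x i \<noteq> y i}"
      proof
        show "{i. i < n \<and> x' i \<noteq> y i} \<subseteq> {i. i < n \<and> x i \<noteq> y i}" using j k by (auto simp: x'_def)
        have "x' j = y j \<or> x' k = y k" using j by (auto simp: x'_def \<delta>_def min_def)
        then have "j \<notin> {i. i < n \<and> x' i \<noteq> y i} \<or> k \<notin> {i. i < n \<and> x' i \<noteq> y i}" by simp
        moreover have "j \<in> {i. i < n \<and> x i \<noteq> y i}" "k \<in> {i. i < n \<and> x i \<noteq> y i}" using j k jn by simp_all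
        ultimately show "{i. i < n \<and> x' i \<noteq> y i} \<noteq> {i. i < n \<and> x i \<noteq> y i}" by metis
      qed
      then show "card {i. i < n \<and> x' i \<noteq> y i} < card {i. i < n \<and> x i \<noteq> y i}" by (intro psubset_card_mono) auto
      show "P x'" unfolding x'_eq using j k q jn less.prems(3) by (intro step) auto
      show "(\<Sum>i<n. y i) = (\<Sum>i<n. x' i)" using sums[of n] jn k less.prems(2) by simp
      fix m assume m: "m \<le> n"
      show "(\<Sum>i<m. y i) \<le> (\<Sum>i<m. x' i)"
      \<comment> \<open>Only partial sums containing \<open>j\<close> but not \<open>k\<close>
        become smaller; all indices there lie below \<open>k\<close>, where \<open>x\<close>
        dominates, and \<open>j\<close> alone has a surplus of at least
        \<open>\<delta>\<close>.\<close>
      proof (cases "j < m \<and> \<not> k < m")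
        case True
        have "\<delta> \<le> (\<Sum>i\<in>{j}. x i - y i)" using \<delta> by simp
        also have "\<dots> \<le> (\<Sum>i<m. x i - y i)" using True below by (intro sum_mono2) auto
        finally show ?thesis using True sums[of m] by (simp add: sum_subtractf)
      next
        case False
        then show ?thesis using sums[of m] less.prems(1)[OF m] j \<delta> by auto
      qed
    qed
  qed
qed

section \<open>Monomial matrices, the bit flip and the Hadamard rotation\<close>

definition spm :: "nat \<Rightarrow> (nat \<Rightarrow> complex) \<Rightarrow> (nat \<Rightarrow> nat) \<Rightarrow> fmat" where
  "spm n s \<pi> = mkf n (\<lambda>i j. if j = \<pi> i then s i else 0)"

lemma spm_crn [simp]: "spm n s \<pi> \<in> crn n"
  by (simp add: spm_def)

lemma ent_spm_left:
  assumes "bij_betw \<pi> {..<n} {..<n}"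
  shows "ent (spm n s \<pi> * A) i j = (if i < n then s i * ent A (\<pi> i) j else 0)"
proof -
  have "\<pi> i < n" if "i < n" using bij_betwE[OF assms] that by auto
  moreover have "ent (spm n s \<pi> * A) i j = (\<Sum>k<n. if k = \<pi> i then (if i < n then s i * ent A (\<pi> i) j else 0) else 0)"
    unfolding ent_times_crn[OF spm_crn] by (intro sum.cong) (auto simp: spm_def ent_mkf)
  ultimately show ?thesis by simp
qed

lemma ent_spm_right:
  assumes "bij_betw \<pi> {..<n} {..<n}"
  shows "ent (A * adj (spm n s \<pi>)) i j = (if j < n then ent A i (\<pi> j) * cnj (s j) else 0)"
proof -
  have "ent (A * adj (spm n s \<pi>)) i j = cnj (ent (adj (A * adj (spm n s \<pi>))) j i)" by (simp only: ent_adj complex_cnj_cnj)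
  also have "adj (A * adj (spm n s \<pi>)) = spm n s \<pi> * adj A" by simp
  finally show ?thesis by (simp add: ent_spm_left[OF assms] mult.commute)
qed

text \<open>Unimodular entries cancel when a diagonal matrix is conjugated, so the signs that the
  rotated bit flip carries do no harm.\<close>

lemma spm_dg:
  assumes \<pi>: "bij_betw \<pi> {..<n} {..<n}" and s: "\<And>i. i < n \<Longrightarrow> s i * cnj (s i) = 1"
  shows "spm n s \<pi> * dg n d * adj (spm n s \<pi>) = dg n (\<lambda>i. d (\<pi> i))"
proof (rule crn_eqI[of _ n])
  fix i j assume ij: "i < n" "j < n"
  have "\<pi> i = \<pi> j \<longleftrightarrow> i = j" "\<pi> i < n" using \<pi> ij bij_betwE[OF \<pi>] by (auto simp: bij_betw_def inj_on_def)
  then show "ent (spm n s \<pi> * dg n d * adj (spm n s \<pi>)) i j = ent (dg n (\<lambda>i. d (\<pi> i))) i j"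
    using ij s[of i] by (simp add: ent_spm_right[OF \<pi>] ent_spm_left[OF \<pi>] ent_dg) (auto simp: mult_ac)
qed auto

lemma spm_uni:
  assumes \<pi>: "bij_betw \<pi> {..<n} {..<n}" and s: "\<And>i. i < n \<Longrightarrow> s i * cnj (s i) = 1"
  shows "spm n s \<pi> \<in> uni n"
proof -
  have 1: "spm n s \<pi> * adj (spm n s \<pi>) = eN n"
    using spm_dg[OF assms, where d = "\<lambda>_. 1"] by (simp add: dg_one)
  have "adj (spm n s \<pi>) * spm n s \<pi> = eN n"
  proof (rule crn_eqI[of _ n])
    fix i j assume ij: "i < n" "j < n"
    have "ent (adj (spm n s \<pi>) * spm n s \<pi>) i j = (\<Sum>k<n. (if i = \<pi> k \<and> j = \<pi> k then 1 else 0))"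
      unfolding ent_times_crn_right[OF spm_crn] using ij s by (intro sum.cong) (auto simp: spm_def ent_mkf mult.commute)
    also have "\<dots> = (\<Sum>k<n. (if i = k \<and> j = k then 1 else 0))"
      using sum.reindex_bij_betw[OF \<pi>, of "\<lambda>k. if i = k \<and> j = k then 1 else 0"] .
    also have "\<dots> = (\<Sum>k<n. if k = i then (if i = j then 1 else 0) else 0)" by (intro sum.cong) auto
    finally show "ent (adj (spm n s \<pi>) * spm n s \<pi>) i j = ent (eN n) i j" using ij by (simp add: ent_eN)
  qed auto
  then show ?thesis unfolding uni_def using 1 by simp
qed

text \<open>The index whose last binary digit is flipped, that is, the other level of the pair
  \<open>2 * k\<close>, \<open>2 * k + 1\<close>.\<close>

definition ptn :: "nat \<Rightarrow> nat" where "ptn i = (if even i then i + 1 else i - 1)"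

lemma ptn_ptn [simp]: "ptn (ptn i) = i" by (auto simp: ptn_def)
lemma ptn_less: "even n \<Longrightarrow> i < n \<Longrightarrow> ptn i < n"
  unfolding ptn_def by presburger
lemma ptn_neq [simp]: "ptn i \<noteq> i" "i \<noteq> ptn i" unfolding ptn_def by presburger+
lemma ptn_div: "ptn i div 2 = i div 2" unfolding ptn_def by presburger
lemma even_ptn [simp]: "even (ptn i) \<longleftrightarrow> odd i" unfolding ptn_def by presburger
lemma ptn_less2 [simp]: "ptn i < 2 \<longleftrightarrow> i < 2"
  unfolding ptn_def by presburger

lemma div2_eq: "i div 2 = j div 2 \<longleftrightarrow> j = i \<or> j = ptn (i::nat)"
proof
  assume eq: "i div 2 = j div 2"
  have half: "x = 2 * (x div 2) \<or> x = 2 * (x div 2) + 1" for x :: nat by presburger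
  obtain d where "i = 2 * d \<or> i = 2 * d + 1" "j = 2 * d \<or> j = 2 * d + 1"
    using half[of i] half[of j] unfolding eq by blast
  then show "j = i \<or> j = ptn i" unfolding ptn_def by (elim disjE) simp_all
qed (auto simp: ptn_div)

lemma ptn_bij: "even n \<Longrightarrow> bij_betw ptn {..<n} {..<n}"
  by (rule bij_betw_byWitness[where f' = ptn]) (auto simp: ptn_less)

definition flp :: "nat \<Rightarrow> fmat" where "flp n = spm n (\<lambda>_. 1) ptn"

lemma flp_props:
  assumes "even n"
  shows "flp n \<in> crn n" "adj (flp n) = flp n" "flp n * flp n = eN n"
proof -
  show "flp n \<in> crn n" by (simp add: flp_def)
  show a: "adj (flp n) = flp n"
    unfolding flp_def spm_def by (rule fmat_eqI) (auto simp: ent_mkf)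
  show "flp n * flp n = eN n"
    using spm_uni[OF ptn_bij[OF assms], of "\<lambda>_. 1"] a unfolding flp_def[symmetric] by (metis uni_D(2) complex_cnj_one mult_1)
qed

text \<open>The Hadamard matrix on every pair of levels except the first one. States that are diagonal in this
  rotated basis are invariant under the bit flip on all those pairs.\<close>

definition had :: "nat \<Rightarrow> fmat" where
  "had n = mkf n (\<lambda>i j. if i < 2 \<or> j < 2 then (if i = j then 1 else 0)
     else if i div 2 \<noteq> j div 2 then 0 else of_real (if odd i \<and> odd j then - (1 / sqrt 2) else 1 / sqrt 2))"

definition swap01 :: "nat \<Rightarrow> nat" where "swap01 i = (if i < 2 then ptn i else i)"

text \<open>Together with \<open>swap01\<close> this describes the bit flip in the rotated basis:
  still a swap on the first pair, and diag(1, -1) on every other pair.\<close>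

definition zsg :: "nat \<Rightarrow> complex" where "zsg i = (if i < 2 then 1 else if odd i then - 1 else 1)"

lemma swap01_bij: "even n \<Longrightarrow> bij_betw swap01 {..<n} {..<n}"
  by (rule bij_betw_byWitness[where f' = swap01]) (auto simp: ptn_less swap01_def)

lemma had_adj: "adj (had n) = had n"
  unfolding had_def by (rule fmat_eqI) (auto simp: ent_mkf)

lemma had_had:
  assumes "even n" shows "had n * had n = eN n"
proof (rule crn_eqI[of _ n])
  fix i j assume ij: "i < n" "j < n"
  let ?f = "\<lambda>k. ent (had n) i k * ent (had n) k j"
  have pi: "ptn i < n" using ptn_less assms ij by simp
  have "(\<Sum>k<n. ?f k) = (\<Sum>k\<in>{i, ptn i}. ?f k)"
    using ij pi by (intro sum.mono_neutral_right) (auto simp: had_def ent_mkf div2_eq)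
  also have "\<dots> = ?f i + ?f (ptn i)" by simp
  also have "\<dots> = ent (eN n) i j"
  proof (cases "i < 2 \<or> j < 2 \<or> i div 2 \<noteq> j div 2")
    case True
    then show ?thesis using ij pi by (auto simp: had_def ent_mkf ent_eN ptn_div)
  next
    case False
    then have "j = i \<or> j = ptn i" by (simp add: div2_eq)
    then show ?thesis using False ij pi
      by (auto simp: had_def ent_mkf ent_eN ptn_div simp flip: of_real_mult of_real_add)
  qed
  finally show "ent (had n * had n) i j = ent (eN n) i j"
    using ent_times_crn[of "had n" n] by (simp add: had_def)
qed (auto simp: had_def)

lemma had_crn [simp]: "had n \<in> crn n" by (simp add: had_def)

lemma had_uni: "even n \<Longrightarrow> had n \<in> uni n"
  unfolding uni_def by (simp add: had_adj had_had)

lemma had_flp: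
  assumes "even n" shows "had n * flp n = spm n zsg swap01 * had n"
proof (rule crn_eqI[of _ n])
  fix i j assume ij: "i < n" "j < n"
  have pj: "ptn j < n" "ptn i < n" using ptn_less assms ij by simp_all
  have "ent (had n * flp n) i j = ent (had n) i (ptn j)"
    using ent_spm_right[OF ptn_bij[OF assms], of "had n" "\<lambda>_. 1" i j] ij flp_props(2)[OF assms] by (simp add: flp_def)
  moreover have "ent (spm n zsg swap01 * had n) i j = zsg i * ent (had n) (swap01 i) j"
    using ij by (simp add: ent_spm_left[OF swap01_bij[OF assms]])
  moreover have "ptn j = i \<longleftrightarrow> j = ptn i" by auto
  ultimately show "ent (had n * flp n) i j = ent (spm n zsg swap01 * had n) i j"
    using ij pj by (auto simp: had_def ent_mkf zsg_def swap01_def ptn_div)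
qed (use assms in \<open>auto simp: flp_props\<close>)

text \<open>In the rotated basis the flip is a permutation with signs. The signs cancel on diagonal
  matrices, and only the exchange of levels 0 and 1 is left.\<close>

lemma flp_conj_had:
  assumes "even n"
  shows "flp n * (had n * dg n d * had n) * flp n = had n * dg n (\<lambda>i. d (swap01 i)) * had n"
proof -
  let ?Z = "spm n zsg swap01"
  note z = swap01_bij[OF assms]
  have 1: "had n * flp n = ?Z * had n" by (rule had_flp[OF assms])
  have "adj (had n * flp n) = adj (?Z * had n)" by (simp only: 1)
  then have 2: "flp n * had n = had n * adj ?Z" by (simp add: had_adj flp_props[OF assms])
  have "adj ?Z = had n * (had n * adj ?Z)" using assms by (simp add: mult.assoc[symmetric] had_had)
  also have "\<dots> = (had n * flp n) * had n" by (simp only: 2[symmetric] mult.assoc)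
  also have "\<dots> = ?Z * (had n * had n)" by (simp only: 1 mult.assoc)
  finally have 3: "adj ?Z = ?Z" using assms by (simp add: had_had)
  have "flp n * (had n * dg n d * had n) * flp n = (flp n * had n) * dg n d * (had n * flp n)" by (simp only: mult.assoc)
  also have "\<dots> = had n * (?Z * dg n d * adj ?Z) * had n" by (simp only: 1 2 3 mult.assoc)
  also have "?Z * dg n d * adj ?Z = dg n (\<lambda>i. d (swap01 i))"
    by (rule spm_dg[OF z]) (simp add: zsg_def)
  finally show ?thesis .
qed

section \<open>Averaging a chosen pair of eigenvalues\<close>

locale bitflip_controllable = controllable_noisy n "flp n" Ks c for n Ks c +
  assumes n_even: "even n" and n2: "2 \<le> n"
begin

lemma perm_cls:
  assumes "bij_betw \<pi> {..<n} {..<n}" shows "rdg n (\<lambda>i. d (\<pi> i)) \<in> cls (rdg n d)"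
  using conj_uni_cls[OF spm_uni[OF assms, of "\<lambda>_. 1"] dg_crn] spm_dg[OF assms, of "\<lambda>_. 1"] by simp

text \<open>Rotate by \<open>had\<close>, let the noise act, rotate back: all pairs except the first
  are protected by the rotation.\<close>

lemma mix01_cls:
  assumes q: "0 \<le> q" "q \<le> 1 / 2"
  shows "rdg n (\<lambda>i. (1 - q) * d i + q * d (swap01 i)) \<in> cls (rdg n d)"
proof -
  let ?H = "had n"
  let ?d' = "\<lambda>i. (1 - q) * d i + q * d (swap01 i)"
  note H = had_uni[OF n_even]
  have HDc: "?H * rdg n d * ?H \<in> crn n" by simp
  have 1: "?H * rdg n d * ?H \<in> cls (rdg n d)" using conj_uni_cls[OF H dg_crn] by (simp add: had_adj)
  have "mix q (?H * rdg n d * ?H) = ?H * (rdg n d - q *\<^sub>R (rdg n d - dg n (\<lambda>i. of_real (d (swap01 i))))) * ?H"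
    unfolding mix_def flp_conj_had[OF n_even] by (simp add: left_diff_distrib right_diff_distrib)
  also have "rdg n d - q *\<^sub>R (rdg n d - dg n (\<lambda>i. of_real (d (swap01 i)))) = rdg n ?d'"
    by (rule fmat_eqI) (simp add: ent_dg algebra_simps)
  finally have "?H * rdg n ?d' * ?H \<in> cls (?H * rdg n d * ?H)" using mix_cls[OF HDc q] by simp
  from cls_trans[OF 1 this] have 2: "?H * rdg n ?d' * ?H \<in> cls (rdg n d)" by simp
  have "?H * (?H * rdg n ?d' * ?H) * adj ?H = (?H * ?H) * rdg n ?d' * (?H * ?H)" by (simp add: had_adj mult.assoc)
  then have "?H * (?H * rdg n ?d' * ?H) * adj ?H = rdg n ?d'" by (simp add: had_had[OF n_even])
  then have "rdg n ?d' \<in> cls (?H * rdg n ?d' * ?H)" using conj_uni_cls[OF H, of "?H * rdg n ?d' * ?H"] by simp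
  from cls_trans[OF 2 this] show ?thesis by simp
qed

lemma transform_cls_half:
  assumes jk: "j < n" "k < n" "j \<noteq> k" and q: "0 \<le> q" "q \<le> 1 / 2"
  shows "rdg n (d(j := (1 - q) * d j + q * d k, k := (1 - q) * d k + q * d j)) \<in> cls (rdg n d)"
proof -
  \<comment> \<open>Pulling \<open>k\<close> back through the first transposition makes the
    composite send 0 to \<open>j\<close> and 1 to \<open>k\<close> even when these overlap with 0
    and 1.\<close>
  define k' where "k' = Transposition.transpose 0 j k"
  define \<pi> where "\<pi> = Transposition.transpose 0 j \<circ> Transposition.transpose 1 k'"
  have k': "k' \<noteq> 0" "k' < n" using jk n2 by (auto simp: k'_def Transposition.transpose_def)
  have \<pi>p: "\<pi> permutes {..<n}" unfolding \<pi>_def using jk k' n2 by (intro permutes_compose permutes_swap_id) auto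
  have \<pi>0: "\<pi> 0 = j" using k' by (simp add: \<pi>_def Transposition.transpose_def)
  have \<pi>1: "\<pi> 1 = k" by (simp add: \<pi>_def k'_def)
  have \<pi>b: "bij_betw \<pi> {..<n} {..<n}" using permutes_imp_bij[OF \<pi>p] .
  define \<rho> where "\<rho> = inv_into UNIV \<pi>"
  have ib: "bij_betw \<rho> {..<n} {..<n}" using permutes_imp_bij[OF permutes_inv[OF \<pi>p]] unfolding \<rho>_def .
  let ?e = "\<lambda>i. d (\<pi> i)"
  let ?e' = "\<lambda>i. (1 - q) * ?e i + q * ?e (swap01 i)"
  have "rdg n ?e' \<in> cls (rdg n d)" by (rule cls_trans[OF perm_cls[OF \<pi>b] mix01_cls[OF q]]) simp
  from cls_trans[OF this perm_cls[OF ib, of ?e']] have *: "rdg n (\<lambda>i. ?e' (\<rho> i)) \<in> cls (rdg n d)" by simp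
  have "rdg n (\<lambda>i. ?e' (\<rho> i)) = rdg n (d(j := (1 - q) * d j + q * d k, k := (1 - q) * d k + q * d j))"
  proof (rule dg_cong)
    fix i assume "i < n"
    have pinv: "\<pi> (\<rho> i) = i" unfolding \<rho>_def by (rule permutes_inverses(1)[OF \<pi>p])
    have ij: "\<rho> j = 0" "\<rho> k = 1" unfolding \<rho>_def using permutes_inverses(2)[OF \<pi>p] \<pi>0 \<pi>1 by metis+
    have "swap01 (\<rho> i) = \<rho> i" if "i \<noteq> j" "i \<noteq> k"
    proof -
      have "\<rho> i \<noteq> 0" "\<rho> i \<noteq> 1" using that pinv \<pi>0 \<pi>1 by metis+
      then show ?thesis by (simp add: swap01_def)
    qed
    moreover have "swap01 0 = 1" "swap01 1 = 0" by (simp_all add: swap01_def ptn_def)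
    ultimately show "complex_of_real (?e' (\<rho> i)) = complex_of_real ((d(j := (1 - q) * d j + q * d k, k := (1 - q) * d k + q * d j)) i)"
      using jk pinv ij \<pi>0 \<pi>1 by (cases "i = j"; cases "i = k") (simp_all add: algebra_simps)
  qed
  then show ?thesis using * by simp
qed

text \<open>For \<open>q\<close> above 1/2 the two eigenvalues are exchanged first by a permutation,
  and the weight \<open>1 - q\<close>, which the noise can realise, is used instead.\<close>

lemma transform_cls:
  assumes jk: "j < n" "k < n" "j \<noteq> k" and q: "0 \<le> q" "q \<le> 1"
  shows "rdg n (d(j := (1 - q) * d j + q * d k, k := (1 - q) * d k + q * d j)) \<in> cls (rdg n d)"
proof (cases "q \<le> 1 / 2")
  case True
  then show ?thesis using transform_cls_half assms by blast
next
  case False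
  let ?t = "Transposition.transpose j k"
  have b: "bij_betw ?t {..<n} {..<n}"
    using permutes_imp_bij[OF permutes_swap_id[of j "{..<n}" k]] jk by simp
  let ?e = "\<lambda>i. d (?t i)"
  have "rdg n (?e(j := (1 - (1 - q)) * ?e j + (1 - q) * ?e k, k := (1 - (1 - q)) * ?e k + (1 - q) * ?e j)) \<in> cls (rdg n ?e)"
    using False q jk by (intro transform_cls_half) auto
  from cls_trans[OF perm_cls[OF b] this]
  have "rdg n (?e(j := (1 - (1 - q)) * ?e j + (1 - q) * ?e k, k := (1 - (1 - q)) * ?e k + (1 - q) * ?e j)) \<in> cls (rdg n d)" by simp
  also have "?e(j := (1 - (1 - q)) * ?e j + (1 - q) * ?e k, k := (1 - (1 - q)) * ?e k + (1 - q) * ?e j) =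
    d(j := (1 - q) * d j + q * d k, k := (1 - q) * d k + q * d j)"
    using jk by (auto simp: fun_eq_iff Transposition.transpose_def)
  finally show ?thesis .
qed

lemma majorized_cls:
  assumes y: "\<And>i j. i \<le> j \<Longrightarrow> j < n \<Longrightarrow> y j \<le> y i"
    and "\<And>m. m \<le> n \<Longrightarrow> (\<Sum>i<m. y i) \<le> (\<Sum>i<m. x i)" "(\<Sum>i<n. y i) = (\<Sum>i<n. x i)"
  shows "rdg n y \<in> cls (rdg n x)"
proof (rule majorization_by_transforms[where P = "\<lambda>d. rdg n d \<in> cls (rdg n x)" and n = n and x = x and y = y])
  show "rdg n x \<in> cls (rdg n x)" by (rule cls_refl) simp
  show "rdg n d' \<in> cls (rdg n x)" if "rdg n d \<in> cls (rdg n x)" "\<And>i. i < n \<Longrightarrow> d i = d' i" for d d'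
  proof -
    have "rdg n d' = rdg n d" using that(2) by (intro dg_cong) simp
    then show ?thesis using that(1) by simp
  qed
  show "rdg n (d(j := (1 - q) * d j + q * d k, k := (1 - q) * d k + q * d j)) \<in> cls (rdg n x)"
    if "rdg n d \<in> cls (rdg n x)" "j < n" "k < n" "j \<noteq> k" "0 \<le> q" "q \<le> 1" for d j k q
    using cls_trans[OF that(1) transform_cls[OF that(2-6)]] by simp
qed (use assms in auto)

text \<open>Eigenbases do not matter, since unitary conjugations are available before and after
  acting on the diagonal.\<close>

lemma spectral_majorized_cls:
  assumes "U \<in> uni n" "V \<in> uni n"
    and y: "\<And>i j. i \<le> j \<Longrightarrow> j < n \<Longrightarrow> y j \<le> y i"
    and "\<And>m. m \<le> n \<Longrightarrow> (\<Sum>i<m. y i) \<le> (\<Sum>i<m. x i)" "(\<Sum>i<n. y i) = (\<Sum>i<n. x i)"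
  shows "U * rdg n y * adj U \<in> cls (V * rdg n x * adj V)"
proof -
  have Vc: "V * rdg n x * adj V \<in> crn n" using assms(2) by simp
  have "adj V * (V * rdg n x * adj V) * adj (adj V) = rdg n x"
    using spectral_middle[OF assms(2) refl, of "\<lambda>i. of_real (x i)"] by (simp add: mult.assoc)
  then have "rdg n x \<in> cls (V * rdg n x * adj V)" using conj_uni_cls[OF uni_closed(2)[OF assms(2)] Vc] by simp
  from cls_trans[OF this majorized_cls[OF assms(3-5)] Vc]
  have "rdg n y \<in> cls (V * rdg n x * adj V)" .
  from cls_trans[OF this conj_uni_cls[OF assms(1) dg_crn] Vc] show ?thesis .
qed

end

subsection \<open>Monotone quantities along trajectories\<close>

lemma inner_conj: "inner (U * A * adj U) B = inner A (adj U * B * U)"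
proof -
  have "inner (U * A * adj U) B = inner (U * A) (B * adj (adj U))" by (rule inner_mult_right)
  also have "\<dots> = inner A (adj U * (B * U))" by (simp only: adj_simps inner_mult_left)
  finally show ?thesis by (simp only: mult.assoc)
qed

lemma bounded_linear_ftr: "bounded_linear (ftr n)"
  unfolding ftr_def by (intro bounded_linear_sum bounded_linear_ent)

text \<open>A Dini-type argument by interval induction: the bound may grow by a small linear term, and by
  a small jump at each of the finitely many exceptional times.\<close>

lemma uniform_bound_preserved:
  fixes f :: "'p \<Rightarrow> real \<Rightarrow> real"
  assumes S: "finite S" and T: "0 \<le> T"
    and cont: "\<And>p. p \<in> F \<Longrightarrow> continuous_on {0..T} (f p)"
    and jump: "\<And>t e. t \<in> {0..<T} \<Longrightarrow> 0 < e \<Longrightarrow> \<exists>d>0. \<forall>h. 0 < h \<and> h < d \<and> t + h \<le> T \<longrightarrow> (\<forall>p\<in>F. f p (t + h) \<le> f p t + e)"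
    and step: "\<And>t e b. t \<in> {0..<T} - S \<Longrightarrow> 0 < e \<Longrightarrow> (\<And>p. p \<in> F \<Longrightarrow> f p t \<le> b) \<Longrightarrow>
       \<exists>d>0. \<forall>h. 0 < h \<and> h < d \<and> t + h \<le> T \<longrightarrow> (\<forall>p\<in>F. f p (t + h) \<le> b + e * h)"
    and init: "\<And>p. p \<in> F \<Longrightarrow> f p 0 \<le> b" and p: "p \<in> F"
  shows "f p T \<le> b"
proof -
  have main: "f p T \<le> b + e * (T + card {s \<in> S. s < T})" if e: "0 < e" for e
  proof -
    \<comment> \<open>Growth at rate \<open>e\<close> plus an allowance of \<open>e\<close> per
      exceptional time. The strict inequality releases the allowance immediately after such a time,
      which is where the continuity estimate \<open>jump\<close> spends it.\<close>
    define B where "B = (\<lambda>t. b + e * (t + card {s \<in> S. s < t}))"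
    have Bmono: "B s \<le> B t" if "s \<le> t" for s t
    proof -
      have "card {u \<in> S. u < s} \<le> card {u \<in> S. u < t}" using S that by (intro card_mono) auto
      then show ?thesis unfolding B_def using that e by (intro add_left_mono mult_left_mono add_mono) auto
    qed
    define G where "G = (\<lambda>t. \<forall>p\<in>F. f p t \<le> B t)"
    define A where "A = {t \<in> {0..T}. \<forall>s\<in>{0..t}. G s}"
    have G0: "G 0"
    proof -
      have "b \<le> B 0" unfolding B_def using e by simp
      then show ?thesis unfolding G_def using init by (meson order_trans)
    qed
    have A0: "0 \<in> A" using G0 T by (simp add: A_def)
    have bdd: "bdd_above A" by (rule bdd_aboveI[of _ T]) (simp add: A_def)
    define \<tau> where "\<tau> = Sup A"
    have ne: "A \<noteq> {}" using A0 by blast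
    have \<tau>: "0 \<le> \<tau>" "\<tau> \<le> T" unfolding \<tau>_def
      by (rule cSup_upper[OF A0 bdd], rule cSup_least[OF ne]) (simp add: A_def)
    have Gless: "G s" if "0 \<le> s" "s < \<tau>" for s
    proof -
      from less_cSup_iff[OF ne bdd, of s] obtain t where "t \<in> A" "s < t"
        using \<open>s < \<tau>\<close> unfolding \<tau>_def by auto
      then show ?thesis using that by (auto simp: A_def)
    qed
    have G\<tau>: "G \<tau>"
    proof (cases "\<tau> = 0")
      case False
      then have pos: "0 < \<tau>" using \<tau> by simp
      show ?thesis unfolding G_def
      proof
        fix p assume p: "p \<in> F"
        have "continuous (at \<tau> within {0..T}) (f p)" using cont[OF p] \<tau> by (auto simp: continuous_on_eq_continuous_within)
        then have "continuous (at \<tau> within {0..\<tau>}) (f p)" by (rule continuous_within_subset) (use \<tau> in auto)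
        then have "(f p \<longlongrightarrow> f p \<tau>) (at \<tau> within {0..\<tau>})" by (simp add: continuous_within)
        then have "(f p \<longlongrightarrow> f p \<tau>) (at_left \<tau>)" using at_within_Icc_at_left[OF pos] by simp
        moreover have "eventually (\<lambda>s. f p s \<le> B \<tau>) (at_left \<tau>)"
        proof -
          have "eventually (\<lambda>s. s \<in> {0<..<\<tau>}) (at_left \<tau>)" using pos by (rule eventually_at_left_real)
          then show ?thesis
          proof (eventually_elim)
            case (elim s)
            then have "f p s \<le> B s" using Gless[of s] p by (simp add: G_def)
            then show ?case using Bmono[of s \<tau>] elim by simp
          qed
        qed
        ultimately show "f p \<tau> \<le> B \<tau>" by (rule tendsto_upperbound) simp
      qed
    qed (use G0 in simp)
    have GA: "G s" if "0 \<le> s" "s \<le> \<tau>" for s using Gless[of s] G\<tau> that by (cases "s = \<tau>") auto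
    have "\<tau> = T"
    proof (rule ccontr)
      assume "\<tau> \<noteq> T"
      then have lt: "\<tau> < T" using \<tau> by simp
      have "\<exists>d>0. \<forall>h. 0 < h \<and> h < d \<and> \<tau> + h \<le> T \<longrightarrow> G (\<tau> + h)"
      proof (cases "\<tau> \<in> S")
        case True
        obtain d where d: "d > 0" "\<forall>h. 0 < h \<and> h < d \<and> \<tau> + h \<le> T \<longrightarrow> (\<forall>p\<in>F. f p (\<tau> + h) \<le> f p \<tau> + e)"
          using jump[of \<tau> e] e lt \<tau> by auto
        have "G (\<tau> + h)" if h: "0 < h" "h < d" "\<tau> + h \<le> T" for h
          unfolding G_def
        proof
          fix p assume p: "p \<in> F"
          have "Suc (card {s \<in> S. s < \<tau>}) = card (insert \<tau> {s \<in> S. s < \<tau>})" using S by simp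
          also have "\<dots> \<le> card {s \<in> S. s < \<tau> + h}" using S True h by (intro card_mono) auto
          finally have cd: "real (card {s \<in> S. s < \<tau>}) + 1 \<le> real (card {s \<in> S. s < \<tau> + h})" by linarith
          have "f p (\<tau> + h) \<le> f p \<tau> + e" using d(2) h p by blast
          also have "\<dots> \<le> B \<tau> + e" using G\<tau> p by (simp add: G_def)
          also have "\<dots> = b + e * (\<tau> + (card {s \<in> S. s < \<tau>} + 1))" by (simp add: B_def algebra_simps)
          also have "\<dots> \<le> B (\<tau> + h)" unfolding B_def using cd h e by (intro add_left_mono mult_left_mono add_mono) auto
          finally show "f p (\<tau> + h) \<le> B (\<tau> + h)" .
        qed
        then show ?thesis using d(1) by blast
      next
        case False
        have "\<tau> \<in> {0..<T} - S" using False lt \<tau> by simp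
        from step[OF this e, of "B \<tau>"] G\<tau> obtain d
          where d: "d > 0" "\<forall>h. 0 < h \<and> h < d \<and> \<tau> + h \<le> T \<longrightarrow> (\<forall>p\<in>F. f p (\<tau> + h) \<le> B \<tau> + e * h)"
          unfolding G_def by blast
        have "G (\<tau> + h)" if h: "0 < h" "h < d" "\<tau> + h \<le> T" for h
          unfolding G_def
        proof
          fix p assume p: "p \<in> F"
          have cd: "card {s \<in> S. s < \<tau>} \<le> card {s \<in> S. s < \<tau> + h}" using S h by (intro card_mono) auto
          have "f p (\<tau> + h) \<le> B \<tau> + e * h" using d(2) h p by blast
          also have "\<dots> = b + e * ((\<tau> + h) + card {s \<in> S. s < \<tau>})" by (simp add: B_def algebra_simps)
          also have "\<dots> \<le> B (\<tau> + h)" unfolding B_def using cd e by (intro add_left_mono mult_left_mono) auto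
          finally show "f p (\<tau> + h) \<le> B (\<tau> + h)" .
        qed
        then show ?thesis using d(1) by blast
      qed
      then obtain d where d: "d > 0" "\<And>h. 0 < h \<Longrightarrow> h < d \<Longrightarrow> \<tau> + h \<le> T \<Longrightarrow> G (\<tau> + h)" by blast
      define h where "h = min (d / 2) (T - \<tau>)"
      have h: "0 < h" "h < d" "\<tau> + h \<le> T" using d(1) lt by (auto simp: h_def)
      have "\<tau> + h \<in> A"
        unfolding A_def
      proof (intro CollectI conjI ballI)
        show "\<tau> + h \<in> {0..T}" using h \<tau> by simp
        fix s assume s: "s \<in> {0..\<tau> + h}"
        show "G s"
        proof (cases "s \<le> \<tau>")
          case False
          then show ?thesis using d(2)[of "s - \<tau>"] s h by simp
        qed (use GA s in simp)
      qed
      then have "\<tau> + h \<le> \<tau>" unfolding \<tau>_def by (rule cSup_upper[OF _ bdd])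
      then show False using h by simp
    qed
    then show ?thesis using G\<tau> p by (simp add: G_def B_def)
  qed
  show ?thesis
  proof (rule field_le_epsilon)
    fix e :: real assume e: "0 < e"
    define w where "w = T + card {s \<in> S. s < T} + 1"
    have w: "w > 0" "T + card {s \<in> S. s < T} \<le> w" using T by (auto simp: w_def)
    have "e / w > 0" using e w by simp
    from main[OF this] have "f p T \<le> b + e / w * (T + card {s \<in> S. s < T})" .
    also have "\<dots> \<le> b + e / w * w" using w e by (intro add_left_mono mult_left_mono) auto
    finally show "f p T \<le> b + e" using w by simp
  qed
qed

context noisy
begin

definition traj :: "real \<Rightarrow> real set \<Rightarrow> (real \<Rightarrow> fmat) \<Rightarrow> (real \<Rightarrow> real) \<Rightarrow> (real \<Rightarrow> fmat) \<Rightarrow> bool" where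
  "traj T S k g y \<longleftrightarrow> 0 \<le> T \<and> finite S \<and> continuous_on {0..T} y \<and> (\<forall>t\<in>{0..T}. y t \<in> crn n \<and> k t \<in> skew n \<and> 0 \<le> g t) \<and>
    (\<forall>t\<in>{0..T} - S. (y has_vector_derivative gen (k t) (g t) (y t)) (at t within {0..T}))"

lemma adj_gen: "K \<in> skew n \<Longrightarrow> adj (gen K g A) = gen K g (adj A)"
  by (simp add: gen_def skewD(2) mult.assoc)

text \<open>The generator commutes with \<open>adj\<close>, so \<open>y - adj y\<close> obeys the
  same dissipative equation and starts at 0.\<close>

lemma traj_hermitian:
  assumes tr: "traj T S k g y" and "adj (y 0) = y 0"
  shows "adj (y T) = y T"
proof -
  have "norm (y T - adj (y T)) \<le> norm (y 0 - adj (y 0))"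
  proof (rule norm_nonincreasing[of S, where D = "\<lambda>t. gen (k t) (g t) (y t - adj (y t))"])
    show "continuous_on {0..T} (\<lambda>t. y t - adj (y t))"
      using tr unfolding traj_def by (intro continuous_intros bounded_linear.continuous_on[OF bounded_linear_adj]) auto
    fix t assume t: "t \<in> {0..T} - S"
    have "(y has_vector_derivative gen (k t) (g t) (y t)) (at t within {0..T})" and k: "k t \<in> skew n" "0 \<le> g t" "y t \<in> crn n"
      using tr t unfolding traj_def by auto
    then show "((\<lambda>t. y t - adj (y t)) has_vector_derivative gen (k t) (g t) (y t - adj (y t))) (at t within {0..T})"
      unfolding gen_diff adj_gen[OF k(1), symmetric]
      by (intro has_vector_derivative_diff bounded_linear.has_vector_derivative[OF bounded_linear_adj])
    show "inner (y t - adj (y t)) (gen (k t) (g t) (y t - adj (y t))) \<le> 0" using k by (intro gen_dissipative) auto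
  qed (use tr in \<open>auto simp: traj_def\<close>)
  then show ?thesis using assms(2) by simp
qed

lemma ftr_gen: assumes "K \<in> skew n" "A \<in> crn n" shows "ftr n (gen K g A) = 0"
proof -
  interpret F: bounded_linear "ftr n" by (rule bounded_linear_ftr)
  have "ftr n (X * A * X) = ftr n A" using ftr_conj[OF Xuni assms(2)] by simp
  moreover have "ftr n (K * A) = ftr n (A * K)" using assms skewD by (intro ftr_commute) auto
  ultimately show ?thesis by (simp add: gen_def F.diff F.scaleR)
qed

lemma traj_trace:
  assumes tr: "traj T S k g y" shows "ftr n (y T) = ftr n (y 0)"
proof -
  have "norm (ftr n (y T) - ftr n (y 0)) \<le> norm (ftr n (y 0) - ftr n (y 0))"
  proof (rule norm_nonincreasing[of S, where D = "\<lambda>t. 0"])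
    show "continuous_on {0..T} (\<lambda>t. ftr n (y t) - ftr n (y 0))"
      using tr unfolding traj_def by (intro continuous_intros bounded_linear.continuous_on[OF bounded_linear_ftr]) auto
    fix t assume t: "t \<in> {0..T} - S"
    have "((\<lambda>t. ftr n (y t)) has_vector_derivative ftr n (gen (k t) (g t) (y t))) (at t within {0..T})"
      using tr t unfolding traj_def by (intro bounded_linear.has_vector_derivative[OF bounded_linear_ftr]) auto
    moreover have "ftr n (gen (k t) (g t) (y t)) = 0" using tr t unfolding traj_def by (intro ftr_gen) auto
    ultimately have "((\<lambda>t. ftr n (y t)) has_vector_derivative 0) (at t within {0..T})" by simp
    from has_vector_derivative_diff[OF this has_vector_derivative_const[of "ftr n (y 0)"]]
    show "((\<lambda>t. ftr n (y t) - ftr n (y 0)) has_vector_derivative 0) (at t within {0..T})" by simp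
  qed (use tr in \<open>auto simp: traj_def\<close>)
  then show ?thesis by simp
qed

text \<open>To first order, the evolution is a convex combination of unitary conjugations, so it does not increase
  the supremum of a unitarily invariant family of linear functionals.\<close>

lemma traj_invariant_bound:
  assumes tr: "traj T S k g y"
    and F: "\<And>P U. P \<in> F \<Longrightarrow> U \<in> uni n \<Longrightarrow> U * P * adj U \<in> F" "\<And>P. P \<in> F \<Longrightarrow> norm P \<le> w"
    and init: "\<And>P. P \<in> F \<Longrightarrow> inner P (y 0) \<le> b" and P: "P \<in> F"
  shows "inner P (y T) \<le> b"
proof (rule uniform_bound_preserved[of S T F "\<lambda>P t. inner P (y t)", OF _ _ _ _ _ init P])
  have T: "0 \<le> T" "finite S" "continuous_on {0..T} y" using tr by (auto simp: traj_def)
  show "finite S" "0 \<le> T" by (rule T)+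
  have w: "0 \<le> w" using order_trans[OF norm_ge_zero F(2)[OF P]] .
  show "continuous_on {0..T} (\<lambda>t. inner p (y t))" for p by (intro continuous_intros T)
  fix t e :: real
  assume e: "0 < e"
  have ew: "e / (w + 1) > 0" using e w by simp
  \<comment> \<open>Converts an error of the state into an error of all functionals in
    \<open>F\<close> at once; \<open>w + 1\<close> replaces the bound \<open>w\<close> because
    \<open>w\<close> may be 0.\<close>
  have le_ew: "w * r \<le> e * s" if "r \<le> e / (w + 1) * s" "0 \<le> s" for r s :: real
  proof -
    have "w * r \<le> w * (e / (w + 1) * s)" using that w by (intro mult_left_mono) auto
    also have "\<dots> = w / (w + 1) * (e * s)" by simp
    also have "\<dots> \<le> 1 * (e * s)" using w e that by (intro mult_right_mono) auto
    finally show ?thesis by simp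
  qed
  {
    assume t: "t \<in> {0..<T}"
    then have "continuous (at t within {0..T}) y" using T(3) by (auto simp: continuous_on_eq_continuous_within)
    from this[unfolded continuous_within_eps_delta, rule_format, OF ew]
    obtain d where d: "d > 0" "\<And>s. s \<in> {0..T} \<Longrightarrow> dist s t < d \<Longrightarrow> dist (y s) (y t) < e / (w + 1)" by blast
    show "\<exists>d>0. \<forall>h. 0 < h \<and> h < d \<and> t + h \<le> T \<longrightarrow> (\<forall>p\<in>F. inner p (y (t + h)) \<le> inner p (y t) + e)"
    proof (intro exI[of _ d] conjI d(1) allI impI ballI)
      fix h p assume h: "0 < h \<and> h < d \<and> t + h \<le> T" and p: "p \<in> F"
      have "norm (y (t + h) - y t) \<le> e / (w + 1) * 1" using d(2)[of "t + h"] h t by (simp add: dist_norm)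
      from le_ew[OF this] have "w * norm (y (t + h) - y t) \<le> e" by simp
      moreover have "inner p (y (t + h) - y t) \<le> norm p * norm (y (t + h) - y t)" by (rule norm_cauchy_schwarz)
      moreover have "norm p * norm (y (t + h) - y t) \<le> w * norm (y (t + h) - y t)" using F(2)[OF p] by (intro mult_right_mono) auto
      ultimately show "inner p (y (t + h)) \<le> inner p (y t) + e" by (simp add: inner_diff_right)
    qed
  }
  fix b' assume t: "t \<in> {0..<T} - S" and b': "\<And>p. p \<in> F \<Longrightarrow> inner p (y t) \<le> b'"
  define K where "K = k t"
  define c0 where "c0 = g t"
  define A where "A = y t"
  have K: "K \<in> skew n" and c0: "0 \<le> c0" and A: "A \<in> crn n"
    and der: "(y has_vector_derivative gen K c0 A) (at t within {0..T})"
    using tr t unfolding traj_def K_def c0_def A_def by auto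
  \<comment> \<open>The second-order coefficients: the Taylor remainder of the unitary conjugation,
    and the product of the noise weight \<open>h * c0\<close> with the commutator.\<close>
  define M where "M = (2 * norm K)\<^sup>2 * norm A + c0 * (2 * norm K * norm A)"
  have M: "0 \<le> M" using c0 by (simp add: M_def)
  \<comment> \<open>One half of the error budget goes to the derivative of the trajectory, the other
    half to the second-order terms.\<close>
  define z where "z = e / (w + 1) / 2"
  have "e / (w + 1) = z + z" unfolding z_def by (rule field_sum_of_halves[symmetric])
  then have e2: "z > 0" "e / (w + 1) * r = z * r + z * r" for r
    using half_gt_zero[OF ew] unfolding z_def by (simp_all only: distrib_right)
  from der[unfolded has_vector_derivative_def has_derivative_within_alt] e2(1)
  obtain d where d: "d > 0" "\<And>s. s \<in> {0..T} \<Longrightarrow> norm (s - t) < d \<Longrightarrow> norm (y s - y t - (s - t) *\<^sub>R gen K c0 A) \<le> z * norm (s - t)"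
    by blast
  \<comment> \<open>The second bound keeps the weight \<open>h * c0\<close> at most 1, so that the
    combination below is convex; the third brings \<open>M * h\<close> below
    \<open>z\<close>.\<close>
  define d' where "d' = min d (min (1 / (c0 + 1)) (z / (M + 1)))"
  show "\<exists>d>0. \<forall>h. 0 < h \<and> h < d \<and> t + h \<le> T \<longrightarrow> (\<forall>p\<in>F. inner p (y (t + h)) \<le> b' + e * h)"
  proof (intro exI[of _ d'] conjI allI impI ballI)
    show "d' > 0" using d(1) c0 M e2(1) by (simp add: d'_def)
    fix h p assume h: "0 < h \<and> h < d' \<and> t + h \<le> T" and p: "p \<in> F"
    have h1: "h < d" "h < 1 / (c0 + 1)" "h < z / (M + 1)" using h by (auto simp: d'_def)
    have hc: "h * c0 \<le> 1"
    proof -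
      have "h * (c0 + 1) < 1" using h1(2) c0 by (simp add: pos_less_divide_eq)
      then show ?thesis using h by (simp add: algebra_simps)
    qed
    have hM: "M * h \<le> z"
    proof -
      have "h * (M + 1) < z" using h1(3) M by (simp only: pos_less_divide_eq)
      then show ?thesis using h by (simp add: algebra_simps)
    qed
    define E where "E = fexp n K h"
    have E: "E \<in> uni n" unfolding E_def by (rule fexp_uni[OF is_fexp_fexp[OF K]])
    define R where "R = E * A * adj E - A - h *\<^sub>R (K * A - A * K)"
    have R: "norm R \<le> (2 * norm K)\<^sup>2 * norm A * h\<^sup>2" unfolding R_def E_def using h by (intro conj_taylor[OF K A]) simp
    \<comment> \<open>The convex combination that agrees with the evolution to first order. Moving
      each conjugation onto the functional stays in \<open>F\<close>, so the bound at time
      \<open>t\<close> carries over to \<open>Q\<close>.\<close>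
    define Q where "Q = (1 - h * c0) *\<^sub>R (E * A * adj E) + (h * c0) *\<^sub>R (X * A * X)"
    define Z where "Z = y (t + h) - A - h *\<^sub>R gen K c0 A"
    have Z: "norm Z \<le> z * h" unfolding Z_def A_def using d(2)[of "t + h"] h h1 t by (simp add: A_def)
    have eq: "y (t + h) = Q + (Z + (h * c0 * h) *\<^sub>R (K * A - A * K) - (1 - h * c0) *\<^sub>R R)"
      unfolding Q_def Z_def R_def gen_def scaleR_add_left scaleR_diff_left scaleR_diff_right scaleR_scaleR scaleR_one
      by (simp add: algebra_simps)
    have Qb: "inner p Q \<le> b'"
    proof -
      have "inner p (E * A * adj E) = inner (adj E * p * E) A"
        using inner_conj[of E A p] by (simp only: inner_commute)
      also have "\<dots> \<le> b'" using b'[OF F(1)[OF p uni_closed(2)[OF E]]] by (simp add: A_def)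
      finally have 1: "inner p (E * A * adj E) \<le> b'" .
      have "inner p (X * A * X) = inner (X * p * X) A"
        using inner_conj[of X A p] by (simp only: inner_commute Xadj)
      also have "\<dots> \<le> b'" using b'[OF F(1)[OF p Xuni]] by (simp add: A_def)
      finally have 2: "inner p (X * A * X) \<le> b'" .
      have "inner p Q \<le> (1 - h * c0) * b' + (h * c0) * b'"
        unfolding Q_def inner_add_right inner_scaleR_right using 1 2 hc h c0 by (intro add_mono mult_left_mono) auto
      then show ?thesis by (simp add: algebra_simps)
    qed
    have n2: "norm ((h * c0 * h) *\<^sub>R (K * A - A * K)) \<le> c0 * (2 * norm K * norm A) * h\<^sup>2"
    proof -
      have "norm ((h * c0 * h) *\<^sub>R (K * A - A * K)) = (h * c0 * h) * norm (K * A - A * K)" using h c0 by simp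
      also have "\<dots> \<le> (h * c0 * h) * (2 * norm K * norm A)" using h c0 by (intro mult_left_mono norm_comm) auto
      finally show ?thesis by (simp add: power2_eq_square mult_ac)
    qed
    have n3: "norm ((1 - h * c0) *\<^sub>R R) \<le> (2 * norm K)\<^sup>2 * norm A * h\<^sup>2"
    proof -
      have "norm ((1 - h * c0) *\<^sub>R R) = (1 - h * c0) * norm R" using hc by simp
      also have "\<dots> \<le> 1 * norm R" using h c0 by (intro mult_right_mono) auto
      finally show ?thesis using R by simp
    qed
    have "norm (Z + (h * c0 * h) *\<^sub>R (K * A - A * K) - (1 - h * c0) *\<^sub>R R) \<le> norm Z + norm ((h * c0 * h) *\<^sub>R (K * A - A * K)) + norm ((1 - h * c0) *\<^sub>R R)"
      by (intro order_trans[OF norm_triangle_ineq4] add_right_mono norm_triangle_ineq)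
    also have "\<dots> \<le> z * h + M * h\<^sup>2" using Z n2 n3 by (simp add: M_def algebra_simps)
    also have "M * h\<^sup>2 = (M * h) * h" by (simp add: power2_eq_square)
    also have "z * h + M * h * h \<le> z * h + z * h"
      using hM h by (intro add_left_mono mult_right_mono) auto
    also have "\<dots> = e / (w + 1) * h" by (simp only: e2(2))
    finally have nr: "norm (Z + (h * c0 * h) *\<^sub>R (K * A - A * K) - (1 - h * c0) *\<^sub>R R) \<le> e / (w + 1) * h" (is "norm ?r \<le> _") .
    have "inner p ?r \<le> norm p * norm ?r" by (rule norm_cauchy_schwarz)
    also have "\<dots> \<le> w * norm ?r" using F(2)[OF p] by (intro mult_right_mono) auto
    also have "\<dots> \<le> e * h" using le_ew[OF nr] h by simp
    finally show "inner p (y (t + h)) \<le> b' + e * h" unfolding eq inner_add_right[of p Q] using Qb by simp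
  qed
qed

end

section \<open>Ky Fan's maximum principle\<close>

lemma sum_if_less:
  fixes f :: "nat \<Rightarrow> 'a::comm_monoid_add"
  assumes "k \<le> n" shows "(\<Sum>j<n. if j < k then f j else 0) = (\<Sum>j<k. f j)"
  by (rule sum.mono_neutral_cong_right) (use assms in auto)

text \<open>The column weights of the first \<open>k\<close> rows lie between 0 and 1 and add up to
  \<open>k\<close>, so the sum is largest when they sit on the \<open>k\<close> largest values. The
  deviation \<open>v\<close> has total 0, which allows \<open>l\<close> to be compared with the
  threshold \<open>l (k - 1)\<close>.\<close>

lemma ky_fan_weights:
  fixes a :: "nat \<Rightarrow> nat \<Rightarrow> real" and l :: "nat \<Rightarrow> real"
  assumes a: "\<And>i j. 0 \<le> a i j" "\<And>i. i < n \<Longrightarrow> (\<Sum>j<n. a i j) = 1" "\<And>j. j < n \<Longrightarrow> (\<Sum>i<n. a i j) = 1"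
    and l: "\<And>i j. i \<le> j \<Longrightarrow> j < n \<Longrightarrow> l j \<le> l i" and k: "k \<le> n"
  shows "(\<Sum>i<k. \<Sum>j<n. a i j * l j) \<le> (\<Sum>j<k. l j)"
proof (cases "k = 0")
  case False
  define t where "t = l (k - 1)"
  define w where "w = (\<lambda>j. \<Sum>i<k. a i j)"
  define v where "v = (\<lambda>j. w j - (if j < k then 1 else 0))"
  have w0: "0 \<le> w j" for j unfolding w_def using a(1) by (intro sum_nonneg) auto
  have w1: "w j \<le> 1" if "j < n" for j
  proof -
    have "w j \<le> (\<Sum>i<n. a i j)" unfolding w_def using a(1) k by (intro sum_mono2) auto
    then show ?thesis using a(3)[OF that] by simp
  qed
  note ind = sum_if_less[OF k]
  have "(\<Sum>j<n. w j) = (\<Sum>i<k. \<Sum>j<n. a i j)" unfolding w_def by (rule sum.swap)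
  also have "\<dots> = real k" using a(2) k by simp
  finally have "(\<Sum>j<n. v j) = 0" using ind[of "\<lambda>_. 1::real"] by (simp add: v_def sum_subtractf)
  moreover have "v j * l j \<le> v j * t" if j: "j < n" for j
  proof (cases "j < k")
    case True
    then have "t \<le> l j" unfolding t_def using k by (intro l) auto
    moreover have "v j \<le> 0" using True w1[OF j] by (simp add: v_def)
    ultimately show ?thesis by (rule mult_left_mono_neg)
  next
    case F: False
    then have "l j \<le> t" unfolding t_def using j by (intro l) auto
    moreover have "0 \<le> v j" using F w0 by (simp add: v_def)
    ultimately show ?thesis by (rule mult_left_mono)
  qed
  then have "(\<Sum>j<n. v j * l j) \<le> (\<Sum>j<n. v j * t)" by (intro sum_mono) auto
  ultimately have "(\<Sum>j<n. v j * l j) \<le> 0" by (simp flip: sum_distrib_right)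
  moreover have "(\<Sum>j<n. v j * l j) = (\<Sum>j<n. w j * l j) - (\<Sum>j<k. l j)"
    unfolding ind[of l, symmetric] sum_subtractf[symmetric] by (intro sum.cong) (auto simp: v_def algebra_simps)
  moreover have "(\<Sum>i<k. \<Sum>j<n. a i j * l j) = (\<Sum>j<n. w j * l j)"
    unfolding w_def by (subst sum.swap) (simp add: sum_distrib_right)
  ultimately show ?thesis by simp
qed simp

definition prj :: "nat \<Rightarrow> nat \<Rightarrow> fmat" where "prj n k = dg n (\<lambda>i. if i < k then 1 else 0)"

lemma prj_crn [simp]: "prj n k \<in> crn n"
  by (simp add: prj_def)

lemma inner_prj:
  assumes "k \<le> n" shows "inner (prj n k) A = (\<Sum>i<k. Re (ent A i i))"
proof -
  have "(\<Sum>j<n. Re (cnj (ent (prj n k) i j) * ent A i j)) = (if i < k then Re (ent A i i) else 0)" if "i < n" for i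
  proof -
    have "(\<Sum>j<n. Re (cnj (ent (prj n k) i j) * ent A i j)) = (\<Sum>j<n. if j = i then (if i < k then Re (ent A i i) else 0) else 0)"
      using that by (intro sum.cong) (auto simp: prj_def ent_dg)
    then show ?thesis using that by simp
  qed
  then have "inner (prj n k) A = (\<Sum>i<n. if i < k then Re (ent A i i) else 0)"
    unfolding inner_crn[OF prj_crn] by (intro sum.cong refl) simp
  then show ?thesis by (simp only: sum_if_less[OF assms])
qed

lemma uni_rows: assumes "W \<in> uni n" "i < n" shows "(\<Sum>j<n. (cmod (ent W i j))\<^sup>2) = 1"
proof -
  have "ent (W * adj W) i i = (\<Sum>j<n. of_real ((cmod (ent W i j))\<^sup>2))"
    unfolding ent_times_crn[OF uni_D(1)[OF assms(1)]] ent_adj complex_norm_square ..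
  then have "complex_of_real (\<Sum>j<n. (cmod (ent W i j))\<^sup>2) = of_real 1" using assms by (simp add: ent_eN)
  then show ?thesis by (simp only: of_real_eq_iff)
qed

text \<open>The squared moduli of the entries of \<open>adj U * V\<close> form a doubly stochastic
  matrix, and the left side is a sum of averages of \<open>l\<close> with these weights.\<close>

lemma ky_fan:
  assumes U: "U \<in> uni n" and V: "V \<in> uni n" and k: "k \<le> n" and l: "\<And>i j. i \<le> j \<Longrightarrow> j < n \<Longrightarrow> l j \<le> l i"
  shows "inner (U * prj n k * adj U) (V * rdg n l * adj V) \<le> (\<Sum>i<k. l i)"
proof -
  define W where "W = adj U * V"
  have W: "W \<in> uni n" unfolding W_def using U V uni_closed by blast
  have "inner (U * prj n k * adj U) (V * rdg n l * adj V) = inner (prj n k) (W * rdg n l * adj W)"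
    unfolding inner_conj W_def by (simp add: mult.assoc)
  also have "\<dots> = (\<Sum>i<k. \<Sum>j<n. (cmod (ent W i j))\<^sup>2 * l j)"
    unfolding inner_prj[OF k]
  proof (intro sum.cong refl)
    fix i assume "i \<in> {..<k}"
    have c: "W * rdg n l \<in> crn n" using W by simp
    have "ent (W * rdg n l * adj W) i i = (\<Sum>j<n. of_real ((cmod (ent W i j))\<^sup>2 * l j))"
      unfolding ent_times_crn[OF c] by (intro sum.cong) (auto simp: ent_dg_right complex_norm_square[symmetric] mult_ac)
    also have "\<dots> = of_real (\<Sum>j<n. (cmod (ent W i j))\<^sup>2 * l j)" by (simp only: of_real_sum)
    finally show "Re (ent (W * rdg n l * adj W) i i) = (\<Sum>j<n. (cmod (ent W i j))\<^sup>2 * l j)" by (simp only: Re_complex_of_real)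
  qed
  also have "\<dots> \<le> (\<Sum>i<k. l i)"
  proof (rule ky_fan_weights[OF _ _ _ l k])
    show "(\<Sum>i<n. (cmod (ent W i j))\<^sup>2) = 1" if "j < n" for j
      using uni_rows[OF uni_closed(2)[OF W] that] by simp
  qed (use uni_rows[OF W] in auto)
  finally show ?thesis .
qed

subsection \<open>Transfer to matrices of the library\<close>

definition FM :: "nat \<Rightarrow> complex mat \<Rightarrow> fmat" where "FM N A = mkf N (\<lambda>i j. A $$ (i,j))"
definition MF :: "nat \<Rightarrow> fmat \<Rightarrow> complex mat" where "MF N F = mat N N (\<lambda>(i,j). ent F i j)"

lemma FM_crn [simp]: "FM N A \<in> crn N" by (simp add: FM_def)
lemma MF_carrier [simp]: "MF N F \<in> carrier_mat N N" by (simp add: MF_def)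
lemma ent_FM: "i < N \<Longrightarrow> j < N \<Longrightarrow> ent (FM N A) i j = A $$ (i,j)" by (simp add: FM_def ent_mkf)
lemma index_MF: "i < N \<Longrightarrow> j < N \<Longrightarrow> MF N F $$ (i,j) = ent F i j" by (simp add: MF_def)

lemma FM_MF: "F \<in> crn N \<Longrightarrow> FM N (MF N F) = F"
  by (rule crn_eqI[of _ N]) (simp_all add: ent_FM index_MF)

lemma MF_FM: "A \<in> carrier_mat N N \<Longrightarrow> MF N (FM N A) = A"
  by (rule eq_matI) (auto simp: ent_FM MF_def)

lemma FM_inject: "A \<in> carrier_mat N N \<Longrightarrow> B \<in> carrier_mat N N \<Longrightarrow> FM N A = FM N B \<Longrightarrow> A = B"
  by (metis MF_FM)

lemma adjoint_carrier [simp]: "A \<in> carrier_mat N N \<Longrightarrow> mat_adjoint A \<in> carrier_mat N N"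
  by (auto simp: mat_adjoint_def)

lemma FM_adjoint: "A \<in> carrier_mat N N \<Longrightarrow> FM N (mat_adjoint A) = adj (FM N A)"
  by (rule crn_eqI[of _ N]) (auto simp: ent_FM mat_adjoint_def mat_of_rows_index conjugate_complex_def)

lemma FM_add: "A \<in> carrier_mat N N \<Longrightarrow> B \<in> carrier_mat N N \<Longrightarrow> FM N (A + B) = FM N A + FM N B"
  by (rule crn_eqI[of _ N]) (auto simp: ent_FM)
lemma FM_diff: "A \<in> carrier_mat N N \<Longrightarrow> B \<in> carrier_mat N N \<Longrightarrow> FM N (A - B) = FM N A - FM N B"
  by (rule crn_eqI[of _ N]) (auto simp: ent_FM)
lemma FM_uminus: "A \<in> carrier_mat N N \<Longrightarrow> FM N (- A) = - FM N A"
  by (rule crn_eqI[of _ N]) (auto simp: ent_FM)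
lemma FM_smult: "A \<in> carrier_mat N N \<Longrightarrow> FM N (k \<cdot>\<^sub>m A) = cs k (FM N A)"
  by (rule crn_eqI[of _ N]) (auto simp: ent_FM)
lemma FM_mult:
  assumes "A \<in> carrier_mat N N" "B \<in> carrier_mat N N" shows "FM N (A * B) = FM N A * FM N B"
proof (rule crn_eqI[of _ N])
  fix i j assume ij: "i < N" "j < N"
  have "(A * B) $$ (i,j) = (\<Sum>k<N. A $$ (i,k) * B $$ (k,j))"
    using assms ij by (auto simp: scalar_prod_def atLeast0LessThan)
  then show "ent (FM N (A * B)) i j = ent (FM N A * FM N B) i j"
    using ij by (simp add: ent_FM ent_times_crn[OF FM_crn])
qed auto
lemma FM_one: "FM N (1\<^sub>m N) = eN N"
  by (rule crn_eqI[of _ N]) (auto simp: ent_FM ent_eN)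
lemma FM_zero: "FM N (0\<^sub>m N N) = 0"
  by (rule crn_eqI[of _ N]) (auto simp: ent_FM)
lemma FM_diag: "FM N (mat N N (\<lambda>(i,j). if i = j then d i else 0)) = dg N d"
  by (rule crn_eqI[of _ N]) (auto simp: ent_FM ent_dg)

lemma FM_unitary: "U \<in> carrier_mat N N \<Longrightarrow> unitary_mat N U \<longleftrightarrow> FM N U \<in> uni N"
proof -
  assume U: "U \<in> carrier_mat N N"
  have c: "U * mat_adjoint U \<in> carrier_mat N N" "mat_adjoint U * U \<in> carrier_mat N N" "1\<^sub>m N \<in> carrier_mat N N"
    using U by (auto intro!: mult_carrier_mat[of _ N N])
  have "U * mat_adjoint U = 1\<^sub>m N \<longleftrightarrow> FM N (U * mat_adjoint U) = FM N (1\<^sub>m N)"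
    by (rule iffI) (simp, rule FM_inject[OF c(1,3)])
  moreover have "mat_adjoint U * U = 1\<^sub>m N \<longleftrightarrow> FM N (mat_adjoint U * U) = FM N (1\<^sub>m N)"
    by (rule iffI) (simp, rule FM_inject[OF c(2,3)])
  moreover have "FM N (U * mat_adjoint U) = FM N U * adj (FM N U)" "FM N (mat_adjoint U * U) = adj (FM N U) * FM N U"
    using U by (simp_all add: FM_mult FM_adjoint)
  moreover note FM_one[of N]
  ultimately show ?thesis using U unfolding unitary_mat_def uni_def by simp
qed

lemma FM_hermitian: "A \<in> carrier_mat N N \<Longrightarrow> hermitian_mat A \<longleftrightarrow> adj (FM N A) = FM N A"
  unfolding hermitian_mat_def by (metis FM_adjoint FM_inject adjoint_carrier)

lemma FM_trace: "A \<in> carrier_mat N N \<Longrightarrow> mtrace A = ftr N (FM N A)"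
  by (simp add: mtrace_def ftr_def ent_FM)

lemma FM_psd: "psd_mat N A \<longleftrightarrow> (\<forall>v. 0 \<le> Re (\<Sum>i<N. \<Sum>j<N. cnj (v i) * ent (FM N A) i j * v j))"
  unfolding psd_mat_def by (intro all_cong1 arg_cong[of _ _ "\<lambda>x. 0 \<le> Re x"] sum.cong refl) (simp add: ent_FM)

text \<open>Puts the quadratic form of \<open>psd_mat\<close> into the shape of an inner product
  with a fixed matrix, the shape handled by \<open>traj_invariant_bound\<close>.\<close>

lemma inner_rank_one:
  assumes "w = mkf N (\<lambda>i j. if j = 0 then v i else 0)" and A: "A \<in> crn N" and N: "0 < N"
  shows "inner (w * adj w) A = Re (\<Sum>i<N. \<Sum>j<N. cnj (v i) * ent A i j * v j)"
proof -
  have wc: "w \<in> crn N" using assms(1) by simp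
  have "ent (w * adj w) i j = v i * cnj (v j)" if ij: "i < N" "j < N" for i j
  proof -
    have "ent (w * adj w) i j = (\<Sum>k<N. if k = 0 then v i * cnj (v j) else 0)"
      unfolding ent_times_crn[OF wc] using ij by (intro sum.cong) (auto simp: assms(1) ent_mkf)
    then show ?thesis using N by simp
  qed
  then show ?thesis using wc
    by (subst inner_crn[of _ N]) (auto intro!: sum.cong simp: Re_sum mult_ac)
qed

lemma eigvals_desc_iff:
  assumes A: "A \<in> carrier_mat N N"
  shows "eigvals_desc N A l \<longleftrightarrow> length l = N \<and> sorted_wrt (\<ge>) l \<and> (\<exists>U\<in>uni N. FM N A = U * rdg N ((!) l) * adj U)"
proof -
  let ?D = "mat N N (\<lambda>(i,j). if i = j then complex_of_real (l ! i) else 0)"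
  have D: "?D \<in> carrier_mat N N" by simp
  have FU: "FM N (U * ?D * mat_adjoint U) = FM N U * rdg N ((!) l) * adj (FM N U)" if "U \<in> carrier_mat N N" for U
    using that FM_diag[of N "\<lambda>i. complex_of_real (l ! i)"] by (simp add: FM_mult[OF mult_carrier_mat] FM_mult FM_adjoint)
  have "(\<exists>U. unitary_mat N U \<and> A = U * ?D * mat_adjoint U) \<longleftrightarrow> (\<exists>U\<in>uni N. FM N A = U * rdg N ((!) l) * adj U)"
  proof
    assume "\<exists>U. unitary_mat N U \<and> A = U * ?D * mat_adjoint U"
    then obtain U where U: "unitary_mat N U" "A = U * ?D * mat_adjoint U" by blast
    then have Uc: "U \<in> carrier_mat N N" by (simp add: unitary_mat_def)
    have "FM N A = FM N U * rdg N ((!) l) * adj (FM N U)" by (subst U(2)) (rule FU[OF Uc])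
    moreover have "FM N U \<in> uni N" using FM_unitary[OF Uc] U(1) by blast
    ultimately show "\<exists>U\<in>uni N. FM N A = U * rdg N ((!) l) * adj U" by (intro bexI[of _ "FM N U"])
  next
    assume "\<exists>U\<in>uni N. FM N A = U * rdg N ((!) l) * adj U"
    then obtain U where U: "U \<in> uni N" "FM N A = U * rdg N ((!) l) * adj U" by blast
    have Uc: "MF N U \<in> carrier_mat N N" by simp
    have FMU: "FM N (MF N U) = U" using U by (simp add: FM_MF)
    have eq: "FM N A = FM N (MF N U * ?D * mat_adjoint (MF N U))" unfolding FU[OF Uc] FMU by (rule U(2))
    have "MF N U * ?D * mat_adjoint (MF N U) \<in> carrier_mat N N"
      using Uc D by (intro mult_carrier_mat[of _ N N]) auto
    then have "A = MF N U * ?D * mat_adjoint (MF N U)" using eq by (rule FM_inject[OF A])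
    moreover have "unitary_mat N (MF N U)" using FM_unitary[OF Uc] FMU U(1) by simp
    ultimately show "\<exists>U. unitary_mat N U \<and> A = U * ?D * mat_adjoint U" by blast
  qed
  then show ?thesis unfolding eigvals_desc_def by simp
qed

text \<open>The eigenvalues are sorted by a permutation matrix, which is absorbed into the
  diagonalising unitary.\<close>

lemma sorted_spectral:
  assumes A: "A \<in> crn N" "adj A = A"
  shows "\<exists>l. length l = N \<and> sorted_wrt (\<ge>) l \<and> (\<exists>U\<in>uni N. A = U * rdg N ((!) l) * adj U)"
proof -
  obtain V d where V: "V \<in> uni N" and Ad: "A = V * rdg N d * adj V"
    using hermitian_spectral[OF A] by blast
  define ys where "ys = map d [0..<N]"
  define l where "l = rev (sort ys)"
  have len: "length l = N" "length ys = N" by (simp_all add: l_def ys_def)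
  have srt: "sorted_wrt (\<ge>) l" unfolding l_def sorted_wrt_rev using sorted_sort[of ys] by (simp add: sorted_wrt_iff_nth_less sorted_iff_nth_mono_less)
  have "mset l = mset ys" by (simp add: l_def)
  then obtain \<pi> where \<pi>: "\<pi> permutes {..<length ys}" "permute_list \<pi> ys = l" by (metis mset_eq_permutation)
  have \<pi>b: "bij_betw \<pi> {..<N} {..<N}" using permutes_imp_bij[OF \<pi>(1)] len by simp
  have lnth: "l ! i = d (\<pi> i)" if "i < N" for i
  proof -
    have "\<pi> i < N" using bij_betwE[OF \<pi>b] that by simp
    then show ?thesis using permute_list_nth[OF \<pi>(1), of i] that \<pi>(2) len by (simp add: ys_def)
  qed
  define W where "W = spm N (\<lambda>_. 1) \<pi>"
  have W: "W \<in> uni N" unfolding W_def by (rule spm_uni[OF \<pi>b]) simp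
  have "W * rdg N d * adj W = dg N (\<lambda>i. of_real (d (\<pi> i)))"
    unfolding W_def by (rule spm_dg[OF \<pi>b]) simp
  also have "\<dots> = rdg N ((!) l)" using lnth by (intro dg_cong) simp
  finally have Wd: "rdg N ((!) l) = W * rdg N d * adj W" ..
  have "(V * adj W) * rdg N ((!) l) * adj (V * adj W) = V * (adj W * W) * rdg N d * (adj W * W) * adj V"
    unfolding Wd by (simp add: mult.assoc)
  also have "\<dots> = A" using W V Ad by simp
  finally have "A = (V * adj W) * rdg N ((!) l) * adj (V * adj W)" ..
  moreover have "V * adj W \<in> uni N" by (intro uni_closed V W)
  ultimately show ?thesis using len srt by blast
qed

lemma V_bitflip_FM:
  assumes "1 \<le> n"
  shows "V_bitflip n \<in> carrier_mat (qdim n) (qdim n)" "FM (qdim n) (V_bitflip n) = (1 / 2) *\<^sub>R flp (qdim n)"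
proof -
  have N: "2 ^ (n - 1) * 2 = qdim n" using assms by (cases n) (auto simp: qdim_def)
  show c: "V_bitflip n \<in> carrier_mat (qdim n) (qdim n)"
    unfolding V_bitflip_def kron_def sigma_x_def using N by auto
  show "FM (qdim n) (V_bitflip n) = (1 / 2) *\<^sub>R flp (qdim n)"
  proof (rule crn_eqI[of _ "qdim n"])
    fix i j assume ij: "i < qdim n" "j < qdim n"
    have d: "i div 2 < 2 ^ (n - 1)" "j div 2 < 2 ^ (n - 1)" using ij N by (auto simp: less_mult_imp_div_less)
    have "V_bitflip n $$ (i,j) = (if i div 2 = j div 2 \<and> i mod 2 \<noteq> j mod 2 then 1 / 2 else 0)"
      unfolding V_bitflip_def kron_def sigma_x_def using ij N d by auto
    also have "(i div 2 = j div 2 \<and> i mod 2 \<noteq> j mod 2) \<longleftrightarrow> j = ptn i"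
      unfolding div2_eq using even_ptn[of i] by (auto simp: mod2_eq_if)
    finally show "ent (FM (qdim n) (V_bitflip n)) i j = ent ((1 / 2) *\<^sub>R flp (qdim n)) i j"
      using ij by (simp add: ent_FM flp_def spm_def ent_mkf)
  qed (auto simp: flp_def)
qed

section \<open>The control system as an instance of the abstract setting\<close>

locale qsys =
  fixes n m :: nat and H :: "nat \<Rightarrow> complex mat" and gs :: real
  assumes n1: "n \<ge> 1"
    and H: "\<And>j. j \<le> m \<Longrightarrow> H j \<in> carrier_mat (qdim n) (qdim n) \<and> hermitian_mat (H j)"
    and lie: "lie_closure ((\<lambda>j. \<i> \<cdot>\<^sub>m H j) ` {0..m}) = su (qdim n)"
    and gs: "gs > 0"
begin

abbreviation N :: nat where "N \<equiv> qdim n"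

lemma N_even: "even N" and N2: "2 \<le> N"
  using n1 by (cases n; auto simp: qdim_def)+

definition Kf :: "(nat \<Rightarrow> real) \<Rightarrow> fmat" where "Kf u = cs (- \<i>) (FM N (ham N m H u))"

lemma FM_ham: "ham N m H u \<in> carrier_mat N N \<and> FM N (ham N m H u) = FM N (H 0) + (\<Sum>j=1..m. u j *\<^sub>R FM N (H j))"
proof -
  have "fold (\<lambda>j acc. acc + complex_of_real (u j) \<cdot>\<^sub>m H j) [1..<k+1] (0\<^sub>m N N) \<in> carrier_mat N N \<and>
    FM N (fold (\<lambda>j acc. acc + complex_of_real (u j) \<cdot>\<^sub>m H j) [1..<k+1] (0\<^sub>m N N)) = (\<Sum>j=1..k. u j *\<^sub>R FM N (H j))" if "k \<le> m" for k
    using that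
  proof (induction k)
    case 0
    then show ?case by (simp add: FM_zero)
  next
    case (Suc k)
    then have "H (Suc k) \<in> carrier_mat N N" using H by simp
    then show ?case using Suc by (simp add: FM_add FM_smult)
  qed
  from this[of m] H[of 0] show ?thesis unfolding ham_def by (simp add: FM_add)
qed

lemma Kf_expand: "Kf u = cs (- \<i>) (FM N (H 0)) + (\<Sum>j=1..m. u j *\<^sub>R cs (- \<i>) (FM N (H j)))"
proof -
  interpret C: additive "cs (- \<i>)" by standard (rule cs_add)
  show ?thesis unfolding Kf_def conjunct2[OF FM_ham] by (simp add: cs_add C.sum)
qed

lemma cs_i_skew: "j \<le> m \<Longrightarrow> cs (- \<i>) (FM N (H j)) \<in> skew N"
  unfolding skew_def using H[of j] FM_hermitian[of "H j" N] by (auto simp: cs_add intro!: fmat_eqI)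

lemma Kf_skew: "Kf u \<in> skew N"
proof -
  have "(\<Sum>j=1..k. u j *\<^sub>R cs (- \<i>) (FM N (H j))) \<in> skew N" if "k \<le> m" for k
    using that
  proof (induction k)
    case (Suc k)
    then show ?case using cs_i_skew[of "Suc k"] by (simp add: skew_def)
  qed (simp add: skew_def)
  from this[of m] cs_i_skew[of 0] show ?thesis unfolding Kf_expand by (simp add: skew_def)
qed

text \<open>The jump operator is half the flip, so both halves of the dissipator carry the factor
  1/4; the rate \<open>gs / 4\<close> accounts for it.\<close>

sublocale noisy N "flp N" "range Kf" "gs / 4"
  using flp_props[OF N_even] Kf_skew gs by unfold_locales auto

text \<open>A control Hamiltonian is never available without the drift. Tangent directions form a
  vector space, however, so the drift, obtained with zero controls, can be subtracted.\<close>

lemma gen_tang: "j \<le> m \<Longrightarrow> cs (- \<i>) (FM N (H j)) \<in> tang N (range Kf)"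
proof -
  assume j: "j \<le> m"
  note t = tang_gen[OF Ks] tang_add[OF Ks] tang_scaleR[OF Ks]
  have 0: "Kf (\<lambda>_. 0) = cs (- \<i>) (FM N (H 0))" by (simp add: Kf_expand)
  show ?thesis
  proof (cases "j = 0")
    case True
    then show ?thesis using t(1)[OF rangeI[of Kf "\<lambda>_. 0"]] unfolding 0 by simp
  next
    case False
    have "(\<Sum>i=1..m. (if i = j then 1 else 0) *\<^sub>R cs (- \<i>) (FM N (H i))) = (\<Sum>i=1..m. if i = j then cs (- \<i>) (FM N (H j)) else 0)"
      by (intro sum.cong) auto
    then have "cs (- \<i>) (FM N (H j)) = Kf (\<lambda>i. if i = j then 1 else 0) + (- 1) *\<^sub>R Kf (\<lambda>_. 0)"
      using False j unfolding 0 by (simp add: Kf_expand)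
    then show ?thesis by (simp only: t rangeI)
  qed
qed

lemma lie_tang: "A \<in> lie_closure ((\<lambda>j. \<i> \<cdot>\<^sub>m H j) ` {0..m}) \<Longrightarrow> A \<in> carrier_mat N N \<and> FM N A \<in> tang N (range Kf)"
proof (induction rule: lie_closure.induct)
  case (gen A)
  then obtain j where j: "j \<le> m" "A = \<i> \<cdot>\<^sub>m H j" by auto
  have "FM N A = (- 1) *\<^sub>R cs (- \<i>) (FM N (H j))" using j H[of j] by (auto simp: FM_smult intro!: fmat_eqI)
  then have "FM N A \<in> tang N (range Kf)" using tang_scaleR[OF Ks gen_tang[OF j(1)], of "- 1"] by simp
  then show ?case using j H[of j] by simp
next
  case (add A B)
  then show ?case using tang_add[OF Ks] by (simp add: FM_add)
next
  case (smult A r)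
  then show ?case using tang_scaleR[OF Ks] by (simp add: FM_smult)
next
  case (bracket A B)
  have "A * B \<in> carrier_mat N N" "B * A \<in> carrier_mat N N"
    using bracket by (auto intro!: mult_carrier_mat[of _ N N])
  with bracket show ?case using tang_bracket[OF Ks] by (simp add: commutator_def FM_diff FM_mult minus_carrier_mat)
qed

sublocale bitflip_controllable N "range Kf" "gs / 4"
proof unfold_locales
  have su: "A \<in> tang N (range Kf)" if "A \<in> skew N" "ftr N A = 0" for A
  proof -
    have Ac: "A \<in> crn N" using that skewD by blast
    have "FM N (mat_adjoint (MF N A)) = FM N (- MF N A)"
      using Ac skewD(2)[OF that(1)] by (simp add: FM_adjoint FM_uminus FM_MF)
    then have "mat_adjoint (MF N A) = - MF N A" by (rule FM_inject[rotated 2]) auto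
    moreover have "mtrace (MF N A) = 0" using that(2) Ac by (simp add: FM_trace[of _ N] FM_MF)
    ultimately have "MF N A \<in> su N" by (simp add: su_def)
    then show ?thesis using lie_tang[of "MF N A"] lie Ac by (simp add: FM_MF)
  qed
  show "\<exists>V\<in>grp N (range Kf). \<exists>z. cmod z = 1 \<and> norm (V - cs z U) < e" if "U \<in> uni N" "0 < e" for U e
    using grp_dense[OF Ks su that] N2 by simp
qed (use N_even N2 in auto)

lemma FM_rhs:
  assumes "\<rho> \<in> carrier_mat N N"
  shows "rhs n m H u g \<rho> \<in> carrier_mat N N" "FM N (rhs n m H u g \<rho>) = gen (Kf u) (g / 4) (FM N \<rho>)"
proof -
  let ?V = "V_bitflip n" and ?h = "ham N m H u"
  note V = V_bitflip_FM[OF n1]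
  have h: "?h \<in> carrier_mat N N" using FM_ham by blast
  have V2: "mat_adjoint ?V * ?V \<in> carrier_mat N N" using V by (intro mult_carrier_mat[of _ N N]) auto
  have c1: "commutator ?h \<rho> \<in> carrier_mat N N" using h assms by (simp add: commutator_def minus_carrier_mat)
  have c2: "?V * \<rho> * mat_adjoint ?V \<in> carrier_mat N N" using V assms by (intro mult_carrier_mat[of _ N N]) auto
  have c3: "mat_adjoint ?V * ?V * \<rho> + \<rho> * (mat_adjoint ?V * ?V) \<in> carrier_mat N N" using V2 assms by simp
  have c4: "lindblad ?V g \<rho> \<in> carrier_mat N N" unfolding lindblad_def by (intro smult_carrier_mat minus_carrier_mat c2)
  show "rhs n m H u g \<rho> \<in> carrier_mat N N" unfolding rhs_def using c1 c4 by simp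
  let ?A = "FM N \<rho>" and ?X = "flp N"
  have FV: "FM N ?V = (1 / 2) *\<^sub>R ?X" "FM N (mat_adjoint ?V) = (1 / 2) *\<^sub>R ?X"
    using V by (simp_all add: FM_adjoint)
  have FVV: "FM N (mat_adjoint ?V * ?V) = (1 / 4) *\<^sub>R eN N" using V FV XX by (simp add: FM_mult)
  have f2: "FM N (?V * \<rho> * mat_adjoint ?V) = (1 / 4) *\<^sub>R (?X * ?A * ?X)"
    using V assms FV by (simp add: FM_mult[of "?V * \<rho>"] FM_mult[of ?V])
  have f3: "FM N (mat_adjoint ?V * ?V * \<rho> + \<rho> * (mat_adjoint ?V * ?V)) = (1 / 2) *\<^sub>R ?A"
  proof -
    have "FM N (mat_adjoint ?V * ?V * \<rho> + \<rho> * (mat_adjoint ?V * ?V)) = (1 / 4) *\<^sub>R ?A + (1 / 4) *\<^sub>R ?A"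
      using V2 assms by (simp add: FM_add FM_mult[OF V2] FM_mult[OF _ V2] FVV)
    also have "\<dots> = (1 / 2) *\<^sub>R ?A" by (simp flip: scaleR_add_left)
    finally show ?thesis .
  qed
  have "FM N (lindblad ?V g \<rho>) = cs (of_real g) (cs (1 / 2) ((1 / 2) *\<^sub>R ?A) - (1 / 4) *\<^sub>R (?X * ?A * ?X))"
    unfolding lindblad_def FM_smult[OF minus_carrier_mat[OF c2]] FM_diff[OF smult_carrier_mat[OF c3] c2] FM_smult[OF c3] f2 f3 ..
  also have "\<dots> = (g / 4) *\<^sub>R (?A - ?X * ?A * ?X)"
    by (rule fmat_eqI) (simp add: algebra_simps)
  finally have f4: "FM N (lindblad ?V g \<rho>) = (g / 4) *\<^sub>R (?A - ?X * ?A * ?X)" .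
  have f1: "FM N (commutator ?h \<rho>) = FM N ?h * ?A - ?A * FM N ?h"
    using h assms by (simp add: commutator_def FM_diff FM_mult)
  have "FM N (rhs n m H u g \<rho>) = - (cs \<i> (FM N ?h * ?A - ?A * FM N ?h) + (g / 4) *\<^sub>R (?A - ?X * ?A * ?X))"
    unfolding rhs_def using c1 c4 by (simp add: FM_uminus FM_add FM_smult f1 f4)
  also have "\<dots> = gen (Kf u) (g / 4) ?A"
    unfolding gen_def Kf_def cs_simps by (rule fmat_eqI) (simp add: algebra_simps)
  finally show "FM N (rhs n m H u g \<rho>) = gen (Kf u) (g / 4) (FM N \<rho>)" .
qed

end

subsection \<open>Reachable states\<close>

context qsys
begin

lemma reach_refl: "\<rho>0 \<in> carrier_mat N N \<Longrightarrow> \<rho>0 \<in> reach n m H gs \<rho>0"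
  unfolding reach_def
  \<comment> \<open>Duration 0, with the only time declared exceptional, so that no differential
    equation has to hold.\<close>
  by (intro CollectI exI[of _ "0::real"] exI[of _ "{0::real}"] exI[of _ "\<lambda>_ _. 0::real"] exI[of _ "\<lambda>_. 0::real"] exI[of _ "\<lambda>_. \<rho>0"])
    (auto simp: pw_const_on_def)

lemma reach_carrier: "\<sigma> \<in> reach n m H gs \<rho>0 \<Longrightarrow> \<sigma> \<in> carrier_mat N N"
  unfolding reach_def by force

lemma pw_const_on_append:
  assumes "pw_const_on T S u"
  shows "pw_const_on (T + T') (insert T S) (\<lambda>s. if s < T then u s else w)"
  unfolding pw_const_on_def
proof (intro conjI allI impI)
  show "finite (insert T S)" using assms by (simp add: pw_const_on_def)
  fix a b assume ab: "0 \<le> a \<and> a \<le> b \<and> b \<le> T + T' \<and> {a..b} \<inter> insert T S = {}"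
  then have "T \<notin> {a..b}" "{a..b} \<inter> S = {}" by auto
  then have "b < T \<or> T < a" using ab by auto
  then show "(if a < T then u a else w) = (if b < T then u b else w)"
    using assms ab \<open>{a..b} \<inter> S = {}\<close> unfolding pw_const_on_def by auto
qed

lemma reach_extend:
  assumes \<sigma>: "\<sigma> \<in> reach n m H gs \<rho>0" and y: "sol (Kf w) c T' y" "y 0 = FM N \<sigma>" and c: "c \<in> {0, gs / 4}" and T': "0 \<le> T'"
  shows "MF N (y T') \<in> reach n m H gs \<rho>0"
proof -
  obtain T S u g x where T: "0 \<le> T" and pw: "pw_const_on T S u" "pw_const_on T S g" and g: "\<forall>t\<in>{0..T}. g t \<in> {0, gs}"
    and xc: "\<forall>t\<in>{0..T}. x t \<in> carrier_mat N N"
    and cont: "\<forall>i<N. \<forall>j<N. continuous_on {0..T} (\<lambda>t. x t $$ (i,j))"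
    and der: "\<forall>t\<in>{0..T} - S. \<forall>i<N. \<forall>j<N. ((\<lambda>s. x s $$ (i,j)) has_vector_derivative (rhs n m H (u t) (g t) (x t) $$ (i,j))) (at t within {0..T})"
    and x0: "x 0 = \<rho>0" and xT: "x T = \<sigma>"
    using \<sigma> unfolding reach_def by blast
  have \<sigma>c: "\<sigma> \<in> carrier_mat N N" by (rule reach_carrier[OF \<sigma>])
  define u' where "u' = (\<lambda>s. if s < T then u s else w)"
  \<comment> \<open>\<open>c\<close> is the rate in \<open>gen\<close>, which is a quarter of the
    noise amplitude.\<close>
  define g' where "g' = (\<lambda>s. if s < T then g s else 4 * c)"
  \<comment> \<open>The old branch keeps the junction time \<open>T\<close>; there both branches
    agree because \<open>y\<close> starts at the state reached, and \<open>T\<close> is added to the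
    exceptional times since the derivative may jump.\<close>
  define x' where "x' = (\<lambda>s. if s \<le> T then x s else MF N (y (s - T)))"
  have yT: "y t \<in> crn N" "(y has_vector_derivative gen (Kf w) c (y t)) (at t within {0..T'})" if "t \<in> {0..T'}" for t
    using y(1) that by (auto simp: sol_def)
  have ycont: "continuous_on {0..T'} y"
    unfolding continuous_on_eq_continuous_within using yT(2) has_vector_derivative_continuous by blast
  have x'_ent: "x' s $$ (i,j) = (if s \<le> T then x s $$ (i,j) else ent (y (s - T)) i j)" if "i < N" "j < N" for s i j
    using that by (simp add: x'_def index_MF)
  have "pw_const_on (T + T') (insert T S) u'" "pw_const_on (T + T') (insert T S) g'"
    unfolding u'_def g'_def by (intro pw_const_on_append pw)+
  moreover have "\<forall>t\<in>{0..T + T'}. g' t \<in> {0, gs}" using g c by (auto simp: g'_def)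
  moreover have "\<forall>t\<in>{0..T + T'}. x' t \<in> carrier_mat N N" using xc by (auto simp: x'_def)
  moreover have "\<forall>i<N. \<forall>j<N. continuous_on {0..T + T'} (\<lambda>t. x' t $$ (i,j))"
  proof (intro allI impI)
    fix i j assume ij: "i < N" "j < N"
    have "continuous_on {0..T + T'} (\<lambda>t. if t \<le> T then x t $$ (i,j) else ent (y (t - T)) i j)"
    proof (rule continuous_on_cases_le)
      have "{t \<in> {0..T + T'}. t \<le> T} = {0..T}" using T' by auto
      then show "continuous_on {t \<in> {0..T + T'}. t \<le> T} (\<lambda>t. x t $$ (i,j))" using cont ij by simp
      have "continuous_on {t \<in> {0..T + T'}. T \<le> t} (\<lambda>t. y (t - T))"
        by (rule continuous_on_compose2[OF ycont]) (auto intro!: continuous_intros)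
      then show "continuous_on {t \<in> {0..T + T'}. T \<le> t} (\<lambda>t. ent (y (t - T)) i j)"
        by (rule bounded_linear.continuous_on[OF bounded_linear_ent])
      show "x t $$ (i,j) = ent (y (t - T)) i j" if "t \<in> {0..T + T'}" "t = T" for t
        using that y(2) xT ij by (simp add: ent_FM)
    qed (rule continuous_on_id)
    then show "continuous_on {0..T + T'} (\<lambda>t. x' t $$ (i,j))" using x'_ent[OF ij] by simp
  qed
  moreover have "\<forall>t\<in>{0..T + T'} - insert T S. \<forall>i<N. \<forall>j<N. ((\<lambda>s. x' s $$ (i,j)) has_vector_derivative (rhs n m H (u' t) (g' t) (x' t) $$ (i,j))) (at t within {0..T + T'})"
  proof (intro ballI allI impI)
    fix t i j assume t: "t \<in> {0..T + T'} - insert T S" and ij: "i < N" "j < N"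
    show "((\<lambda>s. x' s $$ (i,j)) has_vector_derivative (rhs n m H (u' t) (g' t) (x' t) $$ (i,j))) (at t within {0..T + T'})"
    proof (cases "t < T")
      case True
      have "((\<lambda>s. x s $$ (i,j)) has_vector_derivative (rhs n m H (u t) (g t) (x t) $$ (i,j))) (at t within {0..T})"
        using der t ij True by auto
      moreover have "at t within {0..T} = at t within {0..T + T'}"
        by (rule at_within_nhd[of t "{..<T}"]) (use True T' in auto)
      ultimately have "((\<lambda>s. x s $$ (i,j)) has_vector_derivative (rhs n m H (u t) (g t) (x t) $$ (i,j))) (at t within {0..T + T'})" by simp
      then have "((\<lambda>s. x' s $$ (i,j)) has_vector_derivative (rhs n m H (u t) (g t) (x t) $$ (i,j))) (at t within {0..T + T'})"
        by (rule has_vector_derivative_transform_within[where d = "T - t"]) (use True t in \<open>auto simp: x'_def dist_real_def\<close>)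
      then show ?thesis using True by (simp add: u'_def g'_def x'_def)
    next
      case False
      then have tT: "T < t" using t by auto
      have sT: "t - T \<in> {0..T'}" using tT t by auto
      have "((\<lambda>s. s - T) has_vector_derivative 1) (at t within {T..T + T'})" by (auto intro!: derivative_eq_intros)
      moreover have "(y has_vector_derivative gen (Kf w) c (y (t - T))) (at (t - T) within (\<lambda>s. s - T) ` {T..T + T'})"
        using yT(2)[OF sT] by simp
      ultimately have "(y \<circ> (\<lambda>s. s - T) has_vector_derivative 1 *\<^sub>R gen (Kf w) c (y (t - T))) (at t within {T..T + T'})"
        by (rule vector_diff_chain_within)
      then have "((\<lambda>s. ent (y (s - T)) i j) has_vector_derivative ent (gen (Kf w) c (y (t - T))) i j) (at t within {T..T + T'})"
        using bounded_linear.has_vector_derivative[OF bounded_linear_ent] by (fastforce simp: o_def)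
      moreover have "at t within {T..T + T'} = at t within {0..T + T'}"
        by (rule at_within_nhd[of t "{T<..}"]) (use tT T in auto)
      ultimately have d1: "((\<lambda>s. ent (y (s - T)) i j) has_vector_derivative ent (gen (Kf w) c (y (t - T))) i j) (at t within {0..T + T'})" by simp
      have "((\<lambda>s. x' s $$ (i,j)) has_vector_derivative ent (gen (Kf w) c (y (t - T))) i j) (at t within {0..T + T'})"
        by (rule has_vector_derivative_transform_within[OF d1, where d = "t - T"])
          (use tT t x'_ent[OF ij] in \<open>auto simp: dist_real_def\<close>)
      moreover have "ent (gen (Kf w) c (y (t - T))) i j = rhs n m H (u' t) (g' t) (x' t) $$ (i,j)"
      proof -
        have x't: "x' t = MF N (y (t - T))" using tT by (simp add: x'_def)
        have "FM N (rhs n m H w (4 * c) (x' t)) = gen (Kf w) c (y (t - T))"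
          unfolding x't FM_rhs(2)[OF MF_carrier] using yT(1)[OF sT] by (simp add: FM_MF)
        then show ?thesis using tT ij by (simp add: u'_def g'_def flip: ent_FM)
      qed
      ultimately show ?thesis by simp
    qed
  qed
  moreover have "x' 0 = \<rho>0" using T x0 by (simp add: x'_def)
  moreover have "x' (T + T') = MF N (y T')"
  proof (cases "T' = 0")
    case True
    then show ?thesis using xT y(2) MF_FM[OF \<sigma>c] by (simp add: x'_def)
  qed (use T' in \<open>auto simp: x'_def\<close>)
  moreover have "0 \<le> T + T'" using T T' by simp
  ultimately show ?thesis unfolding reach_def by blast
qed

lemma ctl_reach:
  assumes \<rho>0: "\<rho>0 \<in> carrier_mat N N" and "f \<in> ctl"
  shows "MF N (f (FM N \<rho>0)) \<in> reach n m H gs \<rho>0"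
  using assms(2)
proof (induction rule: ctl.induct)
  case ctl_id
  then show ?case using reach_refl[OF \<rho>0] MF_FM[OF \<rho>0] by simp
next
  case (ctl_step f h)
  have hc: "h (FM N \<rho>0) \<in> crn N" using ctl_props[OF ctl_step(2)] by simp
  obtain w c T where w: "c \<in> {0, gs / 4}" "0 \<le> T" "\<forall>A\<in>crn N. \<exists>y. sol (Kf w) c T y \<and> y 0 = A \<and> y T = f A"
    using ctl_step(1) unfolding stepm_def by blast
  then obtain y where y: "sol (Kf w) c T y" "y 0 = h (FM N \<rho>0)" "y T = f (h (FM N \<rho>0))" using hc by blast
  have "y 0 = FM N (MF N (h (FM N \<rho>0)))" using y hc by (simp add: FM_MF)
  from reach_extend[OF ctl_step.IH y(1) this w(1,2)] show ?case using y(3) by simp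
qed

lemma cls_closure:
  assumes \<rho>0: "\<rho>0 \<in> carrier_mat N N" and \<rho>: "\<rho> \<in> carrier_mat N N" "FM N \<rho> \<in> cls (FM N \<rho>0)"
  shows "\<rho> \<in> mat_closure N (reach n m H gs \<rho>0)"
  unfolding mat_closure_def
proof (intro CollectI conjI \<rho>(1) allI impI)
  fix e :: real assume "e > 0"
  then obtain f where f: "f \<in> ctl" "norm (f (FM N \<rho>0) - FM N \<rho>) < e" using clsD[OF \<rho>(2)] by blast
  show "\<exists>\<sigma>\<in>reach n m H gs \<rho>0. \<forall>i<N. \<forall>j<N. cmod (\<sigma> $$ (i,j) - \<rho> $$ (i,j)) < e"
  proof (intro bexI[OF _ ctl_reach[OF \<rho>0 f(1)]] allI impI)
    fix i j assume ij: "i < N" "j < N"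
    have "cmod (ent (f (FM N \<rho>0) - FM N \<rho>) i j) < e" using cmod_ent_le f(2) le_less_trans by blast
    then show "cmod (MF N (f (FM N \<rho>0)) $$ (i,j) - \<rho> $$ (i,j)) < e" using ij by (simp add: index_MF ent_FM)
  qed
qed

lemma reach_traj:
  assumes "\<sigma> \<in> reach n m H gs \<rho>0"
  shows "\<exists>T S k g y. traj T S k g y \<and> y 0 = FM N \<rho>0 \<and> y T = FM N \<sigma>"
proof -
  obtain T S u g x where T: "0 \<le> T" and pw: "pw_const_on T S u" and g: "\<forall>t\<in>{0..T}. g t \<in> {0, gs}"
    and xc: "\<forall>t\<in>{0..T}. x t \<in> carrier_mat N N"
    and cont: "\<forall>i<N. \<forall>j<N. continuous_on {0..T} (\<lambda>t. x t $$ (i,j))"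
    and der: "\<forall>t\<in>{0..T} - S. \<forall>i<N. \<forall>j<N. ((\<lambda>s. x s $$ (i,j)) has_vector_derivative (rhs n m H (u t) (g t) (x t) $$ (i,j))) (at t within {0..T})"
    and x0: "x 0 = \<rho>0" and xT: "x T = \<sigma>"
    using assms unfolding reach_def by blast
  have "traj T S (\<lambda>t. Kf (u t)) (\<lambda>t. g t / 4) (\<lambda>t. FM N (x t))"
    unfolding traj_def
  proof (intro conjI ballI T)
    show "finite S" using pw by (simp add: pw_const_on_def)
    show "continuous_on {0..T} (\<lambda>t. FM N (x t))"
      by (rule continuous_on_crnI[of _ N]) (use cont in \<open>auto simp: ent_FM\<close>)
    show "Kf (u t) \<in> skew N" for t by (rule Kf_skew)
    show "0 \<le> g t / 4" if "t \<in> {0..T}" for t using g that gs by fastforce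
    fix t assume t: "t \<in> {0..T} - S"
    then have xt: "x t \<in> carrier_mat N N" using xc by auto
    show "((\<lambda>t. FM N (x t)) has_vector_derivative gen (Kf (u t)) (g t / 4) (FM N (x t))) (at t within {0..T})"
      unfolding FM_rhs(2)[OF xt, symmetric]
      by (rule has_vector_derivative_crnI[of _ N]) (use der t in \<open>auto simp: ent_FM\<close>)
  qed auto
  then show ?thesis using x0 xT by blast
qed

text \<open>The minus sign turns positivity into an upper bound, and the restriction to short
  vectors makes the family bounded, as \<open>traj_invariant_bound\<close> demands.\<close>

definition pos_family :: "fmat set" where
  "pos_family = {- (w * adj w) | w. colv N w \<and> norm w \<le> 1}"

text \<open>For \<open>k \<le> N\<close> these are the orthogonal projections of rank
  \<open>k\<close>; the supremum of their inner products with a Hermitian matrix is the sum of its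
  \<open>k\<close> largest eigenvalues.\<close>

definition ky_family :: "nat \<Rightarrow> fmat set" where
  "ky_family k = {U * prj N k * adj U | U. U \<in> uni N}"

lemma pos_family_props:
  assumes "P \<in> pos_family" shows "U \<in> uni N \<Longrightarrow> U * P * adj U \<in> pos_family" "norm P \<le> 1"
proof -
  obtain w where w: "P = - (w * adj w)" "colv N w" "norm w \<le> 1" using assms by (auto simp: pos_family_def)
  show "U * P * adj U \<in> pos_family" if U: "U \<in> uni N"
  proof -
    have "U * P * adj U = - ((U * w) * adj (U * w))" by (simp add: w mult.assoc)
    moreover have "colv N (U * w)" using w(2) U by (auto simp: colv_def ent_times_crn[OF uni_D(1)[OF U]])
    moreover have "norm (U * w) \<le> 1" using norm_uni_left[OF U, of w] w(2,3) by (simp add: colv_def)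
    ultimately show ?thesis unfolding pos_family_def by blast
  qed
  have "norm (w * adj w) \<le> norm w * norm w" using norm_mult_ineq[of w "adj w"] by simp
  also have "\<dots> \<le> 1 * 1" using w(3) by (intro mult_mono) auto
  finally show "norm P \<le> 1" by (simp add: w)
qed

lemma ky_family_props:
  assumes "P \<in> ky_family k" shows "U \<in> uni N \<Longrightarrow> U * P * adj U \<in> ky_family k" "norm P \<le> norm (prj N k)"
proof -
  obtain W where W: "P = W * prj N k * adj W" "W \<in> uni N" using assms by (auto simp: ky_family_def)
  show "U * P * adj U \<in> ky_family k" if U: "U \<in> uni N"
  proof -
    have "U * P * adj U = (U * W) * prj N k * adj (U * W)" by (simp add: W mult.assoc)
    then show ?thesis using uni_closed(3)[OF U W(2)] unfolding ky_family_def by blast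
  qed
  show "norm P \<le> norm (prj N k)" unfolding W(1) using norm_conj[OF W(2) prj_crn] by simp
qed

lemma psd_iff_pos_family: "psd_mat N A \<longleftrightarrow> (\<forall>P\<in>pos_family. inner P (FM N A) \<le> 0)"
proof
  assume psd: "psd_mat N A"
  show "\<forall>P\<in>pos_family. inner P (FM N A) \<le> 0"
  proof
    fix P assume "P \<in> pos_family"
    then obtain w where w: "P = - (w * adj w)" "colv N w" by (auto simp: pos_family_def)
    have "w = mkf N (\<lambda>i j. if j = 0 then ent w i 0 else 0)"
      using w(2) by (intro crn_eqI[of _ N]) (auto simp: colv_def ent_mkf)
    from inner_rank_one[OF this FM_crn] psd show "inner P (FM N A) \<le> 0" using N2 by (simp add: w(1) FM_psd)
  qed
next
  assume F: "\<forall>P\<in>pos_family. inner P (FM N A) \<le> 0"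
  show "psd_mat N A" unfolding FM_psd
  proof
    fix v
    define w where "w = mkf N (\<lambda>i j. if j = 0 then v i else 0)"
    \<comment> \<open>Scales the test vector into the unit ball; the added 1 admits the zero
      vector.\<close>
    define r where "r = 1 / (norm w + 1)"
    have r: "r > 0" by (simp add: r_def add_nonneg_pos)
    have "colv N (r *\<^sub>R w)" by (auto simp: colv_def w_def ent_mkf)
    moreover have "norm (r *\<^sub>R w) \<le> 1" using r by (simp add: r_def)
    ultimately have "- ((r *\<^sub>R w) * adj (r *\<^sub>R w)) \<in> pos_family" unfolding pos_family_def by blast
    then have "0 \<le> (r * r) * inner (w * adj w) (FM N A)" using F by fastforce
    then have "0 \<le> inner (w * adj w) (FM N A)"
      using mult_pos_pos[OF r r] by (meson mult_pos_neg not_le)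
    then show "0 \<le> Re (\<Sum>i<N. \<Sum>j<N. cnj (v i) * ent (FM N A) i j * v j)"
      using inner_rank_one[OF w_def FM_crn] N2 by simp
  qed
qed

text \<open>Expressed through equalities and inequalities that are closed and preserved along
  trajectories, so that it contains the reachable states and their limits alike.\<close>

definition admissible :: "real list \<Rightarrow> fmat set" where
  "admissible l0 = {A. adj A = A \<and> ftr N A = 1 \<and> (\<forall>P\<in>pos_family. inner P A \<le> 0) \<and>
     (\<forall>k\<le>N. \<forall>P\<in>ky_family k. inner P A \<le> (\<Sum>i<k. l0 ! i))}"

lemma closed_admissible: "closed (admissible l0)"
proof -
  have "admissible l0 = {A. adj A = A} \<inter> {A. ftr N A = 1} \<inter> (\<Inter>P\<in>pos_family. {A. inner P A \<le> 0}) \<inter>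
     (\<Inter>k\<in>{..N}. \<Inter>P\<in>ky_family k. {A. inner P A \<le> (\<Sum>i<k. l0 ! i)})"
    by (auto simp: admissible_def)
  moreover have "closed {A. adj A = A}"
    by (intro closed_Collect_eq bounded_linear.continuous_on[OF bounded_linear_adj] continuous_intros)
  moreover have "closed {A. ftr N A = 1}"
    by (intro closed_Collect_eq bounded_linear.continuous_on[OF bounded_linear_ftr] continuous_intros)
  moreover have "closed {A :: fmat. inner P A \<le> b}" for P b
    by (intro closed_Collect_le continuous_intros)
  ultimately show ?thesis by (auto intro!: closed_Int closed_INT)
qed

lemma admissible_initial:
  assumes \<rho>0: "\<rho>0 \<in> density_mats N" and l0: "eigvals_desc N \<rho>0 l0"
  shows "FM N \<rho>0 \<in> admissible l0"
proof -
  have c: "\<rho>0 \<in> carrier_mat N N" using \<rho>0 by (simp add: density_mats_def)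
  obtain V where V: "length l0 = N" "sorted_wrt (\<ge>) l0" "V \<in> uni N" "FM N \<rho>0 = V * rdg N ((!) l0) * adj V"
    using l0 unfolding eigvals_desc_iff[OF c] by blast
  have mono: "l0 ! j \<le> l0 ! i" if "i \<le> j" "j < N" for i j
    using V(1,2) that by (cases "i = j") (auto simp: sorted_wrt_iff_nth_less)
  have "inner P (FM N \<rho>0) \<le> (\<Sum>i<k. l0 ! i)" if k: "k \<le> N" and P: "P \<in> ky_family k" for k P
  proof -
    obtain W where W: "P = W * prj N k * adj W" "W \<in> uni N" using P by (auto simp: ky_family_def)
    show ?thesis unfolding W(1) V(4) using ky_fan[OF W(2) V(3) k] mono by blast
  qed
  moreover have "adj (FM N \<rho>0) = FM N \<rho>0" "ftr N (FM N \<rho>0) = 1" "\<forall>P\<in>pos_family. inner P (FM N \<rho>0) \<le> 0"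
    using \<rho>0 FM_hermitian[OF c] FM_trace[OF c] psd_iff_pos_family[of \<rho>0] by (simp_all add: density_mats_def)
  ultimately show ?thesis by (simp add: admissible_def)
qed

lemma admissible_reach:
  assumes "FM N \<rho>0 \<in> admissible l0" "\<sigma> \<in> reach n m H gs \<rho>0"
  shows "FM N \<sigma> \<in> admissible l0"
proof -
  obtain T S k g y where tr: "traj T S k g y" and y: "y 0 = FM N \<rho>0" "y T = FM N \<sigma>"
    using reach_traj[OF assms(2)] by blast
  note a = assms(1)[unfolded admissible_def mem_Collect_eq]
  have "adj (y T) = y T" by (rule traj_hermitian[OF tr]) (use a y in simp)
  moreover have "ftr N (y T) = 1" using traj_trace[OF tr] a y by simp
  moreover have "inner P (y T) \<le> 0" if P: "P \<in> pos_family" for P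
    by (rule traj_invariant_bound[OF tr pos_family_props _ P]) (use a y in auto)
  moreover have "inner P (y T) \<le> (\<Sum>i<k. l0 ! i)" if k: "k \<le> N" and P: "P \<in> ky_family k" for k P
    by (rule traj_invariant_bound[OF tr ky_family_props _ P]) (use a y k in auto)
  ultimately show ?thesis using y by (simp add: admissible_def)
qed

lemma mat_closure_FM:
  assumes \<rho>: "\<rho> \<in> mat_closure N R" and "closed C" and "\<And>\<sigma>. \<sigma> \<in> R \<Longrightarrow> FM N \<sigma> \<in> C"
  shows "FM N \<rho> \<in> C"
proof -
  have "\<exists>A\<in>C. dist A (FM N \<rho>) < e" if e: "e > 0" for e
  proof -
    \<comment> \<open>The Frobenius norm is at most \<open>N\<close> times the largest entry; the
      factor 2 leaves room for the strict inequality.\<close>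
    define r where "r = e / (2 * real N)"
    have N0: "real N > 0" using N2 by simp
    have r: "r > 0" using e N0 by (simp add: r_def)
    obtain \<sigma> where \<sigma>: "\<sigma> \<in> R" "\<forall>i<N. \<forall>j<N. cmod (\<sigma> $$ (i,j) - \<rho> $$ (i,j)) < r"
      using \<rho> r unfolding mat_closure_def by blast
    have d: "FM N \<sigma> - FM N \<rho> \<in> crn N" by simp
    have "(norm (FM N \<sigma> - FM N \<rho>))\<^sup>2 \<le> (\<Sum>i<N. \<Sum>j<N. r\<^sup>2)"
      unfolding norm_crn[OF d] using \<sigma>(2) by (intro sum_mono power_mono) (auto simp: ent_FM less_imp_le)
    also have "\<dots> = (real N * r)\<^sup>2" by (simp add: power2_eq_square)
    finally have "norm (FM N \<sigma> - FM N \<rho>) \<le> real N * r" by (rule power2_le_imp_le) (use r N0 in simp)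
    also have "\<dots> = e / 2" using N0 by (simp add: r_def)
    also have "\<dots> < e" using e by simp
    finally show ?thesis using assms(3)[OF \<sigma>(1)] by (auto simp: dist_norm)
  qed
  then have "FM N \<rho> \<in> closure C" by (simp add: closure_approachable)
  then show ?thesis using assms(2) by simp
qed

lemma admissible_majorised:
  assumes \<rho>: "\<rho> \<in> carrier_mat N N" "FM N \<rho> \<in> admissible l0" and l0: "eigvals_desc N \<rho>0 l0" "\<rho>0 \<in> density_mats N"
  shows "\<rho> \<in> density_mats N" "majorised N \<rho> \<rho>0"
proof -
  note a = \<rho>(2)[unfolded admissible_def mem_Collect_eq]
  show "\<rho> \<in> density_mats N"
    using a \<rho>(1) FM_hermitian[OF \<rho>(1)] FM_trace[OF \<rho>(1)] psd_iff_pos_family[of \<rho>] by (simp add: density_mats_def)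
  obtain l U where l: "length l = N" "sorted_wrt (\<ge>) l" and U: "U \<in> uni N" "FM N \<rho> = U * rdg N ((!) l) * adj U"
    using sorted_spectral[OF FM_crn[of N \<rho>]] a by blast
  have el: "eigvals_desc N \<rho> l" unfolding eigvals_desc_iff[OF \<rho>(1)] using l U by blast
  have ll0: "length l0 = N" using l0(1) by (simp add: eigvals_desc_def)
  have tk: "sum_list (take k xs) = (\<Sum>i<k. xs ! i)" if "k \<le> length xs" for k and xs :: "real list"
    using that by (simp add: sum_list_sum_nth atLeast0LessThan)
  have "sum_list (take k l) \<le> sum_list (take k l0)" if k: "k \<le> N" for k
  proof -
    \<comment> \<open>The projection onto the leading \<open>k\<close> eigenvectors of the state
      itself: its inner product with the state is exactly the sum of the \<open>k\<close> largest
      eigenvalues.\<close>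
    have "U * prj N k * adj U \<in> ky_family k" using U unfolding ky_family_def by blast
    then have "inner (U * prj N k * adj U) (FM N \<rho>) \<le> (\<Sum>i<k. l0 ! i)" using a k by blast
    also have "inner (U * prj N k * adj U) (FM N \<rho>) = inner (prj N k) (adj U * FM N \<rho> * U)" by (rule inner_conj)
    also have "adj U * FM N \<rho> * U = rdg N ((!) l)" by (rule spectral_middle[OF U, symmetric])
    also have "inner (prj N k) \<dots> = (\<Sum>i<k. l ! i)" unfolding inner_prj[OF k] using k by (intro sum.cong) (auto simp: ent_dg)
    finally show ?thesis using tk[of k l] tk[of k l0] k l ll0 by simp
  qed
  moreover have "sum_list l = sum_list l0"
  proof -
    have tr: "of_real (sum_list xs) = ftr N B" if "length xs = N" "W \<in> uni N" "B = W * rdg N ((!) xs) * adj W" for xs W B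
    proof -
      have "ftr N B = (\<Sum>i<N. of_real (xs ! i))" unfolding that(3) ftr_conj[OF that(2) dg_crn] by (simp add: ftr_def ent_dg)
      then show ?thesis using tk[of N xs] that(1) by (simp flip: of_real_sum)
    qed
    have c: "\<rho>0 \<in> carrier_mat N N" using l0(2) by (simp add: density_mats_def)
    obtain V where V: "V \<in> uni N" "FM N \<rho>0 = V * rdg N ((!) l0) * adj V"
      using l0(1) unfolding eigvals_desc_iff[OF c] by blast
    have "complex_of_real (sum_list l) = 1" using tr[OF l(1) U] a by simp
    moreover have "complex_of_real (sum_list l0) = 1" using tr[OF ll0 V] l0(2) FM_trace[OF c] by (simp add: density_mats_def)
    ultimately show ?thesis by (metis of_real_eq_iff)
  qed
  ultimately show "majorised N \<rho> \<rho>0" unfolding majorised_def using el l0(1) by blast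
qed

lemma majorised_cls:
  assumes c: "\<rho> \<in> carrier_mat N N" "\<rho>0 \<in> carrier_mat N N" and "majorised N \<rho> \<rho>0"
  shows "FM N \<rho> \<in> cls (FM N \<rho>0)"
proof -
  obtain l l0 where l: "eigvals_desc N \<rho> l" "eigvals_desc N \<rho>0 l0"
    "\<forall>k\<le>N. sum_list (take k l) \<le> sum_list (take k l0)" "sum_list l = sum_list l0"
    using assms(3) unfolding majorised_def by blast
  obtain U V where U: "U \<in> uni N" "FM N \<rho> = U * rdg N ((!) l) * adj U"
    and V: "V \<in> uni N" "FM N \<rho>0 = V * rdg N ((!) l0) * adj V"
    and len: "length l = N" "length l0 = N" and srt: "sorted_wrt (\<ge>) l"
    using l(1,2) unfolding eigvals_desc_iff[OF c(1)] eigvals_desc_iff[OF c(2)] by blast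
  have tk: "sum_list (take k xs) = (\<Sum>i<k. xs ! i)" if "k \<le> length xs" for k and xs :: "real list"
    using that by (simp add: sum_list_sum_nth atLeast0LessThan)
  show ?thesis unfolding U(2) V(2)
  proof (rule spectral_majorized_cls[OF U(1) V(1)])
    show "l ! j \<le> l ! i" if "i \<le> j" "j < N" for i j
      using srt len that by (cases "i = j") (auto simp: sorted_wrt_iff_nth_less)
    show "(\<Sum>i<k. l ! i) \<le> (\<Sum>i<k. l0 ! i)" if "k \<le> N" for k
      using l(3)[rule_format, OF that] tk[of k l] tk[of k l0] len that by simp
    show "(\<Sum>i<N. l ! i) = (\<Sum>i<N. l0 ! i)" using l(4) tk[of N l] tk[of N l0] len by simp
  qed
qed

theorem closure_reach:
  assumes \<rho>0: "\<rho>0 \<in> density_mats N"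
  shows "mat_closure N (reach n m H gs \<rho>0) = {\<rho> \<in> density_mats N. majorised N \<rho> \<rho>0}"
proof (intro equalityI subsetI)
  have c: "\<rho>0 \<in> carrier_mat N N" and h: "adj (FM N \<rho>0) = FM N \<rho>0"
    using \<rho>0 FM_hermitian[of \<rho>0 N] by (auto simp: density_mats_def)
  obtain l0 where l0: "eigvals_desc N \<rho>0 l0" using sorted_spectral[OF FM_crn h] eigvals_desc_iff[OF c] by blast
  fix \<rho>
  {
    assume \<rho>: "\<rho> \<in> mat_closure N (reach n m H gs \<rho>0)"
    then have "FM N \<rho> \<in> admissible l0"
      by (rule mat_closure_FM[OF _ closed_admissible admissible_reach[OF admissible_initial[OF \<rho>0 l0]]])
    moreover have "\<rho> \<in> carrier_mat N N" using \<rho> by (simp add: mat_closure_def)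
    ultimately show "\<rho> \<in> {\<rho> \<in> density_mats N. majorised N \<rho> \<rho>0}" using admissible_majorised[OF _ _ l0 \<rho>0] by blast
  next
    assume "\<rho> \<in> {\<rho> \<in> density_mats N. majorised N \<rho> \<rho>0}"
    then have "\<rho> \<in> carrier_mat N N" "majorised N \<rho> \<rho>0" by (auto simp: density_mats_def)
    then show "\<rho> \<in> mat_closure N (reach n m H gs \<rho>0)" using cls_closure[OF c] majorised_cls[OF _ c] by blast
  }
qed

end

theorem theorem2:
  fixes n m :: nat and H :: "nat \<Rightarrow> complex mat" and gs :: real and \<rho>0 :: "complex mat"
  assumes "n \<ge> 1"
    and "\<forall>j\<le>m. H j \<in> carrier_mat (qdim n) (qdim n) \<and> hermitian_mat (H j)"
    and "lie_closure ((\<lambda>j. \<i> \<cdot>\<^sub>m H j) ` {0..m}) = su (qdim n)"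
    and "\<forall>i<qdim n. \<forall>j<qdim n. i \<noteq> j \<longrightarrow> H 0 $$ (i,j) = 0"
    and "gs > 0"
    and "\<rho>0 \<in> density_mats (qdim n)"
  shows "mat_closure (qdim n) (reach n m H gs \<rho>0) =
           {\<rho> \<in> density_mats (qdim n). majorised (qdim n) \<rho> \<rho>0}"
proof -
  interpret qsys n m H gs using assms by unfold_locales auto
  show ?thesis by (rule closure_reach[OF assms(6)])
qed

end
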